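(* Let $n\ge1$, let $s>0$ be a real number, and let $B,Q$ be real $n\times n$ matrices with $Q$ symmetric positive semidefinite. Let $\mathcal P=\frac12\operatorname{Tr}^s(-Q\nabla_x^2)+\langle Bx,\nabla_x\rangle$ be the associated fractional Ornstein-Uhlenbeck operator on $L^2(\mathbb R^n)$, equipped with the domain $D(\mathcal P)=\{u\in L^2(\mathbb R^n):\mathcal Pu\in L^2(\mathbb R^n)\}$, and let $(e^{-t\mathcal P})_{t\ge0}$ be the strongly continuous semigroup it generates on $L^2(\mathbb R^n)$. Let $S=\bigcap_{j=0}^{n-1}\operatorname{Ker}\big(\sqrt Q(B^T)^j\big)\subset\mathbb R^n$. If there exist $t>0$ and $\xi_0\in\mathbb R^n$ such that the operator $\langle\xi_0,\nabla_x\rangle e^{-t\mathcal P}$ is bounded on $L^2(\mathbb R^n)$, then $\xi_0\in S^{\perp}$.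
   Context: The operator $\operatorname{Tr}^s(-Q\nabla_x^2)$ is the Fourier multiplier with symbol $\xi\mapsto\langle Q\xi,\xi\rangle^s$, and $\langle Bx,\nabla_x\rangle=\sum_{i=1}^n\sum_{j=1}^nB_{i,j}x_j\partial_{x_i}$ with $B=(B_{i,j})$. The expression $\mathcal Pu$ for $u\in L^2(\mathbb R^n)$ is understood in the sense of distributions. It is known that $-\mathcal P$ with domain $D(\mathcal P)$ is the generator of a strongly continuous semigroup on $L^2(\mathbb R^n)$, denoted $(e^{-t\mathcal P})_{t\ge0}$. $\langle\cdot,\cdot\rangle$ is the canonical Euclidean scalar product on $\mathbb R^n$, $S^\perp$ is the orthogonal complement of $S$ for it, $\sqrt Q$ is the positive semidefinite square root of $Q$, and $\langle\xi_0,\nabla_x\rangle=\sum_j(\xi_0)_j\partial_{x_j}$. *)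

theory Defs
  imports "HOL-Analysis.Analysis"
begin

section \<open>The Hilbert space of square-integrable functions modulo null sets\<close>

definition square_integrable :: "(real ^ 'n \<Rightarrow> complex) \<Rightarrow> bool" where
  "square_integrable f \<longleftrightarrow>
     f \<in> borel_measurable lborel \<and> integrable lborel (\<lambda>x. (cmod (f x))\<^sup>2)"

definition L2_rel :: "(real ^ 'n \<Rightarrow> complex) \<Rightarrow> (real ^ 'n \<Rightarrow> complex) \<Rightarrow> bool" where
  "L2_rel f g \<longleftrightarrow> square_integrable f \<and> square_integrable g \<and> (AE x in lborel. f x = g x)"

lemma square_integrable_add:
  assumes "square_integrable f" "square_integrable g"
  shows "square_integrable (\<lambda>x. f x + g x)"
proof -
  have [measurable]: "f \<in> borel_measurable lborel" "g \<in> borel_measurable lborel"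
    using assms by (auto simp: square_integrable_def)
  have "integrable lborel (\<lambda>x. (cmod (f x + g x))\<^sup>2)"
  proof (rule Bochner_Integration.integrable_bound)
    show "integrable lborel (\<lambda>x. 2 * (cmod (f x))\<^sup>2 + 2 * (cmod (g x))\<^sup>2)"
      using assms by (auto simp: square_integrable_def)
    show "AE x in lborel. norm ((cmod (f x + g x))\<^sup>2)
            \<le> norm (2 * (cmod (f x))\<^sup>2 + 2 * (cmod (g x))\<^sup>2)"
    proof (rule AE_I2)
      fix x
      have "(cmod (f x + g x))\<^sup>2 \<le> (cmod (f x) + cmod (g x))\<^sup>2"
        by (intro power_mono norm_triangle_ineq) auto
      also have "\<dots> \<le> 2 * (cmod (f x))\<^sup>2 + 2 * (cmod (g x))\<^sup>2"
        using sum_squares_bound[of "cmod (f x)" "cmod (g x)"] by (simp add: power2_sum)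
      finally show "norm ((cmod (f x + g x))\<^sup>2)
            \<le> norm (2 * (cmod (f x))\<^sup>2 + 2 * (cmod (g x))\<^sup>2)" by simp
    qed
  qed measurable
  then show ?thesis by (auto simp: square_integrable_def)
qed

lemma square_integrable_scale:
  assumes "square_integrable f"
  shows "square_integrable (\<lambda>x. c * f x)"
  using assms by (auto simp: square_integrable_def norm_mult power_mult_distrib)

lemma square_integrable_zero: "square_integrable (\<lambda>x. 0)"
  by (auto simp: square_integrable_def)

lemma square_integrable_mult:
  assumes "square_integrable f" "square_integrable g"
  shows "integrable lborel (\<lambda>x. f x * g x)"
proof (rule Bochner_Integration.integrable_bound)
  have [measurable]: "f \<in> borel_measurable lborel" "g \<in> borel_measurable lborel"
    using assms by (auto simp: square_integrable_def)
  show "(\<lambda>x. f x * g x) \<in> borel_measurable lborel" by measurable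
  show "integrable lborel (\<lambda>x. (cmod (f x))\<^sup>2 + (cmod (g x))\<^sup>2)"
    using assms by (auto simp: square_integrable_def)
  show "AE x in lborel. norm (f x * g x) \<le> norm ((cmod (f x))\<^sup>2 + (cmod (g x))\<^sup>2)"
  proof (rule AE_I2)
    fix x
    have "2 * (cmod (f x) * cmod (g x)) \<le> (cmod (f x))\<^sup>2 + (cmod (g x))\<^sup>2"
      using sum_squares_bound[of "cmod (f x)" "cmod (g x)"] by simp
    moreover have "0 \<le> cmod (f x) * cmod (g x)" by simp
    ultimately have "cmod (f x) * cmod (g x) \<le> (cmod (f x))\<^sup>2 + (cmod (g x))\<^sup>2" by linarith
    then show "norm (f x * g x) \<le> norm ((cmod (f x))\<^sup>2 + (cmod (g x))\<^sup>2)"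
      by (simp add: norm_mult)
  qed
qed

lemma square_integrable_cnj:
  assumes "square_integrable f"
  shows "square_integrable (\<lambda>x. cnj (f x))"
  using assms by (auto simp: square_integrable_def intro: borel_measurable_continuous_onI
      measurable_compose[OF _ borel_measurable_continuous_onI] continuous_intros)

quotient_type 'n L2 = "real ^ 'n::finite \<Rightarrow> complex" / partial: L2_rel
proof (rule part_equivpI)
  show "\<exists>f :: real ^ 'n \<Rightarrow> complex. L2_rel f f"
    by (rule exI[of _ "\<lambda>x. 0"]) (simp add: L2_rel_def square_integrable_zero)
  show "symp (L2_rel :: (real ^ 'n \<Rightarrow> complex) \<Rightarrow> _)"
    by (rule sympI) (auto simp: L2_rel_def)
  show "transp (L2_rel :: (real ^ 'n \<Rightarrow> complex) \<Rightarrow> _)"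
    by (rule transpI) (auto simp: L2_rel_def)
qed

instantiation L2 :: (finite) real_vector
begin

lift_definition zero_L2 :: "'a L2" is "\<lambda>x. 0"
  by (simp add: L2_rel_def square_integrable_zero)

lift_definition plus_L2 :: "'a L2 \<Rightarrow> 'a L2 \<Rightarrow> 'a L2" is "\<lambda>f g x. f x + g x"
  by (auto simp: L2_rel_def square_integrable_add)

lift_definition scaleR_L2 :: "real \<Rightarrow> 'a L2 \<Rightarrow> 'a L2" is "\<lambda>r f x. complex_of_real r * f x"
  by (auto simp: L2_rel_def square_integrable_scale)

lift_definition uminus_L2 :: "'a L2 \<Rightarrow> 'a L2" is "\<lambda>f x. - f x"
  using square_integrable_scale[where c = "-1"] by (auto simp: L2_rel_def)

lift_definition minus_L2 :: "'a L2 \<Rightarrow> 'a L2 \<Rightarrow> 'a L2" is "\<lambda>f g x. f x - g x"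
  using square_integrable_add square_integrable_scale[where c = "-1"]
  by (fastforce simp: L2_rel_def)

instance
proof
  fix u v w :: "'a L2" and a b :: real
  show "u + v + w = u + (v + w)"
    by transfer (auto simp: L2_rel_def square_integrable_add algebra_simps)
  show "u + v = v + u"
    by transfer (auto simp: L2_rel_def square_integrable_add algebra_simps)
  show "0 + u = u"
    by transfer (auto simp: L2_rel_def)
  show "- u + u = 0"
    by transfer (use square_integrable_zero in \<open>auto simp: L2_rel_def\<close>)
  show "u - v = u + - v"
    by transfer (use square_integrable_add square_integrable_scale[where c = "-1"] in
      \<open>fastforce simp: L2_rel_def\<close>)
  show "a *\<^sub>R (u + v) = a *\<^sub>R u + a *\<^sub>R v"
    by transfer (auto simp: L2_rel_def distrib_left
        intro!: square_integrable_add square_integrable_scale)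
  show "(a + b) *\<^sub>R u = a *\<^sub>R u + b *\<^sub>R u"
  proof transfer
    fix a b :: real and f :: "real ^ 'a \<Rightarrow> complex"
    assume "L2_rel f f"
    then have f: "square_integrable f" by (simp add: L2_rel_def)
    show "L2_rel (\<lambda>x. complex_of_real (a + b) * f x)
            (\<lambda>x. complex_of_real a * f x + complex_of_real b * f x)"
      using square_integrable_scale[OF f, of "complex_of_real (a + b)"]
      by (simp add: L2_rel_def algebra_simps)
  qed
  show "a *\<^sub>R b *\<^sub>R u = (a * b) *\<^sub>R u"
  proof transfer
    fix a b :: real and f :: "real ^ 'a \<Rightarrow> complex"
    assume "L2_rel f f"
    then have f: "square_integrable f" by (simp add: L2_rel_def)
    show "L2_rel (\<lambda>x. complex_of_real a * (complex_of_real b * f x))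
            (\<lambda>x. complex_of_real (a * b) * f x)"
      using square_integrable_scale[OF f, of "complex_of_real (a * b)"]
      by (simp add: L2_rel_def algebra_simps)
  qed
  show "1 *\<^sub>R u = u" by transfer (auto simp: L2_rel_def)
qed

end

instantiation L2 :: (finite) real_inner
begin

text \<open>The class \<open>real_inner\<close> is real-valued: this is the real part of the Hermitian product,
  which induces the usual norm.\<close>

lift_definition inner_L2 :: "'a L2 \<Rightarrow> 'a L2 \<Rightarrow> real"
  is "\<lambda>f g. Re (\<integral>x. f x * cnj (g x) \<partial>lborel)"
proof -
  fix f f' g g' :: "real ^ 'a \<Rightarrow> complex"
  assume a: "L2_rel f f'" "L2_rel g g'"
  have [measurable]: "f \<in> borel_measurable lborel" "g \<in> borel_measurable lborel"
    "f' \<in> borel_measurable lborel" "g' \<in> borel_measurable lborel"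
    using a by (auto simp: L2_rel_def square_integrable_def)
  have *: "(\<lambda>x. cnj (g x)) \<in> borel_measurable lborel"
     "(\<lambda>x. cnj (g' x)) \<in> borel_measurable lborel"
    using square_integrable_cnj[of g] square_integrable_cnj[of g'] a
    by (auto simp: L2_rel_def square_integrable_def)
  have "(\<integral>x. f x * cnj (g x) \<partial>lborel) = (\<integral>x. f' x * cnj (g' x) \<partial>lborel)"
  proof (rule integral_cong_AE)
    show "(\<lambda>x. f x * cnj (g x)) \<in> borel_measurable lborel"
      "(\<lambda>x. f' x * cnj (g' x)) \<in> borel_measurable lborel"
      using * by measurable
    have "AE x in lborel. f x = f' x" "AE x in lborel. g x = g' x"
      using a by (auto simp: L2_rel_def)
    then show "AE x in lborel. f x * cnj (g x) = f' x * cnj (g' x)"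
      by eventually_elim simp
  qed
  then show "Re (\<integral>x. f x * cnj (g x) \<partial>lborel) = Re (\<integral>x. f' x * cnj (g' x) \<partial>lborel)" by simp
qed

definition norm_L2 :: "'a L2 \<Rightarrow> real" where "norm_L2 u = sqrt (inner u u)"

definition dist_L2 :: "'a L2 \<Rightarrow> 'a L2 \<Rightarrow> real" where "dist_L2 u v = norm (u - v)"

definition sgn_L2 :: "'a L2 \<Rightarrow> 'a L2" where "sgn_L2 u = u /\<^sub>R norm u"

definition uniformity_L2 :: "('a L2 \<times> 'a L2) filter" where
  "uniformity_L2 = (INF e\<in>{0<..}. principal {(u, v). dist u v < e})"

definition open_L2 :: "'a L2 set \<Rightarrow> bool" where
  "open_L2 U \<longleftrightarrow> (\<forall>u\<in>U. eventually (\<lambda>(u', v). u' = u \<longrightarrow> v \<in> U) uniformity)"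

instance
proof
  fix u v w :: "'a L2" and a :: real
  show "sgn u = u /\<^sub>R norm u" by (simp add: sgn_L2_def)
  show "dist u v = norm (u - v)" by (simp add: dist_L2_def)
  show "uniformity = (INF e\<in>{0<..}. principal {(u :: 'a L2, v). dist u v < e})"
    by (simp add: uniformity_L2_def)
  show "open U \<longleftrightarrow> (\<forall>u\<in>U. eventually (\<lambda>(u', v). u' = u \<longrightarrow> v \<in> U) uniformity)"
    for U :: "'a L2 set" by (simp add: open_L2_def)
  show "inner u v = inner v u"
  proof transfer
    fix f g :: "real ^ 'a \<Rightarrow> complex"
    have "(\<integral>x. g x * cnj (f x) \<partial>lborel) = cnj (\<integral>x. f x * cnj (g x) \<partial>lborel)"
      by (subst Bochner_Integration.integral_cnj[symmetric]) (simp add: mult.commute)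
    then show "Re (\<integral>x. f x * cnj (g x) \<partial>lborel) = Re (\<integral>x. g x * cnj (f x) \<partial>lborel)" by simp
  qed
  show "inner (u + v) w = inner u w + inner v w"
  proof transfer
    fix f g h :: "real ^ 'a \<Rightarrow> complex"
    assume a: "L2_rel f f" "L2_rel g g" "L2_rel h h"
    then have "integrable lborel (\<lambda>x. f x * cnj (h x))" "integrable lborel (\<lambda>x. g x * cnj (h x))"
      by (auto simp: L2_rel_def intro!: square_integrable_mult square_integrable_cnj)
    then show "Re (\<integral>x. (f x + g x) * cnj (h x) \<partial>lborel) =
       Re (\<integral>x. f x * cnj (h x) \<partial>lborel) + Re (\<integral>x. g x * cnj (h x) \<partial>lborel)"
      by (simp add: distrib_right)
  qed
  show "inner (a *\<^sub>R u) v = a * inner u v"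
    by transfer (simp add: mult.assoc)
  have nonneg: "Re (\<integral>x. f x * cnj (f x) \<partial>lborel) = (\<integral>x. (cmod (f x))\<^sup>2 \<partial>lborel)"
    for f :: "real ^ 'a \<Rightarrow> complex"
    unfolding complex_norm_square[symmetric] by (simp flip: of_real_power)
  show "0 \<le> inner u u"
    by transfer (simp add: nonneg)
  show "inner u u = 0 \<longleftrightarrow> u = 0"
  proof transfer
    fix f :: "real ^ 'a \<Rightarrow> complex"
    assume "L2_rel f f"
    then have f: "square_integrable f" by (simp add: L2_rel_def)
    then have "(\<integral>x. (cmod (f x))\<^sup>2 \<partial>lborel) = 0 \<longleftrightarrow> (AE x in lborel. (cmod (f x))\<^sup>2 = 0)"
      by (intro integral_nonneg_eq_0_iff_AE) (auto simp: square_integrable_def)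
    then show "Re (\<integral>x. f x * cnj (f x) \<partial>lborel) = 0 \<longleftrightarrow> L2_rel f (\<lambda>x. 0)"
      using f by (simp add: nonneg L2_rel_def square_integrable_zero)
  qed
  show "norm u = sqrt (inner u u)" by (simp add: norm_L2_def)
qed

end

lift_definition scaleC_L2 :: "complex \<Rightarrow> 'n::finite L2 \<Rightarrow> 'n L2" is "\<lambda>c f x. c * f x"
  by (auto simp: L2_rel_def square_integrable_scale)

definition bounded_clinear_L2 :: "('n::finite L2 \<Rightarrow> 'n L2) \<Rightarrow> bool" where
  "bounded_clinear_L2 A \<longleftrightarrow>
     bounded_linear A \<and> (\<forall>c u. A (scaleC_L2 c u) = scaleC_L2 c (A u))"


section \<open>Strongly continuous semigroups and their generators\<close>

definition C0_semigroup :: "(real \<Rightarrow> 'n::finite L2 \<Rightarrow> 'n L2) \<Rightarrow> bool" where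
  "C0_semigroup T \<longleftrightarrow>
     (\<forall>t\<ge>0. bounded_clinear_L2 (T t)) \<and>
     T 0 = id \<and>
     (\<forall>r\<ge>0. \<forall>t\<ge>0. T (r + t) = T r \<circ> T t) \<and>
     (\<forall>u. ((\<lambda>t. T t u) \<longlongrightarrow> u) (at_right 0))"

text \<open>Unbounded operators are given by their graphs; the domain is the first projection.\<close>

definition generator :: "(real \<Rightarrow> 'n::finite L2 \<Rightarrow> 'n L2) \<Rightarrow> ('n L2 \<times> 'n L2) set" where
  "generator T = {(u, v). ((\<lambda>h. (T h u - u) /\<^sub>R h) \<longlongrightarrow> v) (at_right 0)}"


section \<open>Schwartz functions and tempered distributions\<close>

definition pderiv_fun :: "'n::finite \<Rightarrow> (real ^ 'n \<Rightarrow> complex) \<Rightarrow> (real ^ 'n \<Rightarrow> complex)" where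
  "pderiv_fun i f x = frechet_derivative f (at x) (axis i 1)"

definition iter_pderiv :: "'n::finite list \<Rightarrow> (real ^ 'n \<Rightarrow> complex) \<Rightarrow> (real ^ 'n \<Rightarrow> complex)" where
  "iter_pderiv is f = foldr pderiv_fun is f"

definition schwartz :: "(real ^ 'n::finite \<Rightarrow> complex) set" where
  "schwartz = {f. (\<forall>is x. iter_pderiv is f differentiable (at x)) \<and>
     (\<forall>k is. bounded (range (\<lambda>x. norm x ^ k *\<^sub>R iter_pderiv is f x)))}"

definition fourier :: "(real ^ 'n::finite \<Rightarrow> complex) \<Rightarrow> (real ^ 'n \<Rightarrow> complex)" where
  "fourier f \<xi> = (\<integral>x. cis (- (x \<bullet> \<xi>)) * f x \<partial>lborel)"

definition inv_fourier :: "(real ^ 'n::finite \<Rightarrow> complex) \<Rightarrow> (real ^ 'n \<Rightarrow> complex)" where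
  "inv_fourier f x = (\<integral>\<xi>. cis (x \<bullet> \<xi>) * f \<xi> \<partial>lborel) / (2 * pi) ^ CARD('n)"

text \<open>A tempered distribution is a functional on Schwartz functions; its values
  elsewhere are irrelevant, so equality is only ever tested on Schwartz functions
  (\<open>dist_eq\<close>). All distributions below are tempered, so testing on Schwartz functions
  is the same as testing on compactly supported smooth ones. Pairings are bilinear, without complex conjugation.\<close>

type_synonym 'n distr = "(real ^ 'n \<Rightarrow> complex) \<Rightarrow> complex"

definition dist_eq :: "'n::finite distr \<Rightarrow> 'n distr \<Rightarrow> bool" where
  "dist_eq D E \<longleftrightarrow> (\<forall>\<phi>\<in>schwartz. D \<phi> = E \<phi>)"

definition distr_of_fun :: "(real ^ 'n::finite \<Rightarrow> complex) \<Rightarrow> 'n distr" where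
  "distr_of_fun f \<phi> = (\<integral>x. f x * \<phi> x \<partial>lborel)"

definition distr_of_L2 :: "'n::finite L2 \<Rightarrow> 'n distr" where
  "distr_of_L2 u = distr_of_fun (rep_L2 u)"

definition distr_pderiv :: "'n::finite \<Rightarrow> 'n distr \<Rightarrow> 'n distr" where
  "distr_pderiv i D \<phi> = - D (pderiv_fun i \<phi>)"

definition distr_mult :: "(real ^ 'n::finite \<Rightarrow> complex) \<Rightarrow> 'n distr \<Rightarrow> 'n distr" where
  "distr_mult a D \<phi> = D (\<lambda>x. a x * \<phi> x)"

definition distr_fourier :: "'n::finite distr \<Rightarrow> 'n distr" where
  "distr_fourier D \<phi> = D (fourier \<phi>)"

definition distr_inv_fourier :: "'n::finite distr \<Rightarrow> 'n distr" where
  "distr_inv_fourier D \<phi> = D (inv_fourier \<phi>)"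

text \<open>By Plancherel's theorem the distributional Fourier transform of a square-integrable
  function is given by a unique square-integrable function.\<close>

definition fourier_L2 :: "'n::finite L2 \<Rightarrow> 'n L2" where
  "fourier_L2 u = (THE U. dist_eq (distr_of_L2 U) (distr_fourier (distr_of_L2 u)))"

definition fourier_multiplier :: "(real ^ 'n::finite \<Rightarrow> real) \<Rightarrow> 'n L2 \<Rightarrow> 'n distr" where
  "fourier_multiplier m u =
     distr_inv_fourier (distr_of_fun (\<lambda>\<xi>. complex_of_real (m \<xi>) * rep_L2 (fourier_L2 u) \<xi>))"


section \<open>The fractional Ornstein-Uhlenbeck operator\<close>

definition OU_distr :: "real \<Rightarrow> real ^ 'n ^ 'n \<Rightarrow> real ^ 'n ^ 'n \<Rightarrow> 'n::finite L2 \<Rightarrow> 'n distr" where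
  "OU_distr s B Q u \<phi> =
     fourier_multiplier (\<lambda>\<xi>. ((Q *v \<xi>) \<bullet> \<xi>) powr s) u \<phi> / 2 +
     (\<Sum>i\<in>UNIV. \<Sum>j\<in>UNIV. complex_of_real (B $ i $ j) *
        distr_mult (\<lambda>x. complex_of_real (x $ j)) (distr_pderiv i (distr_of_L2 u)) \<phi>)"

text \<open>The graph of the operator with its maximal domain, i.e. of all \<open>u\<close> for which the
  distribution \<open>OU_distr s B Q u\<close> is given by a square-integrable function.\<close>

definition OU_operator :: "real \<Rightarrow> real ^ 'n ^ 'n \<Rightarrow> real ^ 'n ^ 'n \<Rightarrow> ('n::finite L2 \<times> 'n L2) set" where
  "OU_operator s B Q = {(u, f). dist_eq (OU_distr s B Q u) (distr_of_L2 f)}"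

definition OU_semigroup ::
  "real \<Rightarrow> real ^ 'n ^ 'n \<Rightarrow> real ^ 'n ^ 'n \<Rightarrow> (real \<Rightarrow> 'n::finite L2 \<Rightarrow> 'n L2) \<Rightarrow> bool" where
  "OU_semigroup s B Q T \<longleftrightarrow>
     C0_semigroup T \<and> generator T = {(u, - f) | u f. (u, f) \<in> OU_operator s B Q}"

definition directional_deriv :: "real ^ 'n \<Rightarrow> 'n::finite L2 \<Rightarrow> 'n distr" where
  "directional_deriv \<xi> u \<phi> =
     (\<Sum>j\<in>UNIV. complex_of_real (\<xi> $ j) * distr_pderiv j (distr_of_L2 u) \<phi>)"

definition L2_bounded :: "('n::finite L2 \<Rightarrow> 'n distr) \<Rightarrow> bool" where
  "L2_bounded D \<longleftrightarrow>
     (\<exists>A. bounded_clinear_L2 A \<and> (\<forall>u. dist_eq (D u) (distr_of_L2 (A u))))"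


section \<open>The space S\<close>

definition pos_semidef :: "real ^ 'n ^ 'n \<Rightarrow> bool" where
  "pos_semidef M \<longleftrightarrow> transpose M = M \<and> (\<forall>x. 0 \<le> (M *v x) \<bullet> x)"

definition psd_sqrt :: "real ^ 'n ^ 'n \<Rightarrow> real ^ 'n ^ 'n" where
  "psd_sqrt Q = (THE R. pos_semidef R \<and> R ** R = Q)"

text \<open>The operation \<open>^\<close> would be the componentwise power here.\<close>

definition matpow :: "real ^ 'n ^ 'n \<Rightarrow> nat \<Rightarrow> real ^ 'n ^ 'n" where
  "matpow M k = ((**) M ^^ k) (mat 1)"

definition kalman_space :: "real ^ 'n ^ 'n \<Rightarrow> real ^ 'n ^ 'n \<Rightarrow> (real ^ 'n) set" where
  "kalman_space B Q =
     (\<Inter>j<CARD('n). {\<xi>. (psd_sqrt Q ** matpow (transpose B) j) *v \<xi> = 0})"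

end

(* The flow of P transports frequencies along exp (-t B^T) and damps them through <Q xi, xi>^s,
   which vanishes on the B^T-invariant space S. So for eta in S the wave packet
   cis (eta . x) exp (-e^2 |x|^2 / 2) is almost purely transported as e -> 0: composed with
   exp (-r B) it stays concentrated, at scale e, around the frequency N eta in S with
   N = exp (-r B^T), hence it solves the evolution equation up to an error of relative size
   e^(2s) in L^2, and Duhamel's formula bounds its distance to the semigroup. Pairing the
   derivative along xi_0 of the transported packet with its conjugate then gives
   |<N eta, xi_0>| <= const, where the constant does not depend on eta; as S is a linear space
   on which N is bijective, xi_0 is orthogonal to S. *)

theory Submission
  imports Defs "HOL-Probability.Characteristic_Functions" "HOL-Probability.Sinc_Integral"
begin

section \<open>Positive semidefinite square roots, Krylov spaces and matrix exponentials\<close>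

text \<open>The semigroup is known only through its generator, so no formula for \<open>T t\<close>
  is at hand; everything must be read off functions in the maximal domain on which the operator is
  explicit. Gaussian packets qualify: linear substitutions keep them packets, and their Fourier
  transforms are again Gaussians. The symbol need not be smooth where <Q xi, xi> = 0, so its action
  on a packet is controlled in L^2 only, by Plancherel's inequality. The exponent 2s comes from Q N
  eta = 0: in <Q xi, xi> only the deviation of xi from N eta survives, and it has size e. Packets
  are not normalised; their squared norms carry a factor e^(-n), the quantity
  \<open>lin_scale (e *\<^sub>R mat 1)\<close>, which occurs on both sides of the final estimate and
  cancels. The constants of the error term depend on eta, but e tends to 0 with eta fixed, so they
  are gone before eta is rescaled. The bound for the semigroup on compact time intervals rests on
  uniform boundedness, hence on completeness of L^2.\<close>

lemma symmetric_matrix_inner: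
  fixes M :: "real ^ 'n ^ 'n"
  assumes "transpose M = M"
  shows "(M *v x) \<bullet> y = x \<bullet> (M *v y)"
  by (metis assms dot_lmul_matrix inner_commute matrix_vector_mul_assoc transpose_matrix_vector)

text \<open>A maximiser \<open>e\<close> of the Rayleigh quotient on the unit sphere of
  \<open>V\<close> is an eigenvector: moving \<open>e\<close> in the direction of its residual
  \<open>w\<close> would otherwise increase the quotient to first order.\<close>

lemma ex_eigenvector_in_invariant_subspace:
  fixes M :: "real ^ 'n ^ 'n"
  assumes sym: "transpose M = M" and V: "subspace V" and nz: "\<exists>v\<in>V. v \<noteq> 0"
    and inv: "\<And>x. x \<in> V \<Longrightarrow> M *v x \<in> V"
  obtains e l where "e \<in> V" "norm e = 1" "M *v e = l *\<^sub>R e"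
proof -
  let ?S = "V \<inter> sphere 0 1"
  let ?f = "\<lambda>x. (M *v x) \<bullet> x"
  obtain v where v: "v \<in> V" "v \<noteq> 0" using nz by blast
  have "v /\<^sub>R norm v \<in> ?S" using v V by (simp add: subspace_scale)
  then have ne: "?S \<noteq> {}" by blast
  have cpt: "compact ?S" by (simp add: V closed_subspace closed_Int_compact)
  have cont: "continuous_on ?S ?f"
    by (intro continuous_intros matrix_vector_mult_linear_continuous_on)
  obtain e where e: "e \<in> ?S" and max: "\<And>x. x \<in> ?S \<Longrightarrow> ?f x \<le> ?f e"
    using continuous_attains_sup[OF cpt ne cont] by blast
  define l where "l = ?f e"
  have ee: "e \<bullet> e = 1" using e by (simp add: dot_square_norm)
  have le: "?f x \<le> l * (x \<bullet> x)" if "x \<in> V" for x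
  proof (cases "x = 0")
    case False
    have "?f (x /\<^sub>R norm x) \<le> l"
      unfolding l_def using that False V by (intro max) (simp add: subspace_scale)
    then have "?f x / (norm x)\<^sup>2 \<le> l"
      by (simp add: matrix_vector_mult_scaleR divide_simps power2_eq_square split: if_splits)
    then show ?thesis using False by (simp add: divide_simps dot_square_norm)
  qed simp
  define w where "w = M *v e - l *\<^sub>R e"
  have wV: "w \<in> V" using e V inv by (auto simp: w_def subspace_diff subspace_scale)
  have we: "w \<bullet> e = 0" using ee by (simp add: w_def inner_diff_left l_def)
  have Mew: "(M *v e) \<bullet> w = w \<bullet> w"
    using we by (simp add: w_def inner_diff_left inner_commute inner_diff_right)
  \<comment> \<open>The quotient bound at e + t w: the terms of order 0 in t cancel, and the
    first-order term is 2 t |w|^2.\<close>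
  have *: "2 * t * (w \<bullet> w) \<le> t\<^sup>2 * (l * (w \<bullet> w) - ?f w)" for t
  proof -
    have "?f (e + t *\<^sub>R w) \<le> l * ((e + t *\<^sub>R w) \<bullet> (e + t *\<^sub>R w))"
      using e wV V by (intro le) (simp add: subspace_add subspace_scale)
    moreover have "(M *v w) \<bullet> e = w \<bullet> w"
      using symmetric_matrix_inner[OF sym, of w e] Mew by (simp add: inner_commute)
    ultimately show ?thesis
      using we ee Mew
      by (simp add: matrix_vector_right_distrib matrix_vector_mult_scaleR inner_add_left
          inner_add_right inner_commute[of e w] l_def[symmetric] power2_eq_square algebra_simps)
  qed
  have "w \<bullet> w = 0"
  proof (rule ccontr)
    assume "w \<bullet> w \<noteq> 0"
    then have p: "w \<bullet> w > 0" by (simp add: less_le)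
    define K where "K = l * (w \<bullet> w) - ?f w"
    have K: "2 * t * (w \<bullet> w) \<le> t\<^sup>2 * K" for t using * by (simp add: K_def)
    have "K > 0" using K[of 1] p by (simp del: inner_gt_zero_iff)
    \<comment> \<open>For t = |w|^2 / K the inequality reads 2 |w|^4 / K \<le> |w|^4 / K.\<close>
    have "2 * ((w \<bullet> w) / K) * (w \<bullet> w) \<le> ((w \<bullet> w) / K)\<^sup>2 * K" by (rule K)
    then have "2 * (w \<bullet> w)\<^sup>2 / K \<le> (w \<bullet> w)\<^sup>2 / K"
      using \<open>K > 0\<close> by (simp add: power2_eq_square)
    then show False using p \<open>K > 0\<close> by (simp add: divide_simps)
  qed
  then have "M *v e = l *\<^sub>R e" by (simp add: w_def)
  with e that show thesis by auto
qed

text \<open>Induction on the dimension: split off one eigenvector; by symmetry its orthogonal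
  complement in \<open>V\<close> is again invariant. The induction needs a general invariant
  subspace in place of the whole space.\<close>

lemma symmetric_eigenbasis_subspace:
  fixes M :: "real ^ 'n ^ 'n"
  assumes sym: "transpose M = M" and "subspace V" "\<And>x. x \<in> V \<Longrightarrow> M *v x \<in> V"
  shows "\<exists>C. C \<subseteq> V \<and> finite C \<and> pairwise orthogonal C \<and> (\<forall>b\<in>C. norm b = 1) \<and> V \<subseteq> span C \<and>
    (\<forall>b\<in>C. \<exists>l. M *v b = l *\<^sub>R b)"
  using assms(2,3)
proof (induction "dim V" arbitrary: V rule: less_induct)
  case less
  show ?case
  proof (cases "\<exists>v\<in>V. v \<noteq> 0")
    case False
    then show ?thesis using span_0 by (intro exI[of _ "{}"]) auto
  next
    case True
    obtain e l where e: "e \<in> V" "norm e = 1" "M *v e = l *\<^sub>R e"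
      using ex_eigenvector_in_invariant_subspace[OF sym less.prems(1) True less.prems(2)] by blast
    define V' where "V' = V \<inter> {y. e \<bullet> y = 0}"
    have sV': "subspace V'"
      unfolding V'_def by (intro subspace_inter less.prems(1) subspace_hyperplane)
    have inv: "M *v x \<in> V'" if "x \<in> V'" for x
      using that less.prems(2) e(3) symmetric_matrix_inner[OF sym, of e x]
      by (auto simp: V'_def)
    have "e \<notin> V'" using e(2) by (auto simp: V'_def)
    then have "V' \<subset> V" using e(1) V'_def by blast
    then have "dim V' < dim V"
      using dim_psubset[of V' V] sV' less.prems(1) by (metis span_eq_iff)
    from less.hyps[OF this sV' inv] obtain C where C: "C \<subseteq> V'" "finite C" "pairwise orthogonal C"
      "\<forall>b\<in>C. norm b = 1" "V' \<subseteq> span C" "\<forall>b\<in>C. \<exists>l. M *v b = l *\<^sub>R b" by blast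
    have "V \<subseteq> span (insert e C)"
    proof
      fix x assume x: "x \<in> V"
      have "x - (e \<bullet> x) *\<^sub>R e \<in> V'"
        using x e less.prems(1)
        by (auto simp: V'_def subspace_diff subspace_scale inner_diff_right dot_square_norm)
      then have "x - (e \<bullet> x) *\<^sub>R e \<in> span C" using C(5) by auto
      then show "x \<in> span (insert e C)" using span_insert by blast
    qed
    moreover have "pairwise orthogonal (insert e C)"
      using C(1,3) by (auto simp: pairwise_insert V'_def orthogonal_def inner_commute)
    moreover have "insert e C \<subseteq> V" using C(1) e(1) by (auto simp: V'_def)
    ultimately show ?thesis
      using C e by (intro exI[of _ "insert e C"]) auto
  qed
qed

lemma symmetric_eigenbasis:
  fixes M :: "real ^ 'n ^ 'n"
  assumes "transpose M = M"
  obtains C l where "finite C" "pairwise orthogonal C" "\<And>b. b \<in> C \<Longrightarrow> norm b = 1"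
    "span C = UNIV" "\<And>b. b \<in> C \<Longrightarrow> M *v b = l b *\<^sub>R b"
  using symmetric_eigenbasis_subspace[OF assms, of UNIV] that by (metis UNIV_I subspace_UNIV top.extremum_unique)

text \<open>On an eigenvector b of R with eigenvalue l, the vector d = R' b - l b satisfies R' d = -
  l d. For l > 0 positivity of R' forces d = 0; for l = 0 one has |R' b|^2 = <R' R' b, b> =
  0.\<close>

lemma pos_semidef_sqrt_unique:
  fixes R R' :: "real ^ 'n ^ 'n"
  assumes R: "pos_semidef R" and R': "pos_semidef R'" and eq: "R ** R = R' ** R'"
  shows "R = R'"
proof -
  obtain C l where C: "finite C" "pairwise orthogonal C" "\<And>b. b \<in> C \<Longrightarrow> norm b = 1"
    "span C = UNIV" "\<And>b. b \<in> C \<Longrightarrow> R *v b = l b *\<^sub>R b"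
    using symmetric_eigenbasis[of R] R by (auto simp: pos_semidef_def)
  have "R *v b = R' *v b" if b: "b \<in> C" for b
  proof -
    have l: "0 \<le> l b"
      using R C(3,5)[OF b] unfolding pos_semidef_def
      by (metis dot_square_norm inner_scaleR_left mult.right_neutral power_one)
    have 1: "R' *v (R' *v b) = (l b)\<^sup>2 *\<^sub>R b"
      using C(5)[OF b] eq
      by (metis matrix_vector_mul_assoc matrix_vector_mult_scaleR power2_eq_square scaleR_scaleR)
    define d where "d = R' *v b - l b *\<^sub>R b"
    have d: "R' *v d = - (l b *\<^sub>R d)"
      by (simp add: d_def matrix_vector_mult_diff_distrib matrix_vector_mult_scaleR 1
          power2_eq_square algebra_simps)
    have ge: "0 \<le> (R' *v d) \<bullet> d" using R' by (simp add: pos_semidef_def)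
    have "d = 0"
    proof (cases "l b = 0")
      case True
      have "(R' *v b) \<bullet> (R' *v b) = 0"
        using symmetric_matrix_inner[of R' b "R' *v b"] R' 1 True by (simp add: pos_semidef_def)
      then show ?thesis using True by (simp add: d_def)
    next
      case False
      then have "d \<bullet> d \<le> 0" using ge l d by (simp add: mult_le_0_iff)
      then show ?thesis by (meson inner_eq_zero_iff inner_ge_zero order_antisym)
    qed
    then show ?thesis using C(5)[OF b] by (simp add: d_def)
  qed
  then have "R *v x = R' *v x" for x
    using linear_eq_on[of "(*v) R" "(*v) R'" x C] C(4)
    by (auto simp: matrix_vector_mul_linear)
  then show ?thesis by (simp add: matrix_eq)
qed

text \<open>Functional calculus: \<open>f\<close> acts on an orthonormal eigenbasis of
  \<open>Q\<close> by the square roots of the eigenvalues.\<close>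

lemma pos_semidef_sqrt_exists:
  fixes Q :: "real ^ 'n ^ 'n"
  assumes Q: "pos_semidef Q"
  shows "\<exists>R. pos_semidef R \<and> R ** R = Q"
proof -
  obtain C l where C: "finite C" "pairwise orthogonal C" "\<And>b. b \<in> C \<Longrightarrow> norm b = 1"
    "span C = UNIV" "\<And>b. b \<in> C \<Longrightarrow> Q *v b = l b *\<^sub>R b"
    using symmetric_eigenbasis[of Q] Q by (auto simp: pos_semidef_def)
  have l: "0 \<le> l b" if "b \<in> C" for b
    using Q C(3,5)[OF that] unfolding pos_semidef_def
    by (metis dot_square_norm inner_scaleR_left mult.right_neutral power_one)
  define f where "f x = (\<Sum>b\<in>C. (sqrt (l b) * (x \<bullet> b)) *\<^sub>R b)" for x
  have lf: "linear f"
    unfolding f_def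
    by (auto intro!: linearI simp: inner_add_left distrib_left scaleR_add_left sum.distrib
        scaleR_sum_right mult.left_commute)
  define R where "R = matrix f"
  have Rf: "R *v x = f x" for x using lf by (simp add: R_def)
  have sym: "f x \<bullet> y = f y \<bullet> x" for x y
    unfolding f_def inner_sum_left by (intro sum.cong) (simp_all add: inner_commute)
  have "transpose R = R"
    by (simp add: vec_eq_iff transpose_def R_def matrix_def)
      (metis sym cart_eq_inner_axis)
  moreover have "0 \<le> (R *v x) \<bullet> x" for x
    unfolding Rf f_def inner_sum_left using l
    by (intro sum_nonneg) (simp add: inner_commute mult.assoc)
  moreover have "R ** R = Q"
  proof -
    have fb: "f b = sqrt (l b) *\<^sub>R b" if b: "b \<in> C" for b
    proof -
      have "(sqrt (l c) * (b \<bullet> c)) *\<^sub>R c = (if c = b then sqrt (l b) *\<^sub>R b else 0)" if "c \<in> C" for c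
        using that b C(2) C(3)[OF b] by (auto simp: pairwise_def orthogonal_def dot_square_norm)
      then show ?thesis unfolding f_def using b C(1) by (simp cong: sum.cong)
    qed
    have "(R ** R) *v b = Q *v b" if b: "b \<in> C" for b
      using fb[OF b] l[OF b] C(5)[OF b] linear_scale[OF lf]
      by (simp add: matrix_vector_mul_assoc[symmetric] Rf)
    then have "(R ** R) *v x = Q *v x" for x
      using linear_eq_on[of "(*v) (R ** R)" "(*v) Q" x C] C(4)
      by (auto simp: matrix_vector_mul_linear)
    then show ?thesis by (simp add: matrix_eq)
  qed
  ultimately show ?thesis by (auto simp: pos_semidef_def)
qed

lemma psd_sqrt:
  fixes Q :: "real ^ 'n ^ 'n"
  assumes "pos_semidef Q"
  shows "pos_semidef (psd_sqrt Q)" "psd_sqrt Q ** psd_sqrt Q = Q"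
proof -
  have "\<exists>!R. pos_semidef R \<and> R ** R = Q"
    using pos_semidef_sqrt_exists[OF assms] pos_semidef_sqrt_unique by blast
  from theI'[OF this] show "pos_semidef (psd_sqrt Q)" "psd_sqrt Q ** psd_sqrt Q = Q"
    by (simp_all add: psd_sqrt_def)
qed


section \<open>Matrix powers, Krylov subspaces and the space S\<close>

lemma matpow_0 [simp]: "matpow M 0 = mat 1"
  by (simp add: matpow_def)

lemma matpow_Suc: "matpow M (Suc k) = M ** matpow M k"
  by (simp add: matpow_def)

lemma matpow_Suc_right: "matpow M (Suc k) = matpow M k ** M"
  by (induction k) (simp_all add: matpow_Suc matrix_mul_assoc)

text \<open>A dimension count in place of Cayley-Hamilton: among n + 1 orbit vectors one,
  \<open>v k\<close>, depends on its predecessors, whose span is then invariant under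
  \<open>M\<close>. This turns the finite intersection defining S into one over all powers, from
  which the invariance of S is immediate.\<close>

lemma krylov_subspace:
  fixes M :: "real ^ 'n ^ 'n"
  assumes W: "subspace W" and orb: "\<And>j. j < CARD('n) \<Longrightarrow> matpow M j *v \<xi> \<in> W"
  shows "matpow M j *v \<xi> \<in> W"
proof -
  define v where "v j = matpow M j *v \<xi>" for j
  have vS: "v (Suc j) = M *v v j" for j
    by (simp add: v_def matpow_Suc matrix_vector_mul_assoc)
  define U where "U k = span (v ` {..<k})" for k
  \<comment> \<open>\<open>k\<close> may be \<open>CARD('n)\<close> itself: the span of
    \<open>v 0\<close>, ..., \<open>v (k - 1)\<close> still involves only indices covered by
    \<open>orb\<close>.\<close>
  have "\<exists>k\<le>CARD('n). v k \<in> U k"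
  proof (rule ccontr)
    assume not: "\<not> ?thesis"
    have "k \<le> CARD('n) + 1 \<Longrightarrow> dim (v ` {..<k}) = k" for k
    proof (induction k)
      case (Suc k)
      then show ?case using not by (auto simp: lessThan_Suc dim_insert U_def)
    qed simp
    then have "dim (v ` {..<CARD('n) + 1}) = CARD('n) + 1" by blast
    then show False using dim_subset_UNIV[of "v ` {..<CARD('n) + 1}"] by simp
  qed
  then obtain k where k: "k \<le> CARD('n)" "v k \<in> U k" by blast
  have inv: "M *v x \<in> U k" if "x \<in> U k" for x
    using that unfolding U_def
  proof (induction rule: span_induct_alt)
    case base
    then show ?case by (simp add: span_zero)
  next
    case (step c x y)
    then obtain i where i: "i < k" "x = v i" by auto
    have "v (Suc i) \<in> U k"
      using i k(2) by (cases "Suc i = k") (auto simp: U_def intro!: span_base)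
    then show ?case
      using step i(2) by (auto simp: matrix_vector_right_distrib matrix_vector_mult_scaleR vS U_def
          intro!: span_add span_scale)
  qed
  have "v j \<in> U k"
  proof (induction j)
    case 0
    then show ?case using k(2) by (cases "k = 0") (auto simp: U_def intro!: span_base)
  next
    case (Suc j)
    then show ?case by (simp add: vS inv)
  qed
  moreover have "U k \<subseteq> W"
    unfolding U_def using orb k(1) by (intro span_minimal W) (auto simp: v_def)
  ultimately show ?thesis by (auto simp: v_def)
qed

lemma kalman_space_iff:
  fixes B Q :: "real ^ 'n ^ 'n"
  shows "\<xi> \<in> kalman_space B Q \<longleftrightarrow> (\<forall>j. matpow (transpose B) j *v \<xi> \<in> {x. psd_sqrt Q *v x = 0})"
proof -
  have "subspace {x. psd_sqrt Q *v x = 0}"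
    by (simp add: subspace_def matrix_vector_right_distrib matrix_vector_mult_scaleR)
  then show ?thesis
    using krylov_subspace[of "{x. psd_sqrt Q *v x = 0}" "transpose B" \<xi>]
    by (auto simp: kalman_space_def matrix_vector_mul_assoc)
qed

lemma subspace_kalman_space: "subspace (kalman_space B Q)"
  by (auto simp: subspace_def kalman_space_iff matrix_vector_right_distrib matrix_vector_mult_scaleR)

lemma kalman_space_invariant:
  fixes B Q :: "real ^ 'n ^ 'n"
  assumes "\<xi> \<in> kalman_space B Q"
  shows "matpow (transpose B) k *v \<xi> \<in> kalman_space B Q"
proof -
  have "matpow M j ** matpow M k = matpow M (j + k)" for M :: "real ^ 'n ^ 'n" and j
    by (induction j) (simp_all add: matpow_Suc matrix_mul_assoc[symmetric])
  then show ?thesis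
    using assms by (simp add: kalman_space_iff matrix_vector_mul_assoc)
qed

lemma kalman_space_kernel:
  fixes B Q :: "real ^ 'n ^ 'n"
  assumes "pos_semidef Q" "\<xi> \<in> kalman_space B Q"
  shows "Q *v \<xi> = 0"
proof -
  have "matpow (transpose B) 0 *v \<xi> \<in> {x. psd_sqrt Q *v x = 0}"
    using assms(2) unfolding kalman_space_iff by blast
  then have "psd_sqrt Q *v (psd_sqrt Q *v \<xi>) = 0" by simp
  then show ?thesis using psd_sqrt(2)[OF assms(1)] by (simp add: matrix_vector_mul_assoc)
qed

section \<open>The matrix exponential\<close>

text \<open>exp(t M), written entry by entry so that convergence and differentiation are those of
  real power series.\<close>

definition mexp :: "real ^ 'n ^ 'n \<Rightarrow> real \<Rightarrow> real ^ 'n ^ 'n" where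
  "mexp M t = (\<chi> i j. \<Sum>k. (matpow M k $ i $ j / fact k) * t ^ k)"

text \<open>The sum of the absolute values of all entries dominates each row sum, so every further
  factor \<open>M\<close> costs at most that much. The powers give an exponential majorant for the
  series.\<close>

lemma matpow_bound:
  fixes M :: "real ^ 'n ^ 'n"
  shows "\<bar>matpow M k $ i $ j\<bar> \<le> (\<Sum>i\<in>UNIV. \<Sum>j\<in>UNIV. \<bar>M $ i $ j\<bar>) ^ k"
proof (induction k arbitrary: i j)
  case 0
  then show ?case by (simp add: mat_def)
next
  case (Suc k)
  let ?K = "\<Sum>i\<in>UNIV. \<Sum>j\<in>UNIV. \<bar>M $ i $ j\<bar>"
  have "\<bar>matpow M (Suc k) $ i $ j\<bar> \<le> (\<Sum>l\<in>UNIV. \<bar>M $ i $ l\<bar> * \<bar>matpow M k $ l $ j\<bar>)"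
    unfolding matpow_Suc matrix_matrix_mult_def by (simp flip: abs_mult)
  also have "\<dots> \<le> (\<Sum>l\<in>UNIV. \<bar>M $ i $ l\<bar> * ?K ^ k)"
    by (intro sum_mono mult_left_mono Suc) simp
  also have "\<dots> = (\<Sum>l\<in>UNIV. \<bar>M $ i $ l\<bar>) * ?K ^ k" by (simp add: sum_distrib_right)
  also have "\<dots> \<le> ?K * ?K ^ k"
    by (intro mult_right_mono member_le_sum[of i UNIV "\<lambda>i. \<Sum>l\<in>UNIV. \<bar>M $ i $ l\<bar>"])
      (auto intro!: sum_nonneg zero_le_power)
  finally show ?case by simp
qed

lemma mexp_summable:
  fixes M :: "real ^ 'n ^ 'n"
  shows "summable (\<lambda>k. (matpow M k $ i $ j / fact k) * t ^ k)"
proof (rule summable_comparison_test')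
  let ?K = "\<Sum>i\<in>UNIV. \<Sum>j\<in>UNIV. \<bar>M $ i $ j\<bar>"
  show "summable (\<lambda>k. inverse (fact k) * (?K * \<bar>t\<bar>) ^ k)" by (rule summable_exp)
  show "norm ((matpow M k $ i $ j / fact k) * t ^ k) \<le> inverse (fact k) * (?K * \<bar>t\<bar>) ^ k" if "k \<ge> 0" for k
    using mult_right_mono[OF matpow_bound[of M k i j], of "\<bar>t\<bar> ^ k / fact k"]
    by (simp add: abs_mult power_abs power_mult_distrib field_simps)
qed

lemma mexp_0: "mexp M 0 = mat 1"
proof -
  have "(\<Sum>k. (matpow M k $ i $ j / fact k) * 0 ^ k) = mat 1 $ i $ j" for i j
    by (subst powser_zero) simp
  then show ?thesis by (simp add: mexp_def vec_eq_iff)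
qed

lemma mexp_has_derivative_aux:
  fixes M :: "real ^ 'n ^ 'n"
  shows "((\<lambda>t. mexp M t $ i $ j) has_real_derivative (\<Sum>k. matpow M (Suc k) $ i $ j / fact k * t ^ k)) (at t)"
proof -
  have "diffs (\<lambda>k. matpow M k $ i $ j / fact k) = (\<lambda>k. matpow M (Suc k) $ i $ j / fact k)"
    by (simp add: diffs_def fun_eq_iff divide_simps del: of_nat_Suc)
  then show ?thesis
    using termdiffs_strong_converges_everywhere[of "\<lambda>k. matpow M k $ i $ j / fact k" t, OF mexp_summable]
    by (simp add: mexp_def)
qed

lemma mexp_has_derivative:
  fixes M :: "real ^ 'n ^ 'n"
  shows "((\<lambda>t. mexp M t $ i $ j) has_real_derivative (M ** mexp M t) $ i $ j) (at t)"
proof -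
  have "(\<lambda>k. \<Sum>l\<in>UNIV. M $ i $ l * (matpow M k $ l $ j / fact k * t ^ k)) sums
      (\<Sum>l\<in>UNIV. M $ i $ l * (\<Sum>k. matpow M k $ l $ j / fact k * t ^ k))"
    by (intro sums_sum sums_mult summable_sums mexp_summable)
  then have "(\<Sum>k. matpow M (Suc k) $ i $ j / fact k * t ^ k) = (M ** mexp M t) $ i $ j"
    by (simp add: sums_iff matpow_Suc mexp_def matrix_matrix_mult_def sum_distrib_right
        sum_divide_distrib mult.assoc)
  then show ?thesis using mexp_has_derivative_aux[of M i j t] by simp
qed

text \<open>In the differentiated series one factor of M^(k+1) can be pulled out on the left or on
  the right; uniqueness of the derivative identifies the two results.\<close>

lemma mexp_commute:
  fixes M :: "real ^ 'n ^ 'n"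
  shows "M ** mexp M t = mexp M t ** M"
proof -
  have "(\<lambda>k. \<Sum>l\<in>UNIV. (matpow M k $ i $ l / fact k * t ^ k) * M $ l $ j) sums
      (\<Sum>l\<in>UNIV. (\<Sum>k. matpow M k $ i $ l / fact k * t ^ k) * M $ l $ j)" for i j
    by (intro sums_sum sums_mult2 summable_sums mexp_summable)
  moreover have "matpow M (Suc k) $ i $ j / fact k * t ^ k =
      (\<Sum>l\<in>UNIV. (matpow M k $ i $ l / fact k * t ^ k) * M $ l $ j)" for i j k
    by (simp add: matpow_Suc_right matrix_matrix_mult_def sum_distrib_right sum_distrib_left
        sum_divide_distrib mult_ac)
  ultimately have "(\<Sum>k. matpow M (Suc k) $ i $ j / fact k * t ^ k) = (mexp M t ** M) $ i $ j" for i j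
    by (simp add: sums_iff mexp_def matrix_matrix_mult_def)
  then have "(M ** mexp M t) $ i $ j = (mexp M t ** M) $ i $ j" for i j
    using DERIV_unique[OF mexp_has_derivative_aux[of M i j t] mexp_has_derivative[of M i j t]] by metis
  then show ?thesis by (simp only: vec_eq_iff) simp
qed

text \<open>The product has derivative 0, by \<open>mexp_commute\<close>, and is the identity at t =
  0.\<close>

lemma mexp_inverse:
  fixes M :: "real ^ 'n ^ 'n"
  shows "mexp M t ** mexp M (- t) = mat 1"
proof -
  have "(mexp M t ** mexp M (- t)) $ i $ j = (mexp M 0 ** mexp M (- 0)) $ i $ j" for i j
  proof (rule DERIV_isconst_all[of "\<lambda>t. (mexp M t ** mexp M (- t)) $ i $ j"], rule allI)
    fix t
    have "((\<lambda>t. mexp M (- t) $ i $ j) has_real_derivative - (M ** mexp M (- t)) $ i $ j) (at t)" for i j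
      using DERIV_chain2[OF mexp_has_derivative[of M i j "-t"] DERIV_minus[OF DERIV_ident]] by simp
    then have "((\<lambda>t. \<Sum>l\<in>UNIV. mexp M t $ i $ l * mexp M (- t) $ l $ j) has_real_derivative
      (\<Sum>l\<in>UNIV. (M ** mexp M t) $ i $ l * mexp M (- t) $ l $ j +
        - (M ** mexp M (- t)) $ l $ j * mexp M t $ i $ l)) (at t)"
      by (intro DERIV_sum DERIV_mult mexp_has_derivative)
    moreover have "(\<Sum>l\<in>UNIV. (M ** mexp M t) $ i $ l * mexp M (- t) $ l $ j +
        - (M ** mexp M (- t)) $ l $ j * mexp M t $ i $ l)
      = ((M ** mexp M t) ** mexp M (- t)) $ i $ j - (mexp M t ** (M ** mexp M (- t))) $ i $ j"
      by (simp add: matrix_matrix_mult_def[of _ "mexp M (- t)"] matrix_matrix_mult_def[of "mexp M t"]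
         sum.distrib sum_negf sum_subtractf mult.commute)
    moreover have "(M ** mexp M t) ** mexp M (- t) = mexp M t ** (M ** mexp M (- t))"
      by (simp only: mexp_commute[of M t] matrix_mul_assoc)
    ultimately show "((\<lambda>t. (mexp M t ** mexp M (- t)) $ i $ j) has_real_derivative 0) (at t)"
      by (simp add: matrix_matrix_mult_def[of "mexp M _" "mexp M _"])
  qed
  then show ?thesis by (simp add: mexp_0 vec_eq_iff)
qed

text \<open>The partial sums of the series stay in \<open>W\<close>, which is closed because the
  dimension is finite. Applied to S it keeps transported frequencies in S.\<close>

lemma mexp_mem_closed_subspace:
  fixes M :: "real ^ 'n ^ 'n"
  assumes W: "subspace W" and "\<And>k. matpow M k *v \<eta> \<in> W"
  shows "mexp M t *v \<eta> \<in> W"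
proof -
  have "(\<lambda>k. \<Sum>j\<in>UNIV. (matpow M k $ i $ j / fact k * t ^ k) * \<eta> $ j) sums
      (\<Sum>j\<in>UNIV. (\<Sum>k. matpow M k $ i $ j / fact k * t ^ k) * \<eta> $ j)" for i
    by (intro sums_sum sums_mult2 summable_sums mexp_summable)
  then have *: "(\<lambda>k. (t ^ k / fact k) * (matpow M k *v \<eta>) $ i) sums (mexp M t *v \<eta>) $ i" for i
    by (simp add: matrix_vector_mult_def mexp_def sum_distrib_left sum_distrib_right mult_ac)
  have lim: "(\<lambda>n. \<Sum>k<n. (t ^ k / fact k) *\<^sub>R (matpow M k *v \<eta>)) \<longlonglongrightarrow> mexp M t *v \<eta>"
    using * by (intro vec_tendstoI) (simp add: sums_def)
  have "(\<Sum>k<n. (t ^ k / fact k) *\<^sub>R (matpow M k *v \<eta>)) \<in> W" for n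
    using assms by (intro subspace_sum subspace_scale) auto
  then show ?thesis by (rule closed_sequentially[OF closed_subspace[OF W] _ lim])
qed

section \<open>The Hilbert space and its semigroups\<close>

lemma L2_rel_rep: "L2_rel (rep_L2 u) (rep_L2 u)"
  by (rule Quotient3_rep_reflp[OF Quotient3_L2])

lemma square_integrable_rep: "square_integrable (rep_L2 u)"
  using L2_rel_rep[of u] by (simp add: L2_rel_def)

lemma abs_rep_L2: "abs_L2 (rep_L2 u) = u"
  by (rule Quotient3_abs_rep[OF Quotient3_L2])

lemma L2_rel_refl: "square_integrable f \<Longrightarrow> L2_rel f f"
  by (simp add: L2_rel_def)

lemma rep_abs_L2: "square_integrable f \<Longrightarrow> L2_rel (rep_L2 (abs_L2 f)) f"
  by (rule rep_abs_rsp_left[OF Quotient3_L2]) (simp add: L2_rel_def)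

lemma rep_abs_L2_AE: "square_integrable f \<Longrightarrow> AE x in lborel. rep_L2 (abs_L2 f) x = f x"
  using rep_abs_L2 by (auto simp: L2_rel_def)

lemma abs_L2_eqI:
  assumes "square_integrable f" "square_integrable g" "AE x in lborel. f x = g x"
  shows "abs_L2 f = abs_L2 g"
  using assms Quotient3_rel_abs[OF Quotient3_L2, of f g] by (simp add: L2_rel_def)

lemma square_integrable_measurable [measurable_dest]:
  "square_integrable f \<Longrightarrow> f \<in> borel_measurable borel"
  by (simp add: square_integrable_def)

lemma inner_abs_L2:
  assumes "square_integrable f" "square_integrable g"
  shows "inner (abs_L2 f) (abs_L2 g) = Re (\<integral>x. f x * cnj (g x) \<partial>lborel)"
  using assms by (simp add: inner_L2.abs_eq L2_rel_refl)

lemma norm_abs_L2: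
  assumes "square_integrable f"
  shows "(norm (abs_L2 f))\<^sup>2 = (\<integral>x. (cmod (f x))\<^sup>2 \<partial>lborel)"
proof -
  have "Re (\<integral>x. f x * cnj (f x) \<partial>lborel) = (\<integral>x. (cmod (f x))\<^sup>2 \<partial>lborel)"
    unfolding complex_norm_square[symmetric] by (simp flip: of_real_power)
  then show ?thesis using assms by (simp add: power2_norm_eq_inner inner_abs_L2)
qed

lemma abs_L2_add:
  "square_integrable f \<Longrightarrow> square_integrable g \<Longrightarrow> abs_L2 f + abs_L2 g = abs_L2 (\<lambda>x. f x + g x)"
  by (simp add: plus_L2.abs_eq L2_rel_refl)

lemma abs_L2_diff:
  "square_integrable f \<Longrightarrow> square_integrable g \<Longrightarrow> abs_L2 f - abs_L2 g = abs_L2 (\<lambda>x. f x - g x)"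
  by (simp add: minus_L2.abs_eq L2_rel_refl)

lemma abs_L2_scaleR:
  "square_integrable f \<Longrightarrow> r *\<^sub>R abs_L2 f = abs_L2 (\<lambda>x. complex_of_real r * f x)"
  by (simp add: scaleR_L2.abs_eq L2_rel_refl)

lemma abs_L2_zero: "abs_L2 (\<lambda>x. 0) = 0"
  by (simp add: zero_L2.abs_eq)

lemma square_integrable_diff:
  "square_integrable f \<Longrightarrow> square_integrable g \<Longrightarrow> square_integrable (\<lambda>x. f x - g x)"
  using square_integrable_add[of f "\<lambda>x. (-1) * g x"] square_integrable_scale[of g "-1"] by simp

lemma abs_L2_sum:
  fixes f :: "nat \<Rightarrow> real ^ 'n \<Rightarrow> complex"
  assumes "\<And>k. square_integrable (f k)"
  shows "square_integrable (\<lambda>x. \<Sum>k<N. f k x)"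
    and "abs_L2 (\<lambda>x. \<Sum>k<N. f k x) = (\<Sum>k<N. abs_L2 (f k))"
proof -
  have "square_integrable (\<lambda>x. \<Sum>k<N. f k x) \<and> abs_L2 (\<lambda>x. \<Sum>k<N. f k x) = (\<Sum>k<N. abs_L2 (f k))"
  proof (induction N)
    case 0
    then show ?case by (simp add: square_integrable_zero abs_L2_zero)
  next
    case (Suc N)
    then show ?case using assms by (simp add: square_integrable_add flip: abs_L2_add)
  qed
  then show "square_integrable (\<lambda>x. \<Sum>k<N. f k x)"
    "abs_L2 (\<lambda>x. \<Sum>k<N. f k x) = (\<Sum>k<N. abs_L2 (f k))" by auto
qed

text \<open>Cauchy-Schwarz for the bilinear complex pairing, whereas \<open>inner\<close> is the
  real part of the Hermitian one: a unimodular \<open>c\<close> makes the integral real and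
  nonnegative, and conjugating \<open>g\<close> undoes the conjugation.\<close>

lemma integral_mult_le_norm_L2:
  assumes f: "square_integrable f" and g: "square_integrable g"
  shows "cmod (\<integral>x. f x * g x \<partial>lborel) \<le> norm (abs_L2 f) * norm (abs_L2 g)"
proof -
  define I where "I = (\<integral>x. f x * g x \<partial>lborel)"
  define c where "c = (if I = 0 then 1 else cnj I / cmod I)"
  have c: "cmod c = 1" by (simp add: c_def norm_divide)
  have cI: "c * I = cmod I" by (simp add: c_def complex_norm_square[symmetric] mult.commute[of "cnj I"] power2_eq_square)
  have sq: "square_integrable (\<lambda>x. c * f x)" "square_integrable (\<lambda>x. cnj (g x))"
    using f g by (auto intro: square_integrable_scale square_integrable_cnj)
  have "inner (abs_L2 (\<lambda>x. c * f x)) (abs_L2 (\<lambda>x. cnj (g x))) = Re (c * I)"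
    by (simp add: inner_abs_L2 sq I_def mult.assoc)
  then have "cmod I = inner (abs_L2 (\<lambda>x. c * f x)) (abs_L2 (\<lambda>x. cnj (g x)))" by (simp add: cI)
  also have "\<dots> \<le> norm (abs_L2 (\<lambda>x. c * f x)) * norm (abs_L2 (\<lambda>x. cnj (g x)))"
    by (rule norm_cauchy_schwarz)
  also have "norm (abs_L2 (\<lambda>x. c * f x)) = norm (abs_L2 f)"
    by (rule power2_eq_imp_eq) (simp_all add: norm_abs_L2 sq f norm_mult c)
  also have "norm (abs_L2 (\<lambda>x. cnj (g x))) = norm (abs_L2 g)"
    by (rule power2_eq_imp_eq) (simp_all add: norm_abs_L2 sq g)
  finally show ?thesis by (simp add: I_def)
qed

text \<open>Completeness of L^2, in the form of Riesz-Fischer. The triangle inequality bounds the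
  partial sums of the moduli in L^2, monotone convergence makes their limit \<open>G\<close> square
  integrable, and \<open>G\<close> dominates all remainders of the series.\<close>

lemma summable_L2:
  fixes X :: "nat \<Rightarrow> 'n::finite L2"
  assumes sm: "summable (\<lambda>k. norm (X k))"
  shows "summable X"
proof -
  define f where "f k = rep_L2 (X k)" for k
  have sq: "square_integrable (f k)" for k by (simp add: f_def square_integrable_rep)
  have [measurable]: "f k \<in> borel_measurable borel" for k using sq by (simp add: square_integrable_def)
  have absX: "abs_L2 (f k) = X k" for k by (simp add: f_def abs_rep_L2)
  define C where "C = (\<Sum>k. norm (X k))"
  define F where "F N x = (\<Sum>k<N. cmod (f k x))" for N x
  have [measurable]: "F N \<in> borel_measurable borel" for N unfolding F_def by measurable
  have sqa: "square_integrable (\<lambda>x. complex_of_real (cmod (f k x)))" for k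
    using sq[of k] by (simp add: square_integrable_def)
  have na: "norm (abs_L2 (\<lambda>x. complex_of_real (cmod (f k x)))) = norm (X k)" for k
    by (rule power2_eq_imp_eq) (simp_all add: norm_abs_L2 sq sqa flip: absX)
  have sqF: "square_integrable (\<lambda>x. complex_of_real (F N x))" for N
    using abs_L2_sum(1)[OF sqa, where N = N] by (simp add: F_def)
  have F_nonneg: "0 \<le> F N x" for N x by (simp add: F_def sum_nonneg)
  have iF: "integrable lborel (\<lambda>x. (F N x)\<^sup>2)" for N
    using sqF[of N] by (simp add: square_integrable_def)
  have le: "(\<integral>x. (F N x)\<^sup>2 \<partial>lborel) \<le> C\<^sup>2" for N
  proof -
    have "norm (abs_L2 (\<lambda>x. complex_of_real (F N x))) \<le> (\<Sum>k<N. norm (X k))"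
      using abs_L2_sum(2)[OF sqa, where N = N] norm_sum[of "\<lambda>k. abs_L2 (\<lambda>x. complex_of_real (cmod (f k x)))" "{..<N}"]
      by (simp add: F_def na)
    also have "\<dots> \<le> C" unfolding C_def by (intro sum_le_suminf sm) auto
    finally have "(norm (abs_L2 (\<lambda>x. complex_of_real (F N x))))\<^sup>2 \<le> C\<^sup>2" by (intro power_mono) auto
    then show ?thesis using sqF[of N] by (simp add: norm_abs_L2)
  qed
  have inc: "incseq (\<lambda>N x. ennreal ((F N x)\<^sup>2))"
    unfolding incseq_Suc_iff le_fun_def
    by (intro allI ennreal_leI power_mono F_nonneg) (simp add: F_def)
  have "(\<integral>\<^sup>+x. (SUP N. ennreal ((F N x)\<^sup>2)) \<partial>lborel) = (SUP N. \<integral>\<^sup>+x. ennreal ((F N x)\<^sup>2) \<partial>lborel)"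
    by (intro nn_integral_monotone_convergence_SUP inc) auto
  also have "\<dots> \<le> ennreal (C\<^sup>2)"
    by (intro SUP_least) (simp add: nn_integral_eq_integral iF le ennreal_leI)
  finally have fin: "(\<integral>\<^sup>+x. (SUP N. ennreal ((F N x)\<^sup>2)) \<partial>lborel) < \<infinity>"
    using le_less_trans by fastforce
  then have "AE x in lborel. (SUP N. ennreal ((F N x)\<^sup>2)) \<noteq> \<infinity>"
    by (intro nn_integral_PInf_AE) auto
  then have AEs: "AE x in lborel. summable (\<lambda>k. cmod (f k x))"
  proof eventually_elim
    case (elim x)
    then obtain r where r: "(SUP N. ennreal ((F N x)\<^sup>2)) = ennreal r" "0 \<le> r"
      by (metis ennreal_cases infinity_ennreal_def)
    have "(F N x)\<^sup>2 \<le> r" for N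
      using SUP_upper[of N UNIV "\<lambda>N. ennreal ((F N x)\<^sup>2)"] r by simp
    then have "F N x \<le> sqrt r" for N using F_nonneg real_le_rsqrt by blast
    then show ?case by (intro summableI_nonneg_bounded[of _ "sqrt r"]) (auto simp: F_def)
  qed
  define G where "G x = (\<Sum>k. cmod (f k x))" for x
  define S where "S x = (\<Sum>k. f k x)" for x
  have [measurable]: "G \<in> borel_measurable borel" "S \<in> borel_measurable borel"
    unfolding G_def S_def by measurable
  have iG: "integrable lborel (\<lambda>x. (G x)\<^sup>2)"
  proof (rule integrableI_bounded)
    have "(\<integral>\<^sup>+x. ennreal (norm ((G x)\<^sup>2)) \<partial>lborel) \<le> (\<integral>\<^sup>+x. (SUP N. ennreal ((F N x)\<^sup>2)) \<partial>lborel)"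
    proof (rule nn_integral_mono_AE, use AEs in eventually_elim)
      case (elim x)
      have "(\<lambda>N. F N x) \<longlonglongrightarrow> G x" unfolding F_def G_def by (rule summable_LIMSEQ[OF elim])
      then have "(\<lambda>N. ennreal ((F N x)\<^sup>2)) \<longlonglongrightarrow> ennreal ((G x)\<^sup>2)" by (intro tendsto_intros)
      then have "ennreal ((G x)\<^sup>2) \<le> (SUP N. ennreal ((F N x)\<^sup>2))"
        by (rule LIMSEQ_le_const2) (intro exI allI impI SUP_upper UNIV_I)
      then show ?case by simp
    qed
    then show "(\<integral>\<^sup>+x. ennreal (norm ((G x)\<^sup>2)) \<partial>lborel) < \<infinity>" using fin by (rule le_less_trans)
  qed simp
  \<comment> \<open>The case N = 0 is the bound |S| \<le> G, which makes \<open>S\<close> square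
    integrable.\<close>
  have AES: "AE x in lborel. cmod (S x - (\<Sum>k<N. f k x)) \<le> G x" for N
    using AEs
  proof eventually_elim
    case (elim x)
    have s: "summable (\<lambda>k. f k x)" by (rule summable_norm_cancel[OF elim])
    have s': "summable (\<lambda>k. cmod (f (k + N) x))" using elim by (subst summable_iff_shift)
    have "S x - (\<Sum>k<N. f k x) = (\<Sum>k. f (k + N) x)"
      unfolding S_def by (subst suminf_split_initial_segment[OF s, where k = N]) simp
    then have "cmod (S x - (\<Sum>k<N. f k x)) \<le> (\<Sum>k. cmod (f (k + N) x))" using summable_norm[OF s'] by simp
    also have "\<dots> \<le> G x" unfolding G_def
      by (subst suminf_split_initial_segment[OF elim, where k = N]) (simp add: sum_nonneg)
    finally show ?case .
  qed
  have sqS: "square_integrable S"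
  proof -
    have "integrable lborel (\<lambda>x. (cmod (S x))\<^sup>2)"
    proof (rule Bochner_Integration.integrable_bound[OF iG])
      show "AE x in lborel. norm ((cmod (S x))\<^sup>2) \<le> norm ((G x)\<^sup>2)"
        using AES[of 0] by eventually_elim (auto intro: power_mono)
    qed simp
    then show ?thesis by (simp add: square_integrable_def)
  qed
  have sqD: "square_integrable (\<lambda>x. S x - (\<Sum>k<N. f k x))" for N
    by (intro square_integrable_diff sqS abs_L2_sum(1) sq)
  have "(\<lambda>N. \<integral>x. (cmod (S x - (\<Sum>k<N. f k x)))\<^sup>2 \<partial>lborel) \<longlonglongrightarrow> (\<integral>x. 0 \<partial>(lborel :: (real ^ 'n) measure))"
  proof (rule integral_dominated_convergence[OF _ _ iG])
    show "AE x in lborel. (\<lambda>N. (cmod (S x - (\<Sum>k<N. f k x)))\<^sup>2) \<longlonglongrightarrow> 0"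
      using AEs
    proof eventually_elim
      case (elim x)
      have "(\<lambda>N. \<Sum>k<N. f k x) \<longlonglongrightarrow> S x"
        unfolding S_def by (rule summable_LIMSEQ[OF summable_norm_cancel[OF elim]])
      then have "(\<lambda>N. (cmod (S x - (\<Sum>k<N. f k x)))\<^sup>2) \<longlonglongrightarrow> (cmod (S x - S x))\<^sup>2"
        by (intro tendsto_intros)
      then show ?case by simp
    qed
    show "AE x in lborel. norm ((cmod (S x - (\<Sum>k<N. f k x)))\<^sup>2) \<le> (G x)\<^sup>2" for N
      using AES[of N] by eventually_elim (auto intro: power_mono)
  qed auto
  moreover have "abs_L2 S - (\<Sum>k<N. X k) = abs_L2 (\<lambda>x. S x - (\<Sum>k<N. f k x))" for N
    using abs_L2_sum(2)[OF sq, where N = N] abs_L2_diff[OF sqS abs_L2_sum(1)[OF sq, where N = N]]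
    by (simp add: absX)
  then have "(norm (abs_L2 S - (\<Sum>k<N. X k)))\<^sup>2 = (\<integral>x. (cmod (S x - (\<Sum>k<N. f k x)))\<^sup>2 \<partial>lborel)" for N
    by (simp only: norm_abs_L2[OF sqD])
  ultimately have "(\<lambda>N. (norm (abs_L2 S - (\<Sum>k<N. X k)))\<^sup>2) \<longlonglongrightarrow> 0" by simp
  from tendsto_real_sqrt[OF this] have "(\<lambda>N. norm (abs_L2 S - (\<Sum>k<N. X k))) \<longlonglongrightarrow> 0" by simp
  then have "(\<lambda>N. \<Sum>k<N. X k) \<longlonglongrightarrow> abs_L2 S"
    unfolding norm_minus_commute[of "abs_L2 S"] by (rule LIM_zero_cancel[OF tendsto_norm_zero_cancel])
  then show ?thesis unfolding summable_def sums_def by blast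
qed


section \<open>Uniform boundedness and semigroup bounds on compact time intervals\<close>

lemma norm_suminf_le_suminf_norm:
  fixes d :: "nat \<Rightarrow> 'a::real_normed_vector"
  assumes "summable d" "summable (\<lambda>i. norm (d i))"
  shows "norm (suminf d) \<le> (\<Sum>i. norm (d i))"
proof (rule LIMSEQ_le)
  show "(\<lambda>n. norm (\<Sum>i<n. d i)) \<longlonglongrightarrow> norm (suminf d)"
    by (intro tendsto_norm summable_LIMSEQ assms)
  show "(\<lambda>n. \<Sum>i<n. norm (d i)) \<longlonglongrightarrow> (\<Sum>i. norm (d i))"
    by (intro summable_LIMSEQ assms)
qed (intro exI allI impI norm_sum)

text \<open>Sokal's argument: among \<open>T (x + z)\<close> and \<open>T (x - z)\<close> one is at least as large as \<open>T z\<close>, so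
  corrections \<open>z\<close> of norm at most \<open>3\<^sup>-\<^sup>j\<close> produce a limit point at which the operators are unbounded.\<close>

lemma uniform_boundedness_L2:
  fixes X :: "nat \<Rightarrow> 'n::finite L2 \<Rightarrow> 'n L2"
  assumes lin: "\<And>k. bounded_linear (X k)"
    and bdd: "\<And>u. bounded (range (\<lambda>k. X k u))"
  shows "\<exists>K. \<forall>k u. norm (X k u) \<le> K * norm u"
proof (rule ccontr)
  assume not: "\<not> ?thesis"
  have "\<exists>k. onorm (X k) > c" for c
    using not onorm[OF lin]
    by (metis (no_types, lifting) linorder_not_less mult_right_mono norm_ge_zero order_trans)
  then have "\<forall>j::nat. \<exists>k. onorm (X k) > 4 ^ j" by blast
  \<comment> \<open>Any rate above 3 would do: the corrections shrink like 3^(-j), which leaves a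
    growth of (4/3)^j.\<close>
  then obtain \<kappa> where \<kappa>: "\<And>j::nat. onorm (X (\<kappa> j)) > 4 ^ j" by metis
  define T where "T j = X (\<kappa> j)" for j
  have T: "bounded_linear (T j)" for j by (simp add: T_def lin)
  have on: "onorm (T j) > 4 ^ j" for j by (simp add: T_def \<kappa>)
  have onp: "onorm (T j) > 0" for j by (rule less_trans[OF _ on]) simp
  have "\<exists>z. norm z \<le> (1/3) ^ j \<and> norm (T j (x + z)) \<ge> (2/3) * (1/3) ^ j * onorm (T j)" for j x
  proof -
    \<comment> \<open>The operator norm is reached up to any factor below 1; this one has to exceed
      the 1/2 in the tail bound \<open>yx\<close>.\<close>
    have "\<exists>y. norm (T j y) > (2/3) * onorm (T j) * norm y"
    proof (rule ccontr)
      assume "\<not> ?thesis"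
      then have "norm (T j y) \<le> (2/3) * onorm (T j) * norm y" for y by (simp add: not_less)
      then have "onorm (T j) \<le> (2/3) * onorm (T j)"
        by (rule onorm_bound[rotated]) (use onp[of j] in simp)
      then show False using onp[of j] by simp
    qed
    then obtain y where y: "norm (T j y) > (2/3) * onorm (T j) * norm y" by blast
    have y0: "y \<noteq> 0" using y bounded_linear.linear[OF T[of j], THEN linear_0] by auto
    define z where "z = ((1/3) ^ j / norm y) *\<^sub>R y"
    have nz: "norm z = (1/3) ^ j" using y0 by (simp add: z_def)
    have Tz: "norm (T j z) \<ge> (2/3) * (1/3) ^ j * onorm (T j)"
    proof -
      have "norm (T j z) = (1/3) ^ j / norm y * norm (T j y)"
        by (simp add: z_def linear_scale[OF bounded_linear.linear[OF T]])
      also have "\<dots> \<ge> (1/3) ^ j / norm y * ((2/3) * onorm (T j) * norm y)"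
        using y by (intro mult_left_mono) auto
      finally show ?thesis using y0 by (simp add: field_simps)
    qed
    have "T j z + T j z = T j (x + z) - T j (x + (- z))"
      using bounded_linear.linear[OF T[of j]] by (simp add: linear_add linear_diff)
    then have "2 * norm (T j z) \<le> norm (T j (x + z)) + norm (T j (x + (- z)))"
      using norm_triangle_ineq4[of "T j (x + z)" "T j (x + (- z))"] norm_scaleR[of 2 "T j z"]
      by (simp add: scaleR_2)
    then have "norm (T j (x + z)) \<ge> norm (T j z) \<or> norm (T j (x + (- z))) \<ge> norm (T j z)" by linarith
    then show ?thesis
    proof
      assume "norm (T j (x + z)) \<ge> norm (T j z)"
      then show ?thesis using nz Tz by (intro exI[of _ z]) simp
    next
      assume "norm (T j (x + (- z))) \<ge> norm (T j z)"
      then show ?thesis using nz Tz by (intro exI[of _ "- z"]) simp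
    qed
  qed
  then obtain Z where Z: "\<And>j x. norm (Z j x) \<le> (1/3) ^ j"
    "\<And>j x. norm (T j (x + Z j x)) \<ge> (2/3) * (1/3) ^ j * onorm (T j)" by metis
  define x where "x = rec_nat 0 (\<lambda>j y. y + Z j y)"
  have xS: "x (Suc j) = x j + Z j (x j)" for j by (simp add: x_def)
  have x0: "x 0 = 0" by (simp add: x_def)
  define d where "d j = Z j (x j)" for j
  have sd: "summable d"
    by (rule summable_L2, rule summable_comparison_test'[of "\<lambda>j. (1/3::real) ^ j"])
      (auto simp: d_def Z(1) intro: summable_geometric)
  have nd: "summable (\<lambda>j. norm (d j))"
    by (rule summable_comparison_test'[of "\<lambda>j. (1/3::real) ^ j"]) (auto simp: d_def Z(1) intro: summable_geometric)
  have xsum: "x j = (\<Sum>i<j. d i)" for j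
    by (induction j) (simp_all add: x0 xS d_def)
  define y where "y = suminf d"
  \<comment> \<open>The corrections after stage j sum to at most 3^(-j-1) / (1 - 1/3) = 3^(-j) / 2,
    less than the share 2/3 gained at stage j. The difference is the 1/6 in
    \<open>grow\<close>.\<close>
  have yx: "norm (y - x (Suc j)) \<le> (1/2) * (1/3) ^ j" for j
  proof -
    have "y - x (Suc j) = (\<Sum>i. d (i + Suc j))"
      unfolding y_def xsum by (subst suminf_split_initial_segment[OF sd, where k = "Suc j"]) simp
    moreover have s': "summable (\<lambda>i. norm (d (i + Suc j)))" using nd by (subst summable_iff_shift)
    ultimately have "norm (y - x (Suc j)) \<le> (\<Sum>i. norm (d (i + Suc j)))"
      using norm_suminf_le_suminf_norm[OF summable_ignore_initial_segment[OF sd] s'] by simp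
    also have "\<dots> \<le> (\<Sum>i. (1/3) ^ Suc j * (1/3::real) ^ i)"
    proof (rule suminf_le[OF _ s'])
      show "norm (d (i + Suc j)) \<le> (1/3) ^ Suc j * (1/3) ^ i" for i
        using Z(1)[of "i + Suc j"] by (simp add: d_def power_add mult.commute)
    qed (intro summable_mult summable_geometric, simp)
    also have "\<dots> = (1/2) * (1/3) ^ j"
      by (subst suminf_mult) (auto simp: suminf_geometric intro: summable_geometric)
    finally show ?thesis .
  qed
  have grow: "norm (T j y) \<ge> (1/6) * (4/3) ^ j" for j
  proof -
    have "norm (T j (x (Suc j))) \<le> norm (T j y) + norm (T j (y - x (Suc j)))"
      unfolding linear_diff[OF bounded_linear.linear[OF T[of j]]]
      using norm_triangle_sub[of "T j (x (Suc j))" "T j y"] by (simp add: norm_minus_commute)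
    moreover have "norm (T j (y - x (Suc j))) \<le> onorm (T j) * ((1/2) * (1/3) ^ j)"
      using onorm[OF T, of j "y - x (Suc j)"] mult_left_mono[OF yx, of "onorm (T j)" j] onp[of j] by linarith
    moreover have "norm (T j (x (Suc j))) \<ge> (2/3) * (1/3) ^ j * onorm (T j)"
      unfolding xS by (rule Z(2))
    ultimately have "norm (T j y) \<ge> (1/6) * (1/3) ^ j * onorm (T j)" by (simp add: algebra_simps)
    also have "(1/6) * (1/3) ^ j * onorm (T j) \<ge> (1/6) * (1/3) ^ j * 4 ^ j"
      using on[of j] by (intro mult_left_mono) auto
    finally show ?thesis by (simp add: power_divide)
  qed
  obtain b where b: "\<And>k. norm (X k y) \<le> b" using bdd[of y] by (auto simp: bounded_iff)
  obtain j where "(4/3::real) ^ j > 6 * b" using real_arch_pow[of "4/3"] by auto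
  then show False using grow[of j] b[of "\<kappa> j"] by (simp add: T_def)
qed

text \<open>If no bound held near 0, there would be operators \<open>T (\<tau> k)\<close> with times
  tending to 0 and norms above k; they converge pointwise by strong continuity, against uniform
  boundedness. The semigroup law then carries the bound from [0, \<delta>] to every multiple of
  \<delta>.\<close>

lemma C0_semigroup_locally_bounded:
  assumes "C0_semigroup T"
  shows "\<exists>M. \<forall>t\<in>{0..a}. \<forall>u. norm (T t u) \<le> M * norm u"
proof -
  have lin: "bounded_linear (T t)" if "t \<ge> 0" for t
    using assms that by (simp add: C0_semigroup_def bounded_clinear_L2_def)
  have T0: "T 0 = id" and add: "\<And>r t. r \<ge> 0 \<Longrightarrow> t \<ge> 0 \<Longrightarrow> T (r + t) u = T r (T t u)"
    and lim: "((\<lambda>t. T t u) \<longlongrightarrow> u) (at_right 0)" for u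
    using assms by (auto simp: C0_semigroup_def)
  have "\<exists>\<delta>>0. \<exists>M. \<forall>t\<in>{0..\<delta>}. \<forall>u. norm (T t u) \<le> M * norm u"
  proof (rule ccontr)
    assume not: "\<not> ?thesis"
    have "\<exists>t\<in>{0..1 / real (Suc k)}. \<exists>u. norm (T t u) > real k * norm u" for k
      using not by (metis not_less of_nat_0_less_iff zero_less_Suc zero_less_divide_1_iff)
    then obtain \<tau> where \<tau>: "\<And>k. \<tau> k \<in> {0..1 / real (Suc k)}" "\<And>k. \<exists>u. norm (T (\<tau> k) u) > real k * norm u"
      by metis
    have "\<tau> \<longlonglongrightarrow> 0"
      by (rule tendsto_sandwich[OF _ _ tendsto_const LIMSEQ_inverse_real_of_nat])
        (use \<tau>(1) in \<open>auto simp: inverse_eq_divide\<close>)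
    have "(\<lambda>k. T (\<tau> k) u) \<longlonglongrightarrow> u" for u
    proof -
      \<comment> \<open>\<open>\<tau> k\<close> may be 0, where \<open>at_right 0\<close> says
        nothing; so the limit is taken within \<open>{0..}\<close>, with
        \<open>T 0 = id\<close>.\<close>
      have "((\<lambda>t. T t u) \<longlongrightarrow> T 0 u) (at 0 within {0..})"
        using lim[of u] by (simp add: T0 at_within_Ici_at_right)
      then have c: "((\<lambda>t. T t u) \<longlongrightarrow> T 0 u) (inf (nhds 0) (principal {0..}))"
        by (subst tendsto_at_within_iff_tendsto_nhds[symmetric]) 
      have "filterlim \<tau> (inf (nhds 0) (principal {0..})) sequentially"
        using \<open>\<tau> \<longlonglongrightarrow> 0\<close> \<tau>(1) by (auto simp: filterlim_inf filterlim_principal)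
      from filterlim_compose[OF c this] show ?thesis by (simp add: T0)
    qed
    then have "bounded (range (\<lambda>k. T (\<tau> k) u))" for u
      using convergent_imp_bounded by (metis comp_def)
    then obtain K where K: "\<And>k u. norm (T (\<tau> k) u) \<le> K * norm u"
      using uniform_boundedness_L2[of "\<lambda>k. T (\<tau> k)"] lin \<tau>(1) by (metis atLeastAtMost_iff)
    obtain k where "real k \<ge> K" using real_arch_simple by blast
    moreover obtain u where "norm (T (\<tau> k) u) > real k * norm u" using \<tau>(2) by blast
    ultimately show False using K[of k u] by (smt (verit) mult_right_mono norm_ge_zero)
  qed
  then obtain \<delta> M where \<delta>: "\<delta> > 0" and M: "\<And>t u. t \<in> {0..\<delta>} \<Longrightarrow> norm (T t u) \<le> M * norm u" by blast
  have "\<exists>M. \<forall>t\<in>{0..real n * \<delta>}. \<forall>u. norm (T t u) \<le> M * norm u" for n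
  proof (induction n)
    case 0
    show ?case by (rule exI[of _ 1]) (simp add: T0)
  next
    case (Suc n)
    then obtain M' where M': "\<And>t u. t \<in> {0..real n * \<delta>} \<Longrightarrow> norm (T t u) \<le> M' * norm u" by blast
    have "norm (T t u) \<le> max M' (\<bar>M\<bar> * \<bar>M'\<bar>) * norm u" if t: "t \<in> {0..real (Suc n) * \<delta>}" for t u
    proof (cases "t \<le> real n * \<delta>")
      case True
      then have "norm (T t u) \<le> M' * norm u" using t M' by simp
      also have "\<dots> \<le> max M' (\<bar>M\<bar> * \<bar>M'\<bar>) * norm u" by (intro mult_right_mono) auto
      finally show ?thesis .
    next
      case False
      have nd: "0 \<le> real n * \<delta>" using \<delta> by simp
      have "norm (T t u) = norm (T (t - real n * \<delta>) (T (real n * \<delta>) u))"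
        using add[of "t - real n * \<delta>" "real n * \<delta>" u] False nd by simp
      also have "\<dots> \<le> M * norm (T (real n * \<delta>) u)"
        using False t by (intro M) (auto simp: algebra_simps)
      also have "\<dots> \<le> \<bar>M\<bar> * norm (T (real n * \<delta>) u)" by (intro mult_right_mono) auto
      also have "\<dots> \<le> \<bar>M\<bar> * (M' * norm u)" using nd by (intro mult_left_mono M') auto
      also have "\<dots> \<le> \<bar>M\<bar> * (\<bar>M'\<bar> * norm u)" by (intro mult_left_mono mult_right_mono) auto
      also have "\<dots> \<le> max M' (\<bar>M\<bar> * \<bar>M'\<bar>) * norm u"
        by (simp add: mult.assoc[symmetric] mult_right_mono)
      finally show ?thesis .
    qed
    then show ?case by blast
  qed
  moreover obtain n where "real n * \<delta> > a" using \<delta> by (metis reals_Archimedean3)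
  ultimately show ?thesis by (metis atLeastAtMost_iff less_imp_le order_trans)
qed

section \<open>The Duhamel estimate\<close>

text \<open>Continuous induction: the range of the local bound may depend on \<tau>, but the
  supremum of the times up to which the global bound holds is attained by continuity and can be
  passed unless it is \<open>a\<close>. The steps go to the right only, because
  \<open>generator\<close> is a limit from the right.\<close>

lemma right_lipschitz_bound:
  fixes w :: "real \<Rightarrow> 'a::real_normed_vector"
  assumes a: "0 \<le> a" and cont: "continuous_on {0..a} w"
    and step: "\<And>\<tau>. 0 \<le> \<tau> \<Longrightarrow> \<tau> < a \<Longrightarrow> eventually (\<lambda>h. norm (w (\<tau> + h) - w \<tau>) \<le> C * h) (at_right 0)"
  shows "norm (w a - w 0) \<le> C * a"
proof -
  define S where "S = {\<tau>\<in>{0..a}. \<forall>\<sigma>\<in>{0..\<tau>}. norm (w \<sigma> - w 0) \<le> C * \<sigma>}"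
  have S0: "0 \<in> S" using a by (simp add: S_def)
  have bdd: "bdd_above S" by (rule bdd_aboveI[of _ a]) (simp add: S_def)
  define c where "c = Sup S"
  have c0: "0 \<le> c" unfolding c_def by (rule cSup_upper[OF S0 bdd])
  have ca: "c \<le> a" unfolding c_def using S0 by (intro cSup_least) (auto simp: S_def)
  have below: "norm (w \<sigma> - w 0) \<le> C * \<sigma>" if "0 \<le> \<sigma>" "\<sigma> < c" for \<sigma>
  proof -
    have "\<exists>\<tau>\<in>S. \<sigma> < \<tau>" using that(2) less_cSup_iff[of S \<sigma>] bdd S0 c_def by blast
    then obtain \<tau> where "\<tau> \<in> S" "\<sigma> < \<tau>" by blast
    then show ?thesis using that by (auto simp: S_def)
  qed
  have at_c: "norm (w c - w 0) \<le> C * c"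
  proof (cases "c = 0")
    case False
    have "(w \<longlongrightarrow> w c) (at c within {0..a})" using cont c0 ca by (simp add: continuous_on_def)
    then have "(w \<longlongrightarrow> w c) (at c within {0..c})"
      by (rule tendsto_within_subset) (use ca in auto)
    then have "((\<lambda>\<sigma>. norm (w \<sigma> - w 0) - C * \<sigma>) \<longlongrightarrow> norm (w c - w 0) - C * c) (at c within {0..c})"
      by (intro tendsto_intros)
    moreover have "eventually (\<lambda>\<sigma>. norm (w \<sigma> - w 0) - C * \<sigma> \<le> 0) (at c within {0..c})"
      using below by (auto simp: eventually_at_filter)
    moreover have "at c within {0..c} \<noteq> bot"
      using False c0 at_within_Icc_at_left[of 0 c] by (simp add: trivial_limit_at_left_real)
    ultimately have "norm (w c - w 0) - C * c \<le> 0" by (rule tendsto_upperbound)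
    then show ?thesis by simp
  qed simp
  have "c = a"
  proof (rule ccontr)
    assume "c \<noteq> a"
    then obtain \<delta> where \<delta>: "\<delta> > 0" and st: "\<And>h. 0 < h \<Longrightarrow> h < \<delta> \<Longrightarrow> norm (w (c + h) - w c) \<le> C * h"
      using step[of c] c0 ca by (auto simp: eventually_at_right_field)
    define e where "e = min (\<delta> / 2) (a - c)"
    have e: "0 < e" "e < \<delta>" "c + e \<le> a" using \<delta> \<open>c \<noteq> a\<close> ca by (auto simp: e_def min_def)
    have "norm (w \<sigma> - w 0) \<le> C * \<sigma>" if "\<sigma> \<in> {0..c + e}" for \<sigma>
    proof -
      consider "\<sigma> < c" | "\<sigma> = c" | "\<sigma> > c" by linarith
      then show ?thesis
      proof cases
        case 3
        have "norm (w \<sigma> - w 0) \<le> norm (w \<sigma> - w c) + norm (w c - w 0)"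
          using norm_triangle_ineq[of "w \<sigma> - w c" "w c - w 0"] by simp
        also have "norm (w \<sigma> - w c) \<le> C * (\<sigma> - c)" using st[of "\<sigma> - c"] 3 that e by simp
        finally show ?thesis using at_c by (simp add: algebra_simps)
      qed (use below at_c that in auto)
    qed
    then have "c + e \<in> S" using e c0 by (simp add: S_def)
    then have "c + e \<le> c" unfolding c_def by (rule cSup_upper[OF _ bdd])
    then show False using e by simp
  qed
  then show ?thesis using at_c by simp
qed

text \<open>The curve \<open>w \<tau> = T \<tau> (u (a - \<tau>))\<close> joins \<open>u a\<close>
  to \<open>T a (u 0)\<close>, and its right derivative is \<open>T \<tau>\<close> applied to g - u'
  at time a - \<tau>. A Lipschitz bound for this curve takes the place of the integral in Duhamel's
  formula.\<close>

lemma C0_semigroup_duhamel: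
  fixes T :: "real \<Rightarrow> 'n::finite L2 \<Rightarrow> 'n L2"
  assumes C0: "C0_semigroup T" and a: "0 \<le> a" and "0 \<le> M"
    and M: "\<And>t u. t \<in> {0..a} \<Longrightarrow> norm (T t u) \<le> M * norm u"
    and gen: "\<And>r. r \<in> {0..a} \<Longrightarrow> (u r, g r) \<in> generator T"
    and der: "\<And>r. (u has_vector_derivative u' r) (at r)"
    and K: "\<And>r. r \<in> {0..a} \<Longrightarrow> norm (u' r - g r) \<le> K"
  shows "norm (T a (u 0) - u a) \<le> M * K * a"
proof -
  have lin: "linear (T t)" if "t \<ge> 0" for t
    using C0 that by (simp add: C0_semigroup_def bounded_clinear_L2_def bounded_linear.linear)
  have T0: "T 0 = id" and add: "\<And>r t. r \<ge> 0 \<Longrightarrow> t \<ge> 0 \<Longrightarrow> T (r + t) v = T r (T t v)"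
    and lim: "((\<lambda>t. T t v) \<longlongrightarrow> v) (at_right 0)" for v
    using C0 by (auto simp: C0_semigroup_def)
  have K0: "0 \<le> K" using K[of a] a by (smt (verit) atLeastAtMost_iff norm_ge_zero)
  define w where "w \<tau> = T \<tau> (u (a - \<tau>))" for \<tau>
  \<comment> \<open>Joint continuity at time 0: the uniform bound \<open>M\<close> lets the argument
    move along with the time.\<close>
  have lim0: "((\<lambda>h. T h (x h)) \<longlongrightarrow> v) (at_right 0)" if "(x \<longlongrightarrow> v) (at_right 0)" "a > 0" for x v
  proof -
    have "((\<lambda>h. M * norm (x h - v)) \<longlongrightarrow> M * norm (v - v)) (at_right 0)"
      by (intro tendsto_intros that)
    then have "((\<lambda>h. M * norm (x h - v)) \<longlongrightarrow> 0) (at_right 0)" by simp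
    then have "((\<lambda>h. T h (x h) - T h v) \<longlongrightarrow> 0) (at_right 0)"
    proof (rule Lim_null_comparison[rotated])
      show "eventually (\<lambda>h. norm (T h (x h) - T h v) \<le> M * norm (x h - v)) (at_right 0)"
      proof -
        have "eventually (\<lambda>h. h \<in> {0<..<a}) (at_right 0)"
          using that(2) by (rule eventually_at_right_real)
        then show ?thesis
        proof eventually_elim
          case (elim h)
          then show ?case using M[of h "x h - v"] linear_diff[OF lin[of h]] by simp
        qed
      qed
    qed
    from tendsto_add[OF this lim[of v]] show ?thesis by simp
  qed
  have ucont: "continuous_on UNIV u"
    using der by (meson continuous_at_imp_continuous_on has_vector_derivative_continuous)
  have strong: "continuous_on {0..a} (\<lambda>t. T t v)" for v
  proof (cases "a = 0")
    case False
    have le: "norm (T \<sigma> v - T \<tau> v) \<le> M * norm (T \<bar>\<sigma> - \<tau>\<bar> v - v)" if "\<sigma> \<in> {0..a}" "\<tau> \<in> {0..a}" for \<sigma> \<tau>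
    proof -
      have *: "norm (T \<sigma> v - T \<tau> v) \<le> M * norm (T (\<tau> - \<sigma>) v - v)" if "0 \<le> \<sigma>" "\<sigma> \<le> \<tau>" "\<tau> \<le> a" for \<sigma> \<tau>
      proof -
        have "T \<tau> v - T \<sigma> v = T \<sigma> (T (\<tau> - \<sigma>) v - v)"
          using add[of \<sigma> "\<tau> - \<sigma>" v] that linear_diff[OF lin[of \<sigma>]] by simp
        then have "norm (T \<tau> v - T \<sigma> v) \<le> M * norm (T (\<tau> - \<sigma>) v - v)"
          using M[of \<sigma>] that by simp
        then show ?thesis by (simp add: norm_minus_commute)
      qed
      show ?thesis using *[of \<sigma> \<tau>] *[of \<tau> \<sigma>] that by (cases "\<sigma> \<le> \<tau>") (auto simp: norm_minus_commute)
    qed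
    have "((\<lambda>t. T t v) \<longlongrightarrow> T \<tau> v) (at \<tau> within {0..a})" if \<tau>: "\<tau> \<in> {0..a}" for \<tau>
    proof -
      have "((\<lambda>\<sigma>. \<bar>\<sigma> - \<tau>\<bar>) \<longlongrightarrow> \<bar>\<tau> - \<tau>\<bar>) (at \<tau> within {0..a})" by (intro tendsto_intros)
      then have "filterlim (\<lambda>\<sigma>. \<bar>\<sigma> - \<tau>\<bar>) (at_right 0) (at \<tau> within {0..a})"
        by (auto simp: filterlim_at eventually_at_filter)
      from filterlim_compose[OF lim[of v] this]
      have "((\<lambda>\<sigma>. M * norm (T \<bar>\<sigma> - \<tau>\<bar> v - v)) \<longlongrightarrow> M * norm (v - v)) (at \<tau> within {0..a})"
        by (intro tendsto_intros)
      then have "((\<lambda>\<sigma>. M * norm (T \<bar>\<sigma> - \<tau>\<bar> v - v)) \<longlongrightarrow> 0) (at \<tau> within {0..a})" by simp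
      then have "((\<lambda>\<sigma>. T \<sigma> v - T \<tau> v) \<longlongrightarrow> 0) (at \<tau> within {0..a})"
        by (rule Lim_null_comparison[rotated]) (use le \<tau> in \<open>auto simp: eventually_at_filter\<close>)
      then show ?thesis by (simp add: LIM_zero_iff)
    qed
    then show ?thesis by (simp add: continuous_on_def)
  qed simp
  have wcont: "continuous_on {0..a} w"
    unfolding continuous_on_def
  proof
    fix \<tau> assume \<tau>: "\<tau> \<in> {0..a}"
    have "isCont u (a - \<tau>)" using ucont by (simp add: continuous_on_eq_continuous_at)
    then have "((\<lambda>\<sigma>. u (a - \<sigma>)) \<longlongrightarrow> u (a - \<tau>)) (at \<tau> within {0..a})"
      by (intro isCont_tendsto_compose[of _ u] tendsto_intros)
    then have "((\<lambda>\<sigma>. M * norm (u (a - \<sigma>) - u (a - \<tau>))) \<longlongrightarrow> M * norm (u (a - \<tau>) - u (a - \<tau>)))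
        (at \<tau> within {0..a})" by (intro tendsto_intros)
    then have "((\<lambda>\<sigma>. M * norm (u (a - \<sigma>) - u (a - \<tau>))) \<longlongrightarrow> 0) (at \<tau> within {0..a})" by simp
    then have "((\<lambda>\<sigma>. T \<sigma> (u (a - \<sigma>)) - T \<sigma> (u (a - \<tau>))) \<longlongrightarrow> 0) (at \<tau> within {0..a})"
      by (rule Lim_null_comparison[rotated])
        (auto simp: eventually_at_filter linear_diff[OF lin, symmetric] intro!: always_eventually M)
    moreover have "((\<lambda>\<sigma>. T \<sigma> (u (a - \<tau>))) \<longlongrightarrow> T \<tau> (u (a - \<tau>))) (at \<tau> within {0..a})"
      using strong \<tau> by (simp add: continuous_on_def)
    ultimately show "(w \<longlongrightarrow> w \<tau>) (at \<tau> within {0..a})"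
      unfolding w_def using tendsto_add by fastforce
  qed
  \<comment> \<open>The strict inequality passes from the limit of the difference quotients to all
    small \<open>h\<close>; the excess is removed at the end by letting it tend to 0.\<close>
  have "norm (w a - w 0) \<le> C * a" if C: "C > M * K" for C
  proof (rule right_lipschitz_bound[OF a wcont])
    fix \<tau> assume \<tau>: "0 \<le> \<tau>" "\<tau> < a"
    define \<rho> where "\<rho> = a - \<tau>"
    have \<rho>: "\<rho> \<in> {0..a}" "0 < a" "\<tau> \<in> {0..a}" using \<tau> by (auto simp: \<rho>_def)
    have "((\<lambda>h. (u (\<rho> - h) - u \<rho>) /\<^sub>R h) \<longlongrightarrow> - u' \<rho>) (at_right 0)"
    proof -
      have "((\<lambda>h. (u (\<rho> + h) - u \<rho>) /\<^sub>R h) \<longlongrightarrow> u' \<rho>) (at 0)"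
      proof (rule LIM_zero_cancel, rule tendsto_norm_zero_cancel, rule Lim_transform_eventually)
        show "((\<lambda>h. norm (u (\<rho> + h) - u \<rho> - h *\<^sub>R u' \<rho>) / norm h) \<longlongrightarrow> 0) (at 0)"
          using der[of \<rho>] unfolding has_vector_derivative_def has_derivative_at by simp
        have "norm (u (\<rho> + h) - u \<rho> - h *\<^sub>R u' \<rho>) / norm h = norm ((u (\<rho> + h) - u \<rho>) /\<^sub>R h - u' \<rho>)"
          if "h \<noteq> 0" for h
        proof -
          have "(u (\<rho> + h) - u \<rho>) /\<^sub>R h - u' \<rho> = (u (\<rho> + h) - u \<rho> - h *\<^sub>R u' \<rho>) /\<^sub>R h"
            using that by (simp add: scaleR_diff_right)
          then show ?thesis by (simp add: divide_inverse mult.commute)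
        qed
        then show "\<forall>\<^sub>F h in at 0. norm (u (\<rho> + h) - u \<rho> - h *\<^sub>R u' \<rho>) / norm h = norm ((u (\<rho> + h) - u \<rho>) /\<^sub>R h - u' \<rho>)"
          by (simp add: eventually_at_filter)
      qed
      moreover have "filterlim (\<lambda>h::real. - h) (at 0) (at_right 0)"
        by (auto simp: filterlim_at eventually_at_filter intro!: tendsto_eq_intros)
      ultimately have "((\<lambda>h. (u (\<rho> + - h) - u \<rho>) /\<^sub>R (- h)) \<longlongrightarrow> u' \<rho>) (at_right 0)"
        by (rule filterlim_compose)
      from tendsto_minus[OF this] show ?thesis by simp
    qed
    then have 1: "((\<lambda>h. T h ((u (\<rho> - h) - u \<rho>) /\<^sub>R h)) \<longlongrightarrow> - u' \<rho>) (at_right 0)"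
      by (rule lim0[OF _ \<rho>(2)])
    have 2: "((\<lambda>h. (T h (u \<rho>) - u \<rho>) /\<^sub>R h) \<longlongrightarrow> g \<rho>) (at_right 0)"
      using gen[OF \<rho>(1)] by (simp add: generator_def)
    have "((\<lambda>h. M * norm (T h ((u (\<rho> - h) - u \<rho>) /\<^sub>R h) + (T h (u \<rho>) - u \<rho>) /\<^sub>R h)) \<longlongrightarrow>
        M * norm (- u' \<rho> + g \<rho>)) (at_right 0)"
      by (intro tendsto_intros 1 2)
    moreover have "M * norm (- u' \<rho> + g \<rho>) < C"
    proof -
      have "M * norm (- u' \<rho> + g \<rho>) \<le> M * K"
        using K[OF \<rho>(1)] \<open>0 \<le> M\<close> by (intro mult_left_mono) (auto simp: norm_minus_commute add.commute)
      then show ?thesis using C by simp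
    qed
    ultimately have "eventually (\<lambda>h. M * norm (T h ((u (\<rho> - h) - u \<rho>) /\<^sub>R h) + (T h (u \<rho>) - u \<rho>) /\<^sub>R h) < C) (at_right 0)"
      by (rule order_tendstoD)
    moreover have "eventually (\<lambda>h. h \<in> {0<..<a - \<tau>}) (at_right 0)"
      using \<tau> by (intro eventually_at_right_real) simp
    ultimately show "eventually (\<lambda>h. norm (w (\<tau> + h) - w \<tau>) \<le> C * h) (at_right 0)"
    proof eventually_elim
      case (elim h)
      then have h: "0 < h" "\<tau> + h \<le> a" by auto
      have lh: "linear (T h)" "linear (T \<tau>)" using lin h \<tau> by auto
      \<comment> \<open>The increments of \<open>u\<close> and of the semigroup are separated: T h
        (u (\<rho> - h)) - u \<rho> is the sum of T h (u (\<rho> - h) - u \<rho>) and T h (u \<rho>)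
        - u \<rho>.\<close>
      let ?D = "T h ((u (\<rho> - h) - u \<rho>) /\<^sub>R h) + (T h (u \<rho>) - u \<rho>) /\<^sub>R h"
      have "h *\<^sub>R ?D = T h (u (\<rho> - h)) - u \<rho>"
        using h(1) by (simp add: scaleR_add_right linear_scale[OF lh(1)] linear_diff[OF lh(1)])
      moreover have "w (\<tau> + h) - w \<tau> = T \<tau> (T h (u (\<rho> - h)) - u \<rho>)"
        using add[of \<tau> h] \<tau> h linear_diff[OF lh(2)] by (simp add: w_def \<rho>_def algebra_simps)
      ultimately have "w (\<tau> + h) - w \<tau> = T \<tau> (h *\<^sub>R ?D)" by simp
      then have "norm (w (\<tau> + h) - w \<tau>) \<le> M * norm (h *\<^sub>R ?D)"
        using M[OF \<rho>(3), of "h *\<^sub>R ?D"] by (simp only:)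
      also have "\<dots> = (M * norm ?D) * h" using h(1) by simp
      also have "\<dots> \<le> C * h" using elim(1) h(1) by (intro mult_right_mono) auto
      finally show ?case .
    qed
  qed
  then have "norm (w a - w 0) \<le> M * K * a"
  proof -
    have "norm (w a - w 0) \<le> M * K * a + e" if "e > 0" for e
    proof (cases "a = 0")
      case False
      then have "a > 0" using a by simp
      then show ?thesis using \<open>\<And>C. C > M * K \<Longrightarrow> _\<close>[of "M * K + e / a"] that
        by (simp add: algebra_simps)
    qed (use that in simp)
    then show ?thesis by (rule field_le_epsilon)
  qed
  then show ?thesis by (simp add: w_def T0)
qed

section \<open>Linear changes of variables and product integrals\<close>

lemma ennreal_mult_right_cancel:
  assumes "a * ennreal c = b * ennreal c" "0 < c"
  shows "a = b"
proof -
  have "ennreal c * a = ennreal c * b" using assms(1) by (simp add: mult.commute)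
  then show ?thesis using assms(2) by (auto simp: ennreal_mult_cancel_left)
qed

text \<open>For invertible \<open>A\<close> this is \<open>1 / \<bar>det A\<bar>\<close>; it vanishes for singular \<open>A\<close>, where the measure is infinite.\<close>

definition lin_scale :: "real ^ 'n ^ 'n \<Rightarrow> real" where
  "lin_scale A = measure lborel ((*v) A -` ball 0 1) / measure lborel (ball (0 :: real ^ 'n) 1)"

lemma borel_measurable_matrix_vector [measurable]:
  fixes A :: "real ^ 'n ^ 'm"
  shows "(*v) A \<in> borel_measurable borel"
  by (intro borel_measurable_continuous_onI linear_continuous_on) (simp add: matrix_vector_mul_bounded_linear)

lemma nn_integral_lborel_translate:
  fixes f :: "'a::euclidean_space \<Rightarrow> ennreal"
  assumes [measurable]: "f \<in> borel_measurable borel"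
  shows "(\<integral>\<^sup>+x. f (c + x) \<partial>lborel) = (\<integral>\<^sup>+x. f x \<partial>lborel)"
proof -
  have "(\<integral>\<^sup>+x. f x \<partial>lborel) = (\<integral>\<^sup>+x. f x \<partial>distr lborel borel ((+) c))"
    by (simp add: lborel_distr_plus)
  also have "\<dots> = (\<integral>\<^sup>+x. f (c + x) \<partial>lborel)" by (subst nn_integral_distr) auto
  finally show ?thesis by simp
qed

lemma matrix_inverse_vector:
  fixes A A' :: "real ^ 'n ^ 'n"
  assumes "A ** A' = mat 1"
  shows "A *v (A' *v x) = x" "A' *v (A *v x) = x"
  using assms assms[unfolded matrix_left_right_inverse[of A A']] by (simp_all add: matrix_vector_mul_assoc)

text \<open>The preimage is the image of the ball under the inverse, hence bounded, and it is an
  open neighbourhood of 0. So \<open>lin_scale\<close> is a finite positive number.\<close>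

lemma vimage_ball_bounds:
  fixes A :: "real ^ 'n ^ 'n"
  assumes inv: "A ** A' = mat 1"
  shows "(*v) A -` ball 0 1 \<in> sets borel" and "emeasure lborel ((*v) A -` ball 0 1) < \<infinity>"
    and "0 < measure lborel ((*v) A -` ball 0 1)"
    and "bounded ((*v) A -` ball 0 1)"
proof -
  let ?S = "(*v) A -` ball 0 1"
  have o: "open ?S"
    by (intro open_vimage open_ball linear_continuous_on) (simp add: matrix_vector_mul_bounded_linear)
  then show "?S \<in> sets borel" by simp
  have "?S = (*v) A' ` ball 0 1"
  proof safe
    fix x assume "A *v x \<in> ball 0 1"
    then show "x \<in> (*v) A' ` ball 0 1"
      using matrix_inverse_vector(2)[OF inv, of x] by (metis imageI)
  qed (use matrix_inverse_vector(1)[OF inv] in simp)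
  then show b: "bounded ?S"
    by (simp add: bounded_linear_image matrix_vector_mul_bounded_linear)
  then show fin: "emeasure lborel ?S < \<infinity>" by (rule emeasure_bounded_finite)
  have "0 \<in> ?S" by simp
  then obtain e where e: "e > 0" "ball 0 e \<subseteq> ?S" using o by (metis open_contains_ball)
  have "0 < measure lborel (ball (0 :: real ^ 'n) e)" using content_ball_pos[OF e(1), of 0] by simp
  also have "\<dots> \<le> measure lborel ?S"
    by (rule measure_mono_fmeasurable[OF e(2)]) (use o fin in \<open>auto simp: fmeasurable_def\<close>)
  finally show "0 < measure lborel ?S" .
qed

lemma lin_scale_pos:
  assumes "A ** A' = mat 1"
  shows "0 < lin_scale A"
  using vimage_ball_bounds(3)[OF assms] content_ball_pos[of 1 "0 :: real ^ 'n"]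
  by (simp add: lin_scale_def zero_less_divide_iff)

text \<open>Haar uniqueness by Tonelli: integrating \<open>f (A x + y)\<close> over all \<open>x\<close> and all \<open>y\<close> in the
  unit ball in both orders. The change-of-variables theorems of the library need a well-ordered
  index type.\<close>

lemma nn_integral_linear_image:
  fixes A :: "real ^ 'n ^ 'n"
  assumes inv: "A ** A' = mat 1" and f [measurable]: "f \<in> borel_measurable borel"
  shows "(\<integral>\<^sup>+x. f (A *v x) \<partial>lborel) = ennreal (lin_scale A) * (\<integral>\<^sup>+x. f x \<partial>lborel)"
proof -
  let ?b = "ball (0 :: real ^ 'n) 1"
  define g where "g = (indicator ?b :: real ^ 'n \<Rightarrow> ennreal)"
  have g [measurable]: "g \<in> borel_measurable borel" unfolding g_def by (intro borel_measurable_indicator) simp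
  let ?I = "\<integral>\<^sup>+x. f x \<partial>lborel" and ?J = "\<integral>\<^sup>+x. f (A *v x) \<partial>lborel"
  \<comment> \<open>A shift by y behind \<open>A\<close> is a shift of the variable by A' y, to
    which translation invariance applies.\<close>
  have tr: "A *v (A' *v y + x) = A *v x + y" for x y
    by (simp add: matrix_vector_right_distrib matrix_inverse_vector[OF inv])
  have "(\<integral>\<^sup>+y. \<integral>\<^sup>+x. f (A *v x + y) * g y \<partial>lborel \<partial>lborel) = (\<integral>\<^sup>+y. ?J * g y \<partial>lborel)"
  proof (rule nn_integral_cong)
    fix y
    have "(\<integral>\<^sup>+x. f (A *v x + y) \<partial>lborel) = (\<integral>\<^sup>+x. f (A *v (A' *v y + x)) \<partial>lborel)" by (simp add: tr)
    also have "\<dots> = ?J" by (rule nn_integral_lborel_translate) simp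
    finally show "(\<integral>\<^sup>+x. f (A *v x + y) * g y \<partial>lborel) = ?J * g y" by (simp add: nn_integral_multc)
  qed
  also have "\<dots> = ?J * emeasure lborel ?b" unfolding g_def by (rule nn_integral_cmult_indicator) simp
  finally have 1: "(\<integral>\<^sup>+y. \<integral>\<^sup>+x. f (A *v x + y) * g y \<partial>lborel \<partial>lborel) = ?J * emeasure lborel ?b" .
  have "(\<integral>\<^sup>+y. \<integral>\<^sup>+x. f (A *v x + y) * g y \<partial>lborel \<partial>lborel) =
      (\<integral>\<^sup>+x. \<integral>\<^sup>+y. f (A *v x + y) * g y \<partial>lborel \<partial>lborel)"
    by (rule lborel_pair.Fubini') measurable
  also have "\<dots> = (\<integral>\<^sup>+x. \<integral>\<^sup>+y. f y * g (y - A *v x) \<partial>lborel \<partial>lborel)"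
  proof (rule nn_integral_cong)
    fix x
    show "(\<integral>\<^sup>+y. f (A *v x + y) * g y \<partial>lborel) = (\<integral>\<^sup>+y. f y * g (y - A *v x) \<partial>lborel)"
      using nn_integral_lborel_translate[of "\<lambda>y. f y * g (y - A *v x)" "A *v x"] by simp
  qed
  also have "\<dots> = (\<integral>\<^sup>+y. \<integral>\<^sup>+x. f y * g (y - A *v x) \<partial>lborel \<partial>lborel)"
    by (rule lborel_pair.Fubini') measurable
  also have "\<dots> = (\<integral>\<^sup>+y. f y * emeasure lborel ((*v) A -` ?b) \<partial>lborel)"
  proof (rule nn_integral_cong)
    fix y
    have "(\<integral>\<^sup>+x. g (y - A *v x) \<partial>lborel) = (\<integral>\<^sup>+x. g (y - A *v (A' *v y + x)) \<partial>lborel)"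
      by (rule nn_integral_lborel_translate[symmetric]) simp
    also have "\<dots> = (\<integral>\<^sup>+x. indicator ((*v) A -` ?b) x \<partial>lborel)"
      by (simp add: tr g_def indicator_def)
    also have "\<dots> = emeasure lborel ((*v) A -` ?b)"
      using vimage_ball_bounds(1)[OF inv] by simp
    finally show "(\<integral>\<^sup>+x. f y * g (y - A *v x) \<partial>lborel) = f y * emeasure lborel ((*v) A -` ?b)"
      by (simp add: nn_integral_cmult)
  qed
  also have "\<dots> = ?I * emeasure lborel ((*v) A -` ?b)" by (simp add: nn_integral_multc)
  finally have 2: "?J * emeasure lborel ?b = ?I * emeasure lborel ((*v) A -` ?b)" using 1 by simp
  have p: "0 < measure lborel ?b" using content_ball_pos[of 1 "0 :: real ^ 'n"] by simp
  have e1: "emeasure lborel ?b = ennreal (measure lborel ?b)"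
    using emeasure_lborel_ball_finite[of "0 :: real ^ 'n" 1]
    by (intro emeasure_eq_ennreal_measure less_imp_neq) simp
  have e2: "emeasure lborel ((*v) A -` ?b) = ennreal (lin_scale A) * ennreal (measure lborel ?b)"
  proof -
    have "emeasure lborel ((*v) A -` ?b) = ennreal (measure lborel ((*v) A -` ?b))"
      using vimage_ball_bounds(2)[OF inv] by (intro emeasure_eq_ennreal_measure less_imp_neq) simp
    then show ?thesis using p by (simp add: lin_scale_def flip: ennreal_mult)
  qed
  have "?J * ennreal (measure lborel ?b) = (ennreal (lin_scale A) * ?I) * ennreal (measure lborel ?b)"
    using 2 unfolding e1 e2 by (simp add: mult_ac)
  then show ?thesis using p by (rule ennreal_mult_right_cancel)
qed

lemma distr_lborel_matrix:
  fixes A :: "real ^ 'n ^ 'n"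
  assumes inv: "A ** A' = mat 1"
  shows "distr lborel borel ((*v) A) = density lborel (\<lambda>_. ennreal (lin_scale A))"
proof (rule measure_eqI)
  fix S :: "(real ^ 'n) set" assume "S \<in> sets (distr lborel borel ((*v) A))"
  then have [measurable]: "S \<in> sets borel" by simp
  have "emeasure (distr lborel borel ((*v) A)) S = (\<integral>\<^sup>+x. indicator S x \<partial>distr lborel borel ((*v) A))"
    by simp
  also have "\<dots> = (\<integral>\<^sup>+x. indicator S (A *v x) \<partial>lborel)" by (rule nn_integral_distr) auto
  also have "\<dots> = emeasure (density lborel (\<lambda>_. ennreal (lin_scale A))) S"
    by (subst nn_integral_linear_image[OF inv]) (auto simp: emeasure_density nn_integral_cmult)
  finally show "emeasure (distr lborel borel ((*v) A)) S = emeasure (density lborel (\<lambda>_. ennreal (lin_scale A))) S" .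
qed simp

lemma
  fixes A :: "real ^ 'n ^ 'n" and f :: "real ^ 'n \<Rightarrow> 'b::{banach, second_countable_topology}"
  assumes inv: "A ** A' = mat 1" and [measurable]: "f \<in> borel_measurable borel"
  shows integrable_linear_image: "integrable lborel (\<lambda>x. f (A *v x)) \<longleftrightarrow> integrable lborel f"
    and integral_linear_image: "(\<integral>x. f (A *v x) \<partial>lborel) = lin_scale A *\<^sub>R (\<integral>x. f x \<partial>lborel)"
proof -
  have p: "0 < lin_scale A" by (rule lin_scale_pos[OF inv])
  have "integrable lborel (\<lambda>x. f (A *v x)) \<longleftrightarrow> integrable (distr lborel borel ((*v) A)) f"
    by (rule integrable_distr_eq[symmetric]) auto
  also have "\<dots> \<longleftrightarrow> integrable lborel f"
  proof -
    have "integrable lborel f" if "integrable lborel (\<lambda>x. lin_scale A *\<^sub>R f x)"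
      using integrable_scaleR_right[of "inverse (lin_scale A)", OF that] p by simp
    then show ?thesis
      using p by (auto simp: distr_lborel_matrix[OF inv] integrable_density)
  qed
  finally show "integrable lborel (\<lambda>x. f (A *v x)) \<longleftrightarrow> integrable lborel f" .
  have "(\<integral>x. f (A *v x) \<partial>lborel) = (\<integral>x. f x \<partial>distr lborel borel ((*v) A))"
    by (rule integral_distr[symmetric]) auto
  also have "\<dots> = lin_scale A *\<^sub>R (\<integral>x. f x \<partial>lborel)"
    using p by (simp add: distr_lborel_matrix[OF inv] integral_density)
  finally show "(\<integral>x. f (A *v x) \<partial>lborel) = lin_scale A *\<^sub>R (\<integral>x. f x \<partial>lborel)" .
qed

lemma lin_scale_mult:
  fixes A C :: "real ^ 'n ^ 'n"
  assumes A: "A ** A' = mat 1" and C: "C ** C' = mat 1"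
  shows "lin_scale (A ** C) = lin_scale A * lin_scale C"
proof -
  let ?f = "indicator (ball (0 :: real ^ 'n) 1) :: _ \<Rightarrow> ennreal"
  have f [simp]: "?f \<in> borel_measurable borel" by (intro borel_measurable_indicator) simp
  have fA [simp]: "(\<lambda>x. ?f (A *v x)) \<in> borel_measurable borel"
    by (rule measurable_compose[OF borel_measurable_matrix_vector f])
  have AC: "(A ** C) ** (C' ** A') = mat 1"
    by (metis A C matrix_mul_assoc matrix_mul_rid)
  have "ennreal (lin_scale (A ** C)) * (\<integral>\<^sup>+x. ?f x \<partial>lborel) = (\<integral>\<^sup>+x. ?f (A *v (C *v x)) \<partial>lborel)"
    by (subst nn_integral_linear_image[OF AC, symmetric]) (simp_all add: matrix_vector_mul_assoc)
  also have "\<dots> = ennreal (lin_scale C) * (ennreal (lin_scale A) * (\<integral>\<^sup>+x. ?f x \<partial>lborel))"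
    using nn_integral_linear_image[OF C fA] nn_integral_linear_image[OF A f] by simp
  finally have 1: "ennreal (lin_scale (A ** C)) * emeasure lborel (ball (0 :: real ^ 'n) 1) =
      ennreal (lin_scale A * lin_scale C) * emeasure lborel (ball (0 :: real ^ 'n) 1)"
    using lin_scale_pos[OF A] by (simp add: ennreal_mult' mult_ac)
  have 2: "emeasure lborel (ball (0 :: real ^ 'n) 1) = ennreal (measure lborel (ball (0 :: real ^ 'n) 1))"
    using emeasure_lborel_ball_finite[of "0 :: real ^ 'n" 1]
    by (intro emeasure_eq_ennreal_measure less_imp_neq) simp
  have "0 < measure lborel (ball (0 :: real ^ 'n) 1)" using content_ball_pos[of 1 "0 :: real ^ 'n"] by simp
  with 1[unfolded 2] have "ennreal (lin_scale (A ** C)) = ennreal (lin_scale A * lin_scale C)"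
    by (rule ennreal_mult_right_cancel)
  then show ?thesis
    using lin_scale_pos[OF A] lin_scale_pos[OF C] lin_scale_pos[OF AC] by (simp add: ennreal_inj)
qed

lemma lin_scale_inverse:
  fixes A A' :: "real ^ 'n ^ 'n"
  assumes "A ** A' = mat 1"
  shows "lin_scale A * lin_scale A' = 1"
proof -
  have "lin_scale (mat 1 :: real ^ 'n ^ 'n) = 1"
  proof -
    have "(*v) (mat 1 :: real ^ 'n ^ 'n) -` ball 0 1 = ball 0 1" by auto
    then show ?thesis using content_ball_pos[of 1 "0 :: real ^ 'n"] by (simp add: lin_scale_def)
  qed
  then show ?thesis
    using lin_scale_mult[OF assms assms[unfolded matrix_left_right_inverse[of A A']]] assms by simp
qed

text \<open>The preimage of the unit ball under \<open>A\<close> lies in the ball of radius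
  \<open>K\<close>. Together with \<open>flow_bounded\<close> this gives bounds along the flow that
  are uniform in time.\<close>

lemma lin_scale_le:
  fixes A A' :: "real ^ 'n ^ 'n"
  assumes inv: "A ** A' = mat 1" and K: "\<And>x. norm (A' *v x) \<le> K * norm x" "0 < K"
  shows "lin_scale A \<le> measure lborel (ball (0 :: real ^ 'n) K) / measure lborel (ball (0 :: real ^ 'n) 1)"
proof -
  have "norm x < K" if "norm (A *v x) < 1" for x
  proof -
    have "norm x \<le> K * norm (A *v x)" using K(1)[of "A *v x"] matrix_inverse_vector(2)[OF inv, of x] by simp
    also have "\<dots> < K * 1" using that K(2) by (intro mult_strict_left_mono)
    finally show ?thesis by simp
  qed
  then have "(*v) A -` ball 0 1 \<subseteq> ball 0 K" by auto
  then have "measure lborel ((*v) A -` ball 0 1) \<le> measure lborel (ball (0 :: real ^ 'n) K)"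
    by (rule measure_mono_fmeasurable)
      (use vimage_ball_bounds(1)[OF inv] emeasure_lborel_ball_finite[of "0 :: real ^ 'n" K]
        in \<open>simp_all add: fmeasurable_def\<close>)
  then show ?thesis by (simp add: lin_scale_def divide_right_mono)
qed

lemma integral_lborel_translate:
  fixes f :: "'a::euclidean_space \<Rightarrow> 'b::{banach, second_countable_topology}"
  assumes [measurable]: "f \<in> borel_measurable borel"
  shows "integrable lborel (\<lambda>x. f (c + x)) \<longleftrightarrow> integrable lborel f"
    and "(\<integral>x. f (c + x) \<partial>lborel) = (\<integral>x. f x \<partial>lborel)"
  using integrable_distr_eq[of "(+) c" lborel borel f] integral_distr[of "(+) c" lborel borel f]
  by (simp_all add: lborel_distr_plus)

text \<open>Fubini, through the description of \<open>lborel\<close> as the image of a product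
  measure over \<open>Basis\<close>; \<iota> reindexes \<open>Basis\<close> by the index type. It
  reduces the Gaussian integrals, and the weight in \<open>schwartz_integrable\<close>, to one
  dimension.\<close>

lemma
  fixes f :: "'n::finite \<Rightarrow> real \<Rightarrow> 'b::{real_normed_field, banach, second_countable_topology}"
  assumes int: "\<And>i. integrable lborel (f i)"
  shows integrable_lborel_vec_prod: "integrable lborel (\<lambda>x :: real ^ 'n. \<Prod>i\<in>UNIV. f i (x $ i))"
    and integral_lborel_vec_prod:
      "(\<integral>x. (\<Prod>i\<in>UNIV. f i (x $ i)) \<partial>(lborel :: (real ^ 'n) measure)) = (\<Prod>i\<in>UNIV. \<integral>x. f i x \<partial>lborel)"
proof -
  interpret product_sigma_finite "\<lambda>_ :: real ^ 'n. lborel :: real measure" ..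
  let ?B = "Basis :: (real ^ 'n) set"
  define \<iota> where "\<iota> = (\<lambda>i :: 'n. axis i (1::real))"
  have B: "?B = range \<iota>" by (auto simp: Basis_vec_def \<iota>_def)
  have inj: "inj \<iota>" by (auto simp: inj_on_def \<iota>_def axis_eq_axis)
  define F where "F b = f (inv \<iota> b)" for b
  have F: "F (\<iota> i) = f i" for i by (simp add: F_def inj)
  have intF: "integrable lborel (F b)" for b by (simp add: F_def int)
  have [measurable]: "f i \<in> borel_measurable borel" for i using int[of i] by auto
  define g where "g = (\<lambda>x :: real ^ 'n. \<Prod>i\<in>UNIV. f i (x $ i))"
  define \<Sigma> where "\<Sigma> = (\<lambda>h :: real ^ 'n \<Rightarrow> real. \<Sum>b\<in>?B. h b *\<^sub>R b)"
  have gm [measurable]: "g \<in> borel_measurable borel" unfolding g_def by measurable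
  have \<Sigma>m: "\<Sigma> \<in> (\<Pi>\<^sub>M b\<in>?B. lborel) \<rightarrow>\<^sub>M borel" unfolding \<Sigma>_def by measurable
  have coord: "\<Sigma> h $ i = h (\<iota> i)" for h i
  proof -
    have "\<Sigma> h \<bullet> \<iota> i = h (\<iota> i)"
      unfolding \<Sigma>_def by (rule inner_sum_left_Basis) (simp add: B)
    then show ?thesis by (simp add: \<iota>_def inner_axis)
  qed
  have gS: "g (\<Sigma> h) = (\<Prod>b\<in>?B. F b (h b))" for h
    unfolding g_def B coord by (simp add: prod.reindex inj F)
  have pi: "integrable (\<Pi>\<^sub>M b\<in>?B. lborel) (\<lambda>h. \<Prod>b\<in>?B. F b (h b))"
    by (rule product_integrable_prod) (auto simp: intF)
  have L: "lborel = distr (\<Pi>\<^sub>M b\<in>?B. lborel) borel \<Sigma>"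
    unfolding \<Sigma>_def by (rule lborel_eq)
  show "integrable lborel (\<lambda>x :: real ^ 'n. \<Prod>i\<in>UNIV. f i (x $ i))"
    unfolding g_def[symmetric] using pi
    by (subst L, subst integrable_distr_eq[OF \<Sigma>m gm]) (simp add: gS)
  have "(\<integral>x. g x \<partial>lborel) = (\<integral>h. g (\<Sigma> h) \<partial>(\<Pi>\<^sub>M b\<in>?B. lborel))"
    by (subst L, rule integral_distr[OF \<Sigma>m gm])
  also have "\<dots> = (\<Prod>b\<in>?B. \<integral>x. F b x \<partial>lborel)"
    unfolding gS by (rule product_integral_prod) (auto simp: intF)
  also have "\<dots> = (\<Prod>i\<in>UNIV. \<integral>x. f i x \<partial>lborel)"
    unfolding B by (simp add: prod.reindex inj F)
  finally show "(\<integral>x. (\<Prod>i\<in>UNIV. f i (x $ i)) \<partial>(lborel :: (real ^ 'n) measure)) = (\<Prod>i\<in>UNIV. \<integral>x. f i x \<partial>lborel)"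
    by (simp add: g_def)
qed

section \<open>Gaussians and the Fourier transform\<close>

text \<open>The parameter is an inverse variance: it adds under products and is inverted by the
  Fourier transform. The argument type is general because the function is used on numbers and on
  vectors.\<close>

definition gauss :: "real \<Rightarrow> 'a::real_normed_vector \<Rightarrow> real" where
  "gauss a x = exp (- (a * (norm x)\<^sup>2 / 2))"

lemma gauss_pos [simp]: "0 < gauss a x"
  by (simp add: gauss_def)

lemma gauss_nonneg [simp]: "0 \<le> gauss a x"
  by (simp add: gauss_def)

lemma gauss_measurable [measurable]:
  "gauss a \<in> borel_measurable (borel :: 'a::{real_normed_vector, second_countable_topology} measure)"
  unfolding gauss_def by measurable

lemma gauss_minus [simp]: "gauss a (- x) = gauss a x"
  by (simp add: gauss_def)

lemma gauss_mult: "gauss a x * gauss b x = gauss (a + b) x"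
  by (simp add: gauss_def algebra_simps add_divide_distrib flip: exp_add)

lemma gauss_le_one: "0 \<le> a \<Longrightarrow> gauss a x \<le> 1"
  by (simp add: gauss_def)

lemma gauss_antimono: "a \<le> b \<Longrightarrow> gauss b x \<le> gauss a x"
  by (simp add: gauss_def mult_right_mono)

lemma poly_gauss_bound:
  assumes "0 < a"
  shows "(1 + norm x) ^ k * gauss a x \<le> exp ((real k)\<^sup>2 / a) * gauss (a / 2) x"
proof -
  have "(1 + norm x) ^ k \<le> exp (norm x) ^ k"
    by (intro power_mono exp_ge_add_one_self) simp
  also have "\<dots> = exp (real k * norm x)" by (simp add: exp_of_nat_mult)
  finally have "(1 + norm x) ^ k * gauss a x \<le> exp (real k * norm x) * gauss a x"
    by (intro mult_right_mono) auto
  also have "\<dots> = exp (real k * norm x - a * (norm x)\<^sup>2 / 2)"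
    by (simp add: gauss_def flip: exp_add)
  also have "\<dots> \<le> exp ((real k)\<^sup>2 / a - a / 2 * (norm x)\<^sup>2 / 2)"
  proof -
    \<comment> \<open>Completing the square: half of the Gaussian exponent is given up to absorb the
      linear term.\<close>
    have "0 \<le> (a / 2 * norm x - real k)\<^sup>2 / a" using assms by simp
    also have "\<dots> = a * (norm x)\<^sup>2 / 4 - real k * norm x + (real k)\<^sup>2 / a"
      using assms by (simp add: power2_eq_square field_simps)
    finally show ?thesis by simp
  qed
  also have "\<dots> = exp ((real k)\<^sup>2 / a) * gauss (a / 2) x"
    by (simp add: gauss_def flip: exp_add)
  finally show ?thesis .
qed

text \<open>For a = 1 this is the characteristic function of the standard normal distribution; the
  substitution by \<open>sqrt a\<close> gives the general case.\<close>

lemma char_gauss_real: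
  fixes a t :: real
  assumes a: "0 < a"
  shows "integrable lborel (\<lambda>x. cis (- (x * t)) * complex_of_real (gauss a x))"
    and "(\<integral>x. cis (- (x * t)) * complex_of_real (gauss a x) \<partial>lborel) =
      complex_of_real (sqrt (2 * pi / a) * gauss (1 / a) t)"
proof -
  have unit: "integrable lborel (\<lambda>x. cis (- (x * t)) * complex_of_real (gauss 1 x)) \<and>
    (\<integral>x. cis (- (x * t)) * complex_of_real (gauss 1 x) \<partial>lborel) =
      complex_of_real (sqrt (2 * pi) * gauss 1 t)" for t :: real
  proof -
    have g: "complex_of_real (gauss 1 x) = complex_of_real (sqrt (2 * pi)) * complex_of_real (std_normal_density x)" for x :: real
      by (simp add: gauss_def std_normal_density_def)
    have int: "integrable lborel (\<lambda>x. cis (- (x * t)) * complex_of_real (std_normal_density x))"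
    proof (rule Bochner_Integration.integrable_bound)
      show "integrable lborel std_normal_density" by (rule integrable_normal_density) simp
      show "(\<lambda>x. cis (- (x * t)) * complex_of_real (std_normal_density x)) \<in> borel_measurable lborel"
        by (intro borel_measurable_times borel_measurable_continuous_onI continuous_intros
            measurable_compose[OF _ borel_measurable_of_real]) (auto simp: cis_conv_exp intro!: continuous_intros)
    qed (simp add: norm_mult)
    have "char std_normal_distribution (- t) = (\<integral>x. cis (- (x * t)) * complex_of_real (std_normal_density x) \<partial>lborel)"
      unfolding char_def
      by (subst integral_density)
        (auto simp: cis_conv_exp scaleR_conv_of_real mult_ac intro!: borel_measurable_continuous_onI continuous_intros)
    then have I: "(\<integral>x. cis (- (x * t)) * complex_of_real (std_normal_density x) \<partial>lborel) = complex_of_real (gauss 1 t)"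
      by (simp add: char_std_normal_distribution gauss_def)
    have eq: "cis (- (x * t)) * complex_of_real (gauss 1 x) =
        complex_of_real (sqrt (2 * pi)) * (cis (- (x * t)) * complex_of_real (std_normal_density x))" for x
      by (simp only: g mult.left_commute)
    show ?thesis
      unfolding eq integral_mult_right_zero I of_real_mult using int by simp
  qed
  have s: "sqrt a > 0" using a by simp
  have eq: "cis (- (x * t)) * complex_of_real (gauss a x) =
      cis (- ((0 + sqrt a * x) * (t / sqrt a))) * complex_of_real (gauss 1 (0 + sqrt a * x))" for x :: real
    using a s by (simp add: gauss_def power_mult_distrib)
  have "integrable lborel (\<lambda>x. cis (- ((0 + sqrt a * x) * (t / sqrt a))) * complex_of_real (gauss 1 (0 + sqrt a * x)))"
    using unit[of "t / sqrt a"] s by (intro lborel_integrable_real_affine) auto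
  then show "integrable lborel (\<lambda>x. cis (- (x * t)) * complex_of_real (gauss a x))" by (simp only: eq)
  have "complex_of_real (sqrt (2 * pi) * gauss 1 (t / sqrt a)) =
      \<bar>sqrt a\<bar> *\<^sub>R (\<integral>x. cis (- (x * t)) * complex_of_real (gauss a x) \<partial>lborel)"
    unfolding eq using s
    by (subst lborel_integral_real_affine[symmetric]) (use unit[of "t / sqrt a"] in auto)
  moreover have "gauss 1 (t / sqrt a) = gauss (1 / a) t"
    using a by (simp add: gauss_def power_divide)
  ultimately show "(\<integral>x. cis (- (x * t)) * complex_of_real (gauss a x) \<partial>lborel) =
      complex_of_real (sqrt (2 * pi / a) * gauss (1 / a) t)"
    using s by (simp add: scaleR_conv_of_real real_sqrt_divide field_simps)
qed

lemma cis_sum: "finite A \<Longrightarrow> cis (sum f A) = (\<Prod>i\<in>A. cis (f i))"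
  by (induction A rule: finite_induct) (simp_all add: cis_mult[symmetric])

text \<open>Both the character and the Gaussian factor over the coordinates.\<close>

lemma
  fixes \<xi> :: "real ^ 'n"
  assumes a: "0 < a"
  shows integrable_cis_gauss: "integrable lborel (\<lambda>x :: real ^ 'n. cis (- (x \<bullet> \<xi>)) * complex_of_real (gauss a x))"
    and fourier_gauss: "fourier (\<lambda>x. complex_of_real (gauss a x)) \<xi> =
      complex_of_real (sqrt (2 * pi / a) ^ CARD('n) * gauss (1 / a) \<xi>)"
proof -
  have norm2: "(norm x)\<^sup>2 = (\<Sum>i\<in>UNIV. (x $ i)\<^sup>2)" for x :: "real ^ 'n"
    unfolding power2_norm_eq_inner inner_vec_def by (simp add: power2_eq_square)
  have gp: "gauss b x = (\<Prod>i\<in>UNIV. gauss b (x $ i))" for b and x :: "real ^ 'n"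
    unfolding gauss_def norm2
    by (simp add: sum_distrib_left sum_divide_distrib exp_sum flip: sum_negf)
  have eq: "cis (- (x \<bullet> \<xi>)) * complex_of_real (gauss a x) =
      (\<Prod>i\<in>UNIV. cis (- (x $ i * \<xi> $ i)) * complex_of_real (gauss a (x $ i)))" for x :: "real ^ 'n"
    unfolding gp by (simp add: inner_vec_def prod.distrib cis_sum flip: sum_negf)
  note int = char_gauss_real(1)[OF a]
  show "integrable lborel (\<lambda>x :: real ^ 'n. cis (- (x \<bullet> \<xi>)) * complex_of_real (gauss a x))"
    unfolding eq by (intro integrable_lborel_vec_prod int)
  have "fourier (\<lambda>x. complex_of_real (gauss a x)) \<xi> =
      (\<Prod>i\<in>UNIV. complex_of_real (sqrt (2 * pi / a) * gauss (1 / a) (\<xi> $ i)))"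
    unfolding fourier_def eq by (subst integral_lborel_vec_prod[OF int]) (simp only: char_gauss_real(2)[OF a])
  then show "fourier (\<lambda>x. complex_of_real (gauss a x)) \<xi> =
      complex_of_real (sqrt (2 * pi / a) ^ CARD('n) * gauss (1 / a) \<xi>)"
    unfolding gp by (simp add: prod.distrib)
qed

lemma integrable_gauss:
  assumes "0 < a"
  shows "integrable lborel (gauss a :: real ^ 'n \<Rightarrow> real)"
  using integrable_Re[OF integrable_cis_gauss[OF assms, of "0 :: real ^ 'n"]] by simp

lemma integral_gauss:
  assumes "0 < a"
  shows "(\<integral>x. gauss a x \<partial>(lborel :: (real ^ 'n) measure)) = sqrt (2 * pi / a) ^ CARD('n)"
  using fourier_gauss[OF assms, of "0 :: real ^ 'n"] unfolding fourier_def
  by (simp add: gauss_def flip: of_real_power)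

lemma integrable_poly_gauss:
  fixes f :: "real ^ 'n \<Rightarrow> 'b::{banach, second_countable_topology}"
  assumes "0 < a" "f \<in> borel_measurable borel" "\<And>x. norm (f x) \<le> C * ((1 + norm x) ^ k * gauss a x)"
  shows "integrable lborel f"
proof (rule Bochner_Integration.integrable_bound)
  show "integrable lborel (\<lambda>x :: real ^ 'n. \<bar>C\<bar> * (exp ((real k)\<^sup>2 / a) * gauss (a / 2) x))"
    using assms(1) by (intro integrable_mult_right integrable_gauss) auto
  have "norm (f x) \<le> norm (\<bar>C\<bar> * (exp ((real k)\<^sup>2 / a) * gauss (a / 2) x))" for x
  proof -
    have "norm (f x) \<le> \<bar>C\<bar> * ((1 + norm x) ^ k * gauss a x)"
      using assms(3)[of x] by (rule order_trans) (intro mult_right_mono, auto)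
    also have "\<dots> \<le> \<bar>C\<bar> * (exp ((real k)\<^sup>2 / a) * gauss (a / 2) x)"
      by (intro mult_left_mono poly_gauss_bound assms) auto
    finally show ?thesis by (simp add: abs_mult)
  qed
  then show "AE x in lborel. norm (f x) \<le> norm (\<bar>C\<bar> * (exp ((real k)\<^sup>2 / a) * gauss (a / 2) x))" by simp
qed (use assms(2) in simp)

lemma integrable_pair_mult:
  fixes f :: "'a::euclidean_space \<Rightarrow> complex" and h :: "'b::euclidean_space \<Rightarrow> complex"
  assumes f: "integrable lborel f" and h: "integrable lborel h"
    and k: "case_prod k \<in> borel_measurable (borel \<Otimes>\<^sub>M borel)" "\<And>x y. cmod (k x y) \<le> 1"
  shows "integrable (lborel \<Otimes>\<^sub>M lborel) (\<lambda>(x, y). k x y * f x * h y)"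
proof (rule Bochner_Integration.integrable_bound)
  have [measurable]: "f \<in> borel_measurable borel" "h \<in> borel_measurable borel" using f h by auto
  note k(1)[measurable]
  show "integrable (lborel \<Otimes>\<^sub>M lborel) (\<lambda>(x, y). f x * h y)"
  proof (rule lborel_pair.Fubini_integrable)
    show "integrable lborel (\<lambda>x. \<integral>y. norm (case (x, y) of (x, y) \<Rightarrow> f x * h y) \<partial>lborel)"
      using f by (simp add: norm_mult)
  qed (use h in auto)
  show "(\<lambda>(x, y). k x y * f x * h y) \<in> borel_measurable (lborel \<Otimes>\<^sub>M lborel)" by measurable
  have "cmod (k x y * f x * h y) \<le> cmod (f x * h y)" for x y
    using mult_right_mono[OF k(2)[of x y], of "cmod (f x * h y)"] by (simp add: norm_mult mult.assoc)
  then show "AE x in lborel \<Otimes>\<^sub>M lborel. norm (case x of (x, y) \<Rightarrow> k x y * f x * h y) \<le> norm (case x of (x, y) \<Rightarrow> f x * h y)"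
    by (auto simp: split_beta)
qed

text \<open>Fubini for a bounded kernel. With a character as \<open>k\<close> it moves the Fourier
  transform from one factor of a pairing to the other, with a Gaussian as \<open>k\<close> it moves
  a convolution.\<close>

lemma kernel_swap:
  fixes f :: "'a::euclidean_space \<Rightarrow> complex" and h :: "'b::euclidean_space \<Rightarrow> complex"
  assumes f: "integrable lborel f" and h: "integrable lborel h"
    and k: "case_prod k \<in> borel_measurable (borel \<Otimes>\<^sub>M borel)" "\<And>x y. cmod (k x y) \<le> 1"
  shows "(\<integral>y. (\<integral>x. k x y * f x \<partial>lborel) * h y \<partial>lborel) = (\<integral>x. f x * (\<integral>y. k x y * h y \<partial>lborel) \<partial>lborel)"
proof -
  have "(\<integral>y. \<integral>x. k x y * f x * h y \<partial>lborel \<partial>lborel) = (\<integral>x. \<integral>y. k x y * f x * h y \<partial>lborel \<partial>lborel)"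
    by (rule lborel_pair.Fubini_integral) (rule integrable_pair_mult[OF assms])
  moreover have "(\<integral>y. k x y * f x * h y \<partial>lborel) = f x * (\<integral>y. k x y * h y \<partial>lborel)" for x
    by (subst integral_mult_right_zero[symmetric]) (simp add: mult_ac)
  ultimately show ?thesis by simp
qed

lemma cis_measurable [measurable]: "cis \<in> borel_measurable borel"
  by (intro borel_measurable_continuous_onI) (auto simp: cis_conv_exp intro!: continuous_intros)

lemma fourier_measurable [measurable]:
  fixes f :: "real ^ 'n \<Rightarrow> complex"
  assumes [measurable]: "f \<in> borel_measurable borel"
  shows "fourier f \<in> borel_measurable borel"
  unfolding fourier_def by (rule lborel.borel_measurable_lebesgue_integral) measurable

lemma cmod_fourier_le: "cmod (fourier f \<xi>) \<le> (\<integral>x. cmod (f x) \<partial>lborel)"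
  unfolding fourier_def using integral_norm_bound[of lborel "\<lambda>x. cis (- (x \<bullet> \<xi>)) * f x"]
  by (simp add: norm_mult)

lemma inv_fourier_eq: "inv_fourier f x = fourier f (- x) / (2 * pi) ^ CARD('n)" for x :: "real ^ 'n"
  by (simp add: inv_fourier_def fourier_def inner_commute)

lemma inv_fourier_measurable [measurable]:
  fixes f :: "real ^ 'n \<Rightarrow> complex"
  assumes [measurable]: "f \<in> borel_measurable borel"
  shows "inv_fourier f \<in> borel_measurable borel"
  unfolding inv_fourier_eq by measurable

lemma integral_fourier_mult:
  fixes f g :: "real ^ 'n \<Rightarrow> complex"
  assumes "integrable lborel f" "integrable lborel g"
  shows "(\<integral>x. fourier f x * g x \<partial>lborel) = (\<integral>x. f x * fourier g x \<partial>lborel)"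
  using kernel_swap[OF assms, of "\<lambda>x y. cis (- (x \<bullet> y))"]
  by (simp add: fourier_def inner_commute)

lemma integral_inv_fourier_mult:
  fixes f g :: "real ^ 'n \<Rightarrow> complex"
  assumes "integrable lborel f" "integrable lborel g"
  shows "(\<integral>x. inv_fourier f x * g x \<partial>lborel) = (\<integral>x. f x * inv_fourier g x \<partial>lborel)"
  using kernel_swap[OF assms, of "\<lambda>x y. cis (x \<bullet> y)"]
  by (simp add: inv_fourier_def inner_commute)

section \<open>Plancherel bound and injectivity of the Fourier transform\<close>

lemma ennreal_norm_integral_le:
  fixes f :: "'a \<Rightarrow> 'b::{banach, second_countable_topology}"
  shows "ennreal (norm (\<integral>x. f x \<partial>M)) \<le> (\<integral>\<^sup>+x. ennreal (norm (f x)) \<partial>M)"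
  by (cases "integrable M f") (simp_all add: integral_norm_bound_ennreal not_integrable_integral_eq)

text \<open>Against a Gaussian weight the left-hand side is the integral of \<open>f x * cnj (f y)\<close> against a
  nonnegative convolution kernel of mass \<open>(2 * pi) ^ CARD('n)\<close>, so \<open>2 * a * b \<le> a\<^sup>2 + b\<^sup>2\<close> suffices.\<close>

lemma plancherel_gauss:
  fixes f :: "real ^ 'n \<Rightarrow> complex"
  assumes f: "integrable lborel f" and sq: "square_integrable f" and d: "0 < \<delta>"
  shows "(\<integral>\<xi>. (cmod (fourier f \<xi>))\<^sup>2 * gauss \<delta> \<xi> \<partial>lborel) \<le> (2 * pi) ^ CARD('n) * (\<integral>x. (cmod (f x))\<^sup>2 \<partial>lborel)"
    and "integrable lborel (\<lambda>\<xi>. (cmod (fourier f \<xi>))\<^sup>2 * gauss \<delta> \<xi>)"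
proof -
  have [measurable]: "f \<in> borel_measurable borel" using f by auto
  have [measurable]: "cnj \<in> borel_measurable borel"
    by (intro borel_measurable_continuous_onI continuous_intros)
  define c where "c = sqrt (2 * pi / \<delta>) ^ CARD('n)"
  have c: "0 \<le> c" using d by (simp add: c_def)
  let ?g = "\<lambda>z :: real ^ 'n. c * gauss (1 / \<delta>) z"
  define h where "h \<xi> = cnj (fourier f \<xi>) * complex_of_real (gauss \<delta> \<xi>)" for \<xi>
  define L where "L = (\<integral>x. cmod (f x) \<partial>lborel)"
  have L: "cmod (fourier f \<xi>) \<le> L" for \<xi> unfolding L_def by (rule cmod_fourier_le)
  have L0: "0 \<le> L" by (simp add: L_def)
  have hint: "integrable lborel h"
  proof (rule Bochner_Integration.integrable_bound)
    show "integrable lborel (\<lambda>\<xi> :: real ^ 'n. L * gauss \<delta> \<xi>)" by (intro integrable_mult_right integrable_gauss d)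
    show "h \<in> borel_measurable lborel" unfolding h_def by measurable
    show "AE \<xi> in lborel. norm (h \<xi>) \<le> norm (L * gauss \<delta> \<xi>)"
      using L L0 by (auto simp: h_def norm_mult intro!: mult_right_mono)
  qed
  show int: "integrable lborel (\<lambda>\<xi>. (cmod (fourier f \<xi>))\<^sup>2 * gauss \<delta> \<xi>)"
  proof (rule Bochner_Integration.integrable_bound)
    show "integrable lborel (\<lambda>\<xi> :: real ^ 'n. L\<^sup>2 * gauss \<delta> \<xi>)" by (intro integrable_mult_right integrable_gauss d)
    show "AE \<xi> in lborel. norm ((cmod (fourier f \<xi>))\<^sup>2 * gauss \<delta> \<xi>) \<le> norm (L\<^sup>2 * gauss \<delta> \<xi>)"
      using L L0 by (auto simp: norm_mult intro!: mult_right_mono power_mono)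
  qed measurable
  \<comment> \<open>Integrating out the frequency turns the Gaussian weight into a Gaussian kernel
    in x - y.\<close>
  have inner: "(\<integral>\<xi>. cis (- (x \<bullet> \<xi>)) * h \<xi> \<partial>lborel) = (\<integral>y. cnj (f y) * complex_of_real (?g (x - y)) \<partial>lborel)" for x
  proof -
    have cf: "cnj (fourier f \<xi>) = (\<integral>y. cis (y \<bullet> \<xi>) * cnj (f y) \<partial>lborel)" for \<xi>
      unfolding fourier_def by (subst Bochner_Integration.integral_cnj[symmetric]) (simp add: cis_cnj)
    have "(\<integral>\<xi>. cis (- (x \<bullet> \<xi>)) * h \<xi> \<partial>lborel) =
      (\<integral>\<xi>. (\<integral>y. cis (y \<bullet> \<xi>) * cnj (f y) \<partial>lborel) * (cis (- (\<xi> \<bullet> x)) * complex_of_real (gauss \<delta> \<xi>)) \<partial>lborel)"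
      by (simp add: h_def cf inner_commute mult_ac)
    also have "\<dots> = (\<integral>y. cnj (f y) * (\<integral>\<xi>. cis (y \<bullet> \<xi>) * (cis (- (\<xi> \<bullet> x)) * complex_of_real (gauss \<delta> \<xi>)) \<partial>lborel) \<partial>lborel)"
      by (rule kernel_swap[OF _ integrable_cis_gauss[OF d]]) (use f in auto)
    finally have 1: "(\<integral>\<xi>. cis (- (x \<bullet> \<xi>)) * h \<xi> \<partial>lborel) = \<dots>" .
    have 2: "(\<integral>\<xi>. cis (y \<bullet> \<xi>) * (cis (- (\<xi> \<bullet> x)) * complex_of_real (gauss \<delta> \<xi>)) \<partial>lborel) =
        complex_of_real (?g (x - y))" for y
    proof -
      have eq: "cis (y \<bullet> \<xi>) * (cis (- (\<xi> \<bullet> x)) * complex_of_real (gauss \<delta> \<xi>)) =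
          cis (- (\<xi> \<bullet> (x - y))) * complex_of_real (gauss \<delta> \<xi>)" for \<xi>
        by (simp add: cis_mult inner_diff_right inner_commute flip: mult.assoc)
      show ?thesis using fourier_gauss[OF d, of "x - y"] unfolding eq fourier_def by (simp add: c_def)
    qed
    show ?thesis by (simp only: 1 2)
  qed
  have Gshift: "(\<integral>\<^sup>+x. ennreal (?g (x - y)) \<partial>lborel) = ennreal ((2 * pi) ^ CARD('n))" for y
  proof -
    have "(\<integral>\<^sup>+x. ennreal (?g (x - y)) \<partial>lborel) = (\<integral>\<^sup>+x. ennreal (?g (- y + x)) \<partial>lborel)" by simp
    also have "\<dots> = (\<integral>\<^sup>+x. ennreal (?g x) \<partial>lborel)" by (rule nn_integral_lborel_translate) measurable
    also have "\<dots> = ennreal (\<integral>x. ?g x \<partial>lborel)"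
      using c d by (intro nn_integral_eq_integral integrable_mult_right integrable_gauss) auto
    also have "(\<integral>x. ?g x \<partial>lborel) = (sqrt (2 * pi / \<delta>) * sqrt (2 * pi * \<delta>)) ^ CARD('n)"
      using d by (simp add: integral_gauss c_def power_mult_distrib)
    \<comment> \<open>The mass of the kernel does not depend on \<delta>, so the bound survives the
      limit in which \<delta> tends to 0.\<close>
    also have "sqrt (2 * pi / \<delta>) * sqrt (2 * pi * \<delta>) = sqrt ((2 * pi)\<^sup>2)"
      using d by (simp add: power2_eq_square flip: real_sqrt_mult)
    also have "\<dots> = 2 * pi" by (simp only: real_sqrt_abs) simp
    finally show ?thesis .
  qed
  have Gshift': "(\<integral>\<^sup>+y. ennreal (?g (x - y)) \<partial>lborel) = ennreal ((2 * pi) ^ CARD('n))" for x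
    using Gshift[of x] gauss_minus[of "1 / \<delta>" "x - _"] by simp
  have "complex_of_real (\<integral>\<xi>. (cmod (fourier f \<xi>))\<^sup>2 * gauss \<delta> \<xi> \<partial>lborel) = (\<integral>\<xi>. fourier f \<xi> * h \<xi> \<partial>lborel)"
    unfolding h_def
    by (subst integral_complex_of_real[symmetric]) (simp only: of_real_mult complex_norm_square mult.assoc)
  also have "\<dots> = (\<integral>x. f x * (\<integral>\<xi>. cis (- (x \<bullet> \<xi>)) * h \<xi> \<partial>lborel) \<partial>lborel)"
    unfolding fourier_def by (rule kernel_swap[OF f hint]) auto
  also have "\<dots> = (\<integral>x. f x * (\<integral>y. cnj (f y) * complex_of_real (?g (x - y)) \<partial>lborel) \<partial>lborel)"
    by (simp only: inner)
  finally have J: "complex_of_real (\<integral>\<xi>. (cmod (fourier f \<xi>))\<^sup>2 * gauss \<delta> \<xi> \<partial>lborel) =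
      (\<integral>x. f x * (\<integral>y. cnj (f y) * complex_of_real (?g (x - y)) \<partial>lborel) \<partial>lborel)" .
  have "ennreal (\<integral>\<xi>. (cmod (fourier f \<xi>))\<^sup>2 * gauss \<delta> \<xi> \<partial>lborel) =
      ennreal (cmod (\<integral>x. f x * (\<integral>y. cnj (f y) * complex_of_real (?g (x - y)) \<partial>lborel) \<partial>lborel))"
    unfolding J[symmetric] norm_of_real by (subst abs_of_nonneg) (auto intro!: integral_nonneg)
  also have "\<dots> \<le> (\<integral>\<^sup>+x. ennreal (cmod (f x * (\<integral>y. cnj (f y) * complex_of_real (?g (x - y)) \<partial>lborel))) \<partial>lborel)"
    by (rule ennreal_norm_integral_le)
  also have "\<dots> \<le> (\<integral>\<^sup>+x. \<integral>\<^sup>+y. ennreal (1/2 * (cmod (f x))\<^sup>2) * ennreal (?g (x - y)) + ennreal (1/2 * (cmod (f y))\<^sup>2) * ennreal (?g (x - y)) \<partial>lborel \<partial>lborel)"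
  proof (rule nn_integral_mono)
    fix x
    have "ennreal (cmod (f x * (\<integral>y. cnj (f y) * complex_of_real (?g (x - y)) \<partial>lborel))) \<le>
        ennreal (cmod (f x)) * (\<integral>\<^sup>+y. ennreal (cmod (cnj (f y) * complex_of_real (?g (x - y)))) \<partial>lborel)"
      unfolding norm_mult[of "f x"] ennreal_mult'[OF norm_ge_zero]
      by (intro mult_left_mono ennreal_norm_integral_le) simp
    also have "\<dots> = (\<integral>\<^sup>+y. ennreal (cmod (f x)) * ennreal (cmod (cnj (f y) * complex_of_real (?g (x - y)))) \<partial>lborel)"
      by (rule nn_integral_cmult[symmetric]) measurable
    also have "\<dots> \<le> (\<integral>\<^sup>+y. ennreal (1/2 * (cmod (f x))\<^sup>2) * ennreal (?g (x - y)) + ennreal (1/2 * (cmod (f y))\<^sup>2) * ennreal (?g (x - y)) \<partial>lborel)"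
    proof (rule nn_integral_mono)
      fix y
      have "cmod (f x) * (cmod (f y) * ?g (x - y)) \<le> (1/2 * (cmod (f x))\<^sup>2 + 1/2 * (cmod (f y))\<^sup>2) * ?g (x - y)"
        using mult_right_mono[OF sum_squares_bound[of "cmod (f x)" "cmod (f y)"], of "?g (x - y) / 2"] c
        by (simp add: algebra_simps)
      then show "ennreal (cmod (f x)) * ennreal (cmod (cnj (f y) * complex_of_real (?g (x - y)))) \<le>
          ennreal (1/2 * (cmod (f x))\<^sup>2) * ennreal (?g (x - y)) + ennreal (1/2 * (cmod (f y))\<^sup>2) * ennreal (?g (x - y))"
        using c by (simp add: norm_mult distrib_right ennreal_leI flip: ennreal_mult ennreal_plus)
    qed
    finally show "ennreal (cmod (f x * (\<integral>y. cnj (f y) * complex_of_real (?g (x - y)) \<partial>lborel))) \<le> \<dots>" .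
  qed
  also have "\<dots> = (\<integral>\<^sup>+x. \<integral>\<^sup>+y. ennreal (1/2 * (cmod (f x))\<^sup>2) * ennreal (?g (x - y)) \<partial>lborel \<partial>lborel) +
     (\<integral>\<^sup>+x. \<integral>\<^sup>+y. ennreal (1/2 * (cmod (f y))\<^sup>2) * ennreal (?g (x - y)) \<partial>lborel \<partial>lborel)"
    by (subst nn_integral_add[symmetric], measurable) (subst nn_integral_add, measurable)
  also have "(\<integral>\<^sup>+x. \<integral>\<^sup>+y. ennreal (1/2 * (cmod (f y))\<^sup>2) * ennreal (?g (x - y)) \<partial>lborel \<partial>lborel) =
      (\<integral>\<^sup>+y. \<integral>\<^sup>+x. ennreal (1/2 * (cmod (f y))\<^sup>2) * ennreal (?g (x - y)) \<partial>lborel \<partial>lborel)"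
    by (rule lborel_pair.Fubini') measurable
  also have "\<dots> = (\<integral>\<^sup>+y. ennreal (1/2 * (cmod (f y))\<^sup>2) * ennreal ((2 * pi) ^ CARD('n)) \<partial>lborel)"
    by (simp add: nn_integral_cmult Gshift)
  also have "(\<integral>\<^sup>+x. \<integral>\<^sup>+y. ennreal (1/2 * (cmod (f x))\<^sup>2) * ennreal (?g (x - y)) \<partial>lborel \<partial>lborel) =
     (\<integral>\<^sup>+y. ennreal (1/2 * (cmod (f y))\<^sup>2) * ennreal ((2 * pi) ^ CARD('n)) \<partial>lborel)"
    by (simp add: nn_integral_cmult Gshift')
  also have "(\<integral>\<^sup>+y. ennreal (1/2 * (cmod (f y))\<^sup>2) * ennreal ((2 * pi) ^ CARD('n)) \<partial>lborel) +
     (\<integral>\<^sup>+y. ennreal (1/2 * (cmod (f y))\<^sup>2) * ennreal ((2 * pi) ^ CARD('n)) \<partial>lborel) =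
     ennreal ((2 * pi) ^ CARD('n) * (\<integral>x. (cmod (f x))\<^sup>2 \<partial>lborel))"
  proof -
    have "(\<integral>\<^sup>+y. ennreal (1/2 * (cmod (f y))\<^sup>2) * ennreal ((2 * pi) ^ CARD('n)) \<partial>lborel) =
        (\<integral>\<^sup>+y. ennreal ((2 * pi) ^ CARD('n) / 2 * (cmod (f y))\<^sup>2) \<partial>lborel)"
      by (simp add: mult.commute flip: ennreal_mult)
    also have "\<dots> = ennreal ((2 * pi) ^ CARD('n) / 2 * (\<integral>x. (cmod (f x))\<^sup>2 \<partial>lborel))"
      using sq by (subst nn_integral_eq_integral) (auto simp: square_integrable_def)
    finally show ?thesis by (simp flip: ennreal_plus)
  qed
  finally show "(\<integral>\<xi>. (cmod (fourier f \<xi>))\<^sup>2 * gauss \<delta> \<xi> \<partial>lborel) \<le> (2 * pi) ^ CARD('n) * (\<integral>x. (cmod (f x))\<^sup>2 \<partial>lborel)"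
    by (subst (asm) ennreal_le_iff) auto
qed

text \<open>Monotone convergence as the weights in \<open>plancherel_gauss\<close> increase to 1.
  Finiteness of the limit is also what makes the transform square integrable.\<close>

lemma plancherel_bound:
  fixes f :: "real ^ 'n \<Rightarrow> complex"
  assumes f: "integrable lborel f" and sq: "square_integrable f"
  shows "square_integrable (fourier f)"
    and "(\<integral>\<xi>. (cmod (fourier f \<xi>))\<^sup>2 \<partial>lborel) \<le> (2 * pi) ^ CARD('n) * (\<integral>x. (cmod (f x))\<^sup>2 \<partial>lborel)"
proof -
  have [measurable]: "f \<in> borel_measurable borel" using f by auto
  let ?C = "(2 * pi) ^ CARD('n) * (\<integral>x. (cmod (f x))\<^sup>2 \<partial>lborel)"
  define p where "p k \<xi> = (cmod (fourier f \<xi>))\<^sup>2 * gauss (1 / real (Suc k)) \<xi>" for k and \<xi> :: "real ^ 'n"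
  have [measurable]: "p k \<in> borel_measurable borel" for k unfolding p_def by measurable
  have inc: "incseq (\<lambda>k (\<xi> :: real ^ 'n). ennreal (p k \<xi>))"
    unfolding incseq_Suc_iff le_fun_def p_def
    by (intro allI ennreal_leI mult_left_mono gauss_antimono) (auto simp: field_simps)
  have "(\<integral>\<^sup>+\<xi>. ennreal ((cmod (fourier f \<xi>))\<^sup>2) \<partial>lborel) \<le> (\<integral>\<^sup>+\<xi>. (SUP k. ennreal (p k \<xi>)) \<partial>lborel)"
  proof (rule nn_integral_mono)
    fix \<xi> :: "real ^ 'n"
    have "(\<lambda>k. exp (- (1 / real (Suc k) * (norm \<xi>)\<^sup>2 / 2))) \<longlonglongrightarrow> exp (- (0 * (norm \<xi>)\<^sup>2 / 2))"
      by (intro tendsto_intros LIMSEQ_Suc[OF lim_1_over_n]) auto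
    then have "(\<lambda>k. gauss (1 / real (Suc k)) \<xi>) \<longlonglongrightarrow> 1" by (simp add: gauss_def)
    then have "(\<lambda>k. p k \<xi>) \<longlonglongrightarrow> (cmod (fourier f \<xi>))\<^sup>2 * 1"
      unfolding p_def by (intro tendsto_intros)
    then have "(\<lambda>k. ennreal (p k \<xi>)) \<longlonglongrightarrow> ennreal ((cmod (fourier f \<xi>))\<^sup>2)" by (intro tendsto_ennrealI) simp
    then show "ennreal ((cmod (fourier f \<xi>))\<^sup>2) \<le> (SUP k. ennreal (p k \<xi>))"
      by (rule LIMSEQ_le_const2) (intro exI allI impI SUP_upper UNIV_I)
  qed
  also have "\<dots> = (SUP k. \<integral>\<^sup>+\<xi>. ennreal (p k \<xi>) \<partial>lborel)"
    by (intro nn_integral_monotone_convergence_SUP inc) auto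
  also have "\<dots> \<le> ennreal ?C"
  proof (rule SUP_least)
    fix k
    have k: "0 < 1 / real (Suc k)" by simp
    have "(\<integral>\<^sup>+\<xi>. ennreal (p k \<xi>) \<partial>lborel) = ennreal (\<integral>\<xi>. p k \<xi> \<partial>lborel)"
      using plancherel_gauss(2)[OF f sq k] unfolding p_def by (intro nn_integral_eq_integral) auto
    also have "\<dots> \<le> ennreal ?C"
      using plancherel_gauss(1)[OF f sq k] unfolding p_def by (intro ennreal_leI)
    finally show "(\<integral>\<^sup>+\<xi>. ennreal (p k \<xi>) \<partial>lborel) \<le> ennreal ?C" .
  qed
  finally have *: "(\<integral>\<^sup>+\<xi>. ennreal ((cmod (fourier f \<xi>))\<^sup>2) \<partial>lborel) \<le> ennreal ?C" .
  have int: "integrable lborel (\<lambda>\<xi>. (cmod (fourier f \<xi>))\<^sup>2)"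
    by (rule integrableI_bounded) (use * in \<open>auto intro: le_less_trans\<close>)
  then show "square_integrable (fourier f)" by (simp add: square_integrable_def)
  show "(\<integral>\<xi>. (cmod (fourier f \<xi>))\<^sup>2 \<partial>lborel) \<le> ?C"
    using * nn_integral_eq_integral[OF int] by simp
qed


section \<open>Injectivity of the Fourier transform on integrable functions\<close>

text \<open>The Borel sets over which the integral vanishes form a Dynkin system, and the open boxes
  are an intersection-stable generator.\<close>

lemma integrable_boxes_zero_imp_AE_zero:
  fixes F :: "'a::euclidean_space \<Rightarrow> complex"
  assumes F: "integrable lborel F" and box: "\<And>a b. (LINT x:box a b|lborel. F x) = 0"
  shows "AE x in lborel. F x = 0"
proof (rule sigma_finite_measure.density_zero[OF sigma_finite_lborel F])
  fix A :: "'a set" assume "A \<in> sets lborel"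
  then have A: "A \<in> sigma_sets UNIV (range (\<lambda>(a, b). box a b))" by (simp add: borel_eq_box)
  have meas: "A \<in> sets borel" if "A \<in> sigma_sets UNIV (range (\<lambda>(a, b). box a b))" for A :: "'a set"
    using that by (simp add: borel_eq_box)
  have si: "set_integrable lborel A F" if "A \<in> sets borel" for A
    using F that by (simp add: set_integrable_def integrable_mult_indicator)
  \<comment> \<open>Complements require the integral over the whole space to vanish; it is the limit
    over growing boxes.\<close>
  have total: "(\<integral>x. F x \<partial>lborel) = 0"
  proof -
    let ?A = "\<lambda>n::nat. box (- (real n *\<^sub>R One)) (real n *\<^sub>R One) :: 'a set"
    have "(\<lambda>n. LINT x:?A n|lborel. F x) \<longlonglongrightarrow> (LINT x:(\<Union>n. ?A n)|lborel. F x)"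
    proof (rule set_integral_cont_up)
      show "incseq ?A" by (intro incseq_SucI subset_box_imp) simp
    qed (auto intro: si)
    then show ?thesis using box by (simp add: UN_box_eq_UNIV LIMSEQ_const_iff set_lebesgue_integral_def)
  qed
  have "Int_stable (range (\<lambda>(a, b). box a b :: 'a set))"
    by (auto simp: Int_stable_def box_Int_box)
  moreover have "range (\<lambda>(a, b). box a b :: 'a set) \<subseteq> Pow UNIV" by simp
  ultimately show "(LINT x:A|lborel. F x) = 0"
    using A
  proof (induction rule: sigma_sets_induct_disjoint)
    case (basic A)
    then show ?case using box by auto
  next
    case (compl A)
    have "(LINT x:UNIV - A|lborel. F x) = (\<integral>x. F x \<partial>lborel) - (LINT x:A|lborel. F x)"
    proof -
      have "indicat_real (UNIV - A) x *\<^sub>R F x = F x - indicat_real A x *\<^sub>R F x" for x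
        by (simp add: indicator_def)
      then show ?thesis
        using F si[OF meas[OF compl(1)]]
        by (simp add: set_lebesgue_integral_def set_integrable_def)
    qed
    then show ?case using total compl by simp
  next
    case (union A)
    then have "A i \<in> sets borel" for i using meas by auto
    moreover from this have "(\<Union>i. A i) \<in> sets borel" by auto
    ultimately have "(LINT x:(\<Union>i. A i)|lborel. F x) = (\<Sum>i. LINT x:(A i)|lborel. F x)"
      using union(1) by (intro lebesgue_integral_countable_add si) (auto simp: disjoint_family_on_def)
    then show ?case using union by simp
  qed (auto simp: set_lebesgue_integral_def)
qed

lemma AE_boundary_box: "AE x in (lborel :: 'a::euclidean_space measure). x \<notin> cbox a b - box a b"
proof (rule AE_not_in, rule null_setsI)
  have "emeasure lborel (cbox a b - box a b) = emeasure lborel (cbox a b) - emeasure lborel (box a b)"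
    using emeasure_bounded_finite[OF bounded_box, of a b]
    by (intro emeasure_Diff box_subset_cbox) auto
  also have "\<dots> = 0" by (simp add: emeasure_lborel_cbox_eq emeasure_lborel_box_eq)
  finally show "emeasure lborel (cbox a b - box a b) = 0" .
qed auto

text \<open>Gaussian summation of the inversion formula: a vanishing transform makes every Gaussian
  average of \<open>F\<close> vanish, hence also the integral of \<open>F\<close> against box
  indicators smoothed at scale e. As e tends to 0 the smoothed indicators converge off the boundary
  of the box, a null set.\<close>

lemma AE_zero_if_fourier_zero:
  fixes F :: "real ^ 'n \<Rightarrow> complex"
  assumes F: "integrable lborel F" and zero: "\<And>\<xi>. fourier F \<xi> = 0"
  shows "AE x in lborel. F x = 0"
proof (rule integrable_boxes_zero_imp_AE_zero[OF F])
  fix a b :: "real ^ 'n"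
  have [measurable]: "F \<in> borel_measurable borel" using F by auto
  define U where "U = box a b"
  have Um [measurable]: "U \<in> sets borel" by (simp add: U_def)
  define iU where "iU = (indicat_real U)"
  have [measurable]: "iU \<in> borel_measurable borel" unfolding iU_def by (intro borel_measurable_indicator) simp
  have intU: "integrable lborel (\<lambda>y. complex_of_real (iU y))"
    unfolding iU_def U_def using emeasure_bounded_finite[OF bounded_box, of a b]
    by (intro integrable_of_real integrable_real_indicator) auto
  have conv: "(\<integral>x. F x * complex_of_real (gauss (1 / \<delta>) (x - y)) \<partial>lborel) = 0" if d: "0 < \<delta>" for \<delta> y
  proof -
    define h where "h \<xi> = cis (- (\<xi> \<bullet> (- y))) * complex_of_real (gauss \<delta> \<xi>)" for \<xi> :: "real ^ 'n"
    have h: "integrable lborel h" unfolding h_def by (rule integrable_cis_gauss[OF d])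
    have "(\<integral>\<xi>. fourier F \<xi> * h \<xi> \<partial>lborel) = (\<integral>x. F x * (\<integral>\<xi>. cis (- (x \<bullet> \<xi>)) * h \<xi> \<partial>lborel) \<partial>lborel)"
      unfolding fourier_def by (rule kernel_swap[OF F h]) auto
    moreover have "(\<integral>\<xi>. cis (- (x \<bullet> \<xi>)) * h \<xi> \<partial>lborel) =
        complex_of_real (sqrt (2 * pi / \<delta>) ^ CARD('n)) * complex_of_real (gauss (1 / \<delta>) (x - y))" for x
    proof -
      have eq: "cis (- (x \<bullet> \<xi>)) * h \<xi> = cis (- (\<xi> \<bullet> (x - y))) * complex_of_real (gauss \<delta> \<xi>)" for \<xi>
        by (simp add: h_def cis_mult inner_diff_right inner_commute flip: mult.assoc)
      show ?thesis using fourier_gauss[OF d, of "x - y"] unfolding eq fourier_def by simp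
    qed
    ultimately have "(\<integral>x. F x * (complex_of_real (sqrt (2 * pi / \<delta>) ^ CARD('n)) * complex_of_real (gauss (1 / \<delta>) (x - y))) \<partial>lborel) = 0"
      by (simp only: zero) simp
    then have "complex_of_real (sqrt (2 * pi / \<delta>) ^ CARD('n)) * (\<integral>x. F x * complex_of_real (gauss (1 / \<delta>) (x - y)) \<partial>lborel) = 0"
      by (subst integral_mult_right_zero[symmetric]) (simp add: mult_ac)
    then show ?thesis using d by simp
  qed
  \<comment> \<open>The box indicator smoothed at scale e, up to the mass \<open>G\<close>. The
    Gaussian is kept fixed and the scale is put into the indicator, so that one majorant serves
    every e.\<close>
  define H where "H e x = (\<integral>z. iU (x + e *\<^sub>R z) * gauss 1 z \<partial>lborel)" for e and x :: "real ^ 'n"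
  have Hint: "integrable lborel (\<lambda>z. iU (x + e *\<^sub>R z) * gauss 1 z)" for e and x :: "real ^ 'n"
    by (rule Bochner_Integration.integrable_bound[OF integrable_gauss[of 1]])
      (auto simp: iU_def indicator_def)
  have [measurable]: "H e \<in> borel_measurable borel" for e
    unfolding H_def by (rule lborel.borel_measurable_lebesgue_integral) measurable
  define G where "G = (\<integral>z. gauss 1 z \<partial>(lborel :: (real ^ 'n) measure))"
  have G: "G > 0" by (simp add: G_def integral_gauss)
  have Hb: "\<bar>H e x\<bar> \<le> G" for e x
  proof -
    have "\<bar>H e x\<bar> \<le> (\<integral>z. \<bar>iU (x + e *\<^sub>R z) * gauss 1 z\<bar> \<partial>lborel)"
      unfolding H_def using integral_norm_bound[of lborel "\<lambda>z. iU (x + e *\<^sub>R z) * gauss 1 z"] by simp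
    also have "\<dots> \<le> G"
      unfolding G_def using integrable_abs[OF Hint]
      by (intro integral_mono integrable_gauss) (auto simp: iU_def indicator_def)
    finally show ?thesis .
  qed
  have FH: "(\<integral>x. F x * complex_of_real (H e x) \<partial>lborel) = 0" if e: "0 < e" for e
  proof -
    \<comment> \<open>The kernel with parameter 1/\<delta> has width sqrt \<delta>; this choice
      matches the scale of \<open>H e\<close>.\<close>
    define \<delta> where "\<delta> = e\<^sup>2"
    have d: "0 < \<delta>" using e by (simp add: \<delta>_def)
    have "(\<integral>y. (\<integral>x. complex_of_real (gauss (1 / \<delta>) (x - y)) * F x \<partial>lborel) * complex_of_real (iU y) \<partial>lborel) =
        (\<integral>x. F x * (\<integral>y. complex_of_real (gauss (1 / \<delta>) (x - y)) * complex_of_real (iU y) \<partial>lborel) \<partial>lborel)"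
      using d by (intro kernel_swap[OF F intU]) (auto simp: gauss_le_one)
    moreover have "(\<integral>y. complex_of_real (gauss (1 / \<delta>) (x - y)) * complex_of_real (iU y) \<partial>lborel) =
       complex_of_real (1 / lin_scale (e *\<^sub>R (mat 1 :: real ^ 'n ^ 'n))) * complex_of_real (H e x)" for x
    proof -
      let ?A = "e *\<^sub>R (mat 1 :: real ^ 'n ^ 'n)" and ?A' = "(1 / e) *\<^sub>R (mat 1 :: real ^ 'n ^ 'n)"
      have inv: "?A ** ?A' = mat 1" using e by (simp add: matrix_scalar_ac flip: scalar_matrix_assoc)
      have Az: "?A *v z = e *\<^sub>R z" for z by (simp add: scaleR_matrix_vector_assoc[symmetric])
      have g: "gauss (1 / \<delta>) (e *\<^sub>R z) = gauss 1 z" for z :: "real ^ 'n"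
        using e by (simp add: gauss_def \<delta>_def power_mult_distrib)
      have "(\<integral>y. gauss (1 / \<delta>) (x - y) * iU y \<partial>lborel) = (\<integral>y. gauss (1 / \<delta>) (x - (x + y)) * iU (x + y) \<partial>lborel)"
        by (rule integral_lborel_translate(2)[symmetric]) measurable
      then have 1: "(\<integral>y. gauss (1 / \<delta>) (x - y) * iU y \<partial>lborel) = (\<integral>y. gauss (1 / \<delta>) y * iU (x + y) \<partial>lborel)" by simp
      have "H e x = (\<integral>z. gauss (1 / \<delta>) (?A *v z) * iU (x + ?A *v z) \<partial>lborel)"
        unfolding H_def Az g by (simp add: mult.commute)
      also have "\<dots> = lin_scale ?A *\<^sub>R (\<integral>y. gauss (1 / \<delta>) y * iU (x + y) \<partial>lborel)"
        by (rule integral_linear_image[OF inv]) measurable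
      finally have "(\<integral>y. gauss (1 / \<delta>) (x - y) * iU y \<partial>lborel) = 1 / lin_scale ?A * H e x"
        using 1 lin_scale_pos[OF inv] by simp
      then show ?thesis by (simp only: integral_complex_of_real of_real_mult[symmetric])
    qed
    ultimately have "(\<integral>x. F x * (complex_of_real (1 / lin_scale (e *\<^sub>R (mat 1 :: real ^ 'n ^ 'n))) * complex_of_real (H e x)) \<partial>lborel) = 0"
      using conv[OF d] by (simp add: mult.commute)
    then have "complex_of_real (1 / lin_scale (e *\<^sub>R (mat 1 :: real ^ 'n ^ 'n))) * (\<integral>x. F x * complex_of_real (H e x) \<partial>lborel) = 0"
      by (subst integral_mult_right_zero[symmetric]) (simp add: mult_ac)
    moreover have "lin_scale (e *\<^sub>R (mat 1 :: real ^ 'n ^ 'n)) > 0"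
      using e by (intro lin_scale_pos[of _ "(1 / e) *\<^sub>R mat 1"]) (simp add: matrix_scalar_ac flip: scalar_matrix_assoc)
    ultimately show ?thesis by simp
  qed
  have Hlim: "(\<lambda>k. H (1 / real (Suc k)) x) \<longlonglongrightarrow> iU x * G" if x: "x \<notin> cbox a b - box a b" for x
  proof -
    have pt: "(\<lambda>k. iU (x + (1 / real (Suc k)) *\<^sub>R z)) \<longlonglongrightarrow> iU x" for z
    proof -
      have "(\<lambda>k. x + (1 / real (Suc k)) *\<^sub>R z) \<longlonglongrightarrow> x + 0 *\<^sub>R z"
        by (intro tendsto_intros LIMSEQ_Suc[OF lim_1_over_n])
      then have lim: "(\<lambda>k. x + (1 / real (Suc k)) *\<^sub>R z) \<longlonglongrightarrow> x" by simp
      \<comment> \<open>A neighbourhood of \<open>x\<close> on which the indicator is constant; it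
        exists off the boundary.\<close>
      define V where "V = (if x \<in> box a b then box a b else - cbox a b)"
      have "open V" "x \<in> V" using x by (auto simp: V_def open_box closed_cbox open_Compl)
      from topological_tendstoD[OF lim this]
      have "eventually (\<lambda>k. iU (x + (1 / real (Suc k)) *\<^sub>R z) = iU x) sequentially"
        by eventually_elim
          (use x box_subset_cbox[of a b] in \<open>auto simp: V_def iU_def U_def indicator_def split: if_splits\<close>)
      then show ?thesis by (rule tendsto_eventually)
    qed
    have "(\<lambda>k. H (1 / real (Suc k)) x) \<longlonglongrightarrow> (\<integral>z. iU x * gauss 1 z \<partial>(lborel :: (real ^ 'n) measure))"
      unfolding H_def
    proof (rule integral_dominated_convergence[where w = "gauss 1 :: real ^ 'n \<Rightarrow> real"])
      show "AE z in lborel. (\<lambda>k. iU (x + (1 / real (Suc k)) *\<^sub>R z) * gauss 1 z) \<longlonglongrightarrow> iU x * gauss 1 z"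
        by (intro AE_I2 tendsto_mult pt tendsto_const)
    qed (auto simp: integrable_gauss iU_def indicator_def)
    then show ?thesis by (simp add: G_def)
  qed
  have "(\<lambda>k. \<integral>x. F x * complex_of_real (H (1 / real (Suc k)) x) \<partial>lborel) \<longlonglongrightarrow> (\<integral>x. F x * complex_of_real (iU x * G) \<partial>lborel)"
  proof (rule integral_dominated_convergence[where w = "\<lambda>x. cmod (F x) * G"])
    show "AE x in lborel. (\<lambda>k. F x * complex_of_real (H (1 / real (Suc k)) x)) \<longlonglongrightarrow> F x * complex_of_real (iU x * G)"
      using AE_boundary_box[of a b]
    proof eventually_elim
      case (elim x)
      then show ?case by (intro tendsto_mult tendsto_const tendsto_of_real Hlim)
    qed
    show "AE x in lborel. norm (F x * complex_of_real (H (1 / real (Suc k)) x)) \<le> cmod (F x) * G" for k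
      using Hb by (auto simp: norm_mult intro!: mult_left_mono)
  qed (use F in auto)
  then have "(\<integral>x. F x * complex_of_real (iU x * G) \<partial>lborel) = 0"
    using FH by (simp add: LIMSEQ_const_iff)
  then have "complex_of_real G * (LINT x:U|lborel. F x) = 0"
    unfolding set_lebesgue_integral_def
    by (subst integral_mult_right_zero[symmetric]) (simp add: iU_def scaleR_conv_of_real mult_ac)
  then show "(LINT x:box a b|lborel. F x) = 0" using G by (simp add: U_def)
qed

section \<open>Schwartz functions and Gaussian wave packets\<close>

lemma schwartz_differentiable: "\<phi> \<in> schwartz \<Longrightarrow> iter_pderiv is \<phi> differentiable (at x)"
  by (simp add: schwartz_def)

lemma schwartz_differentiable0: "\<phi> \<in> schwartz \<Longrightarrow> \<phi> differentiable (at x)"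
  using schwartz_differentiable[of \<phi> "[]"] by (simp add: iter_pderiv_def)

lemma schwartz_pderiv: "\<phi> \<in> schwartz \<Longrightarrow> pderiv_fun i \<phi> \<in> schwartz"
proof -
  assume a: "\<phi> \<in> schwartz"
  have "iter_pderiv is (pderiv_fun i \<phi>) = iter_pderiv (is @ [i]) \<phi>" for "is"
    by (simp add: iter_pderiv_def)
  then show ?thesis using a by (simp add: schwartz_def)
qed

lemma schwartz_continuous: "\<phi> \<in> schwartz \<Longrightarrow> continuous_on UNIV \<phi>"
  using schwartz_differentiable0
  by (meson continuous_at_imp_continuous_on differentiable_imp_continuous_within)

lemma schwartz_measurable: "\<phi> \<in> schwartz \<Longrightarrow> \<phi> \<in> borel_measurable borel"
  by (intro borel_measurable_continuous_onI schwartz_continuous)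

lemma schwartz_decay:
  fixes \<phi> :: "real ^ 'n \<Rightarrow> complex"
  assumes "\<phi> \<in> schwartz"
  shows "\<exists>C\<ge>0. \<forall>x. norm x ^ k * cmod (\<phi> x) \<le> C"
proof -
  have "bounded (range (\<lambda>x. norm x ^ k *\<^sub>R iter_pderiv [] \<phi> x))" using assms by (simp add: schwartz_def)
  then obtain C where "\<And>x. norm (norm x ^ k *\<^sub>R \<phi> x) \<le> C" by (auto simp: bounded_iff iter_pderiv_def)
  then show ?thesis by (intro exI[of _ "max C 0"]) (auto intro: le_max_iff_disj[THEN iffD2])
qed

lemma schwartz_bounded:
  fixes \<phi> :: "real ^ 'n \<Rightarrow> complex"
  assumes "\<phi> \<in> schwartz"
  shows "\<exists>C\<ge>0. \<forall>x. cmod (\<phi> x) \<le> C"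
  using schwartz_decay[OF assms, of 0] by simp

text \<open>The product of the 1 / (1 + x_i^2) is an integrable weight whose reciprocal is at most
  (1 + |x|^2)^n. So bounds for |\<phi>| and for |x|^(2n) |\<phi>| yield a majorant.\<close>

lemma schwartz_integrable:
  fixes \<phi> :: "real ^ 'n \<Rightarrow> complex"
  assumes "\<phi> \<in> schwartz"
  shows "integrable lborel \<phi>"
proof -
  let ?n = "CARD('n)"
  obtain C0 where C0: "C0 \<ge> 0" "\<And>x. cmod (\<phi> x) \<le> C0" using schwartz_bounded[OF assms] by blast
  obtain C1 where C1: "C1 \<ge> 0" "\<And>x. norm x ^ (2 * ?n) * cmod (\<phi> x) \<le> C1" using schwartz_decay[OF assms] by blast
  let ?w = "\<lambda>x :: real ^ 'n. \<Prod>i\<in>UNIV. 1 / (1 + (x $ i)\<^sup>2)"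
  have "integrable lborel (\<lambda>x :: real. 1 / (1 + x\<^sup>2))"
    using integrable_inverse_1_plus_square
    by (simp add: set_integrable_def einterval_def inverse_eq_divide)
  then have w: "integrable lborel ?w" by (intro integrable_lborel_vec_prod)
  show ?thesis
  proof (rule Bochner_Integration.integrable_bound)
    show "integrable lborel (\<lambda>x. (2 ^ ?n * (C0 + C1)) * ?w x)" by (intro integrable_mult_right w)
    show "\<phi> \<in> borel_measurable lborel" using schwartz_measurable[OF assms] by simp
    have "cmod (\<phi> x) \<le> (2 ^ ?n * (C0 + C1)) * ?w x" for x
    proof -
      let ?p = "\<Prod>i\<in>UNIV. (1 + (x $ i)\<^sup>2)"
      have pp: "?p > 0" by (intro prod_pos) (simp add: add_pos_nonneg)
      have "?p \<le> (\<Prod>i\<in>(UNIV :: 'n set). 1 + (norm x)\<^sup>2)"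
        using component_le_norm_cart[of x] by (intro prod_mono) (auto intro: abs_le_square_iff[THEN iffD1])
      also have "\<dots> = (1 + (norm x)\<^sup>2) ^ ?n" by simp
      also have "\<dots> \<le> (2 * max 1 ((norm x)\<^sup>2)) ^ ?n" by (intro power_mono) auto
      also have "\<dots> = 2 ^ ?n * max 1 ((norm x)\<^sup>2) ^ ?n" by (simp add: power_mult_distrib)
      also have "\<dots> \<le> 2 ^ ?n * (1 + norm x ^ (2 * ?n))"
      proof (rule mult_left_mono)
        show "max 1 ((norm x)\<^sup>2) ^ ?n \<le> 1 + norm x ^ (2 * ?n)"
          by (cases "(norm x)\<^sup>2 \<le> 1") (auto simp: max_def power_mult)
      qed simp
      finally have "?p * cmod (\<phi> x) \<le> 2 ^ ?n * (1 + norm x ^ (2 * ?n)) * cmod (\<phi> x)"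
        by (intro mult_right_mono) auto
      also have "\<dots> = 2 ^ ?n * (cmod (\<phi> x) + norm x ^ (2 * ?n) * cmod (\<phi> x))" by (simp add: algebra_simps)
      also have "\<dots> \<le> 2 ^ ?n * (C0 + C1)" by (intro mult_left_mono add_mono C0 C1) auto
      finally have "cmod (\<phi> x) \<le> 2 ^ ?n * (C0 + C1) / ?p" using pp by (simp add: pos_le_divide_eq mult.commute)
      also have "\<dots> = (2 ^ ?n * (C0 + C1)) * ?w x" by (simp add: prod_dividef)
      finally show ?thesis .
    qed
    moreover have "0 \<le> (2 ^ ?n * (C0 + C1)) * ?w x" for x
      using C0(1) C1(1) by (intro mult_nonneg_nonneg prod_nonneg) auto
    ultimately show "AE x in lborel. norm (\<phi> x) \<le> norm ((2 ^ ?n * (C0 + C1)) * ?w x)"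
      by (simp only: real_norm_def abs_of_nonneg) simp
  qed
qed

lemma schwartz_square_integrable:
  fixes \<phi> :: "real ^ 'n \<Rightarrow> complex"
  assumes "\<phi> \<in> schwartz"
  shows "square_integrable \<phi>"
proof -
  have [measurable]: "\<phi> \<in> borel_measurable borel" by (rule schwartz_measurable[OF assms])
  obtain C where C: "C \<ge> 0" "\<And>x. cmod (\<phi> x) \<le> C" using schwartz_bounded[OF assms] by blast
  have "integrable lborel (\<lambda>x. (cmod (\<phi> x))\<^sup>2)"
  proof (rule Bochner_Integration.integrable_bound)
    show "integrable lborel (\<lambda>x. C * cmod (\<phi> x))" using schwartz_integrable[OF assms] by simp
    show "AE x in lborel. norm ((cmod (\<phi> x))\<^sup>2) \<le> norm (C * cmod (\<phi> x))"
      using C by (auto simp: power2_eq_square abs_mult intro!: mult_right_mono)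
  qed measurable
  then show ?thesis by (simp add: square_integrable_def)
qed

lemma pderiv_fun_eq:
  assumes "(f has_derivative D) (at x)"
  shows "pderiv_fun i f x = D (axis i 1)"
  using frechet_derivative_at[OF assms] by (simp add: pderiv_fun_def)

section \<open>Polynomials and Gaussian wave packets\<close>

text \<open>Generated inductively, so that stability under differentiation and polynomial growth are
  plain inductions. Closure under products is needed because each derivative of a packet brings in
  another polynomial factor.\<close>

inductive_set poly_funs :: "(real ^ 'n \<Rightarrow> complex) set" where
  const: "(\<lambda>x. c) \<in> poly_funs"
| coord: "(\<lambda>x. complex_of_real (x $ j)) \<in> poly_funs"
| add: "f \<in> poly_funs \<Longrightarrow> g \<in> poly_funs \<Longrightarrow> (\<lambda>x. f x + g x) \<in> poly_funs"
| mult: "f \<in> poly_funs \<Longrightarrow> g \<in> poly_funs \<Longrightarrow> (\<lambda>x. f x * g x) \<in> poly_funs"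

lemma poly_funs_sum: "(\<And>i. i \<in> I \<Longrightarrow> f i \<in> poly_funs) \<Longrightarrow> (\<lambda>x. \<Sum>i\<in>I. f i x) \<in> poly_funs"
  by (induction I rule: infinite_finite_induct) (auto intro: poly_funs.intros)

lemma poly_funs_derivative:
  fixes f :: "real ^ 'n \<Rightarrow> complex"
  assumes "f \<in> poly_funs"
  shows "\<exists>D. (\<forall>x. (f has_derivative D x) (at x)) \<and> (\<forall>v. (\<lambda>x. D x v) \<in> poly_funs)"
  using assms
proof induction
  case (const c)
  then show ?case by (intro exI[of _ "\<lambda>x v. 0"]) (auto intro: poly_funs.const)
next
  case (coord j)
  have "bounded_linear (\<lambda>x :: real ^ 'n. complex_of_real (x $ j))"
    by (rule bounded_linear_compose[OF bounded_linear_of_real bounded_linear_vec_nth])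
  then show ?case
    by (intro exI[of _ "\<lambda>x v. complex_of_real (v $ j)"]) (auto intro: poly_funs.const bounded_linear_imp_has_derivative)
next
  case (add f g)
  then obtain D E where "\<And>x. (f has_derivative D x) (at x)" "\<And>v. (\<lambda>x. D x v) \<in> poly_funs"
    "\<And>x. (g has_derivative E x) (at x)" "\<And>v. (\<lambda>x. E x v) \<in> poly_funs" by blast
  then show ?case
    by (intro exI[of _ "\<lambda>x v. D x v + E x v"]) (auto intro: poly_funs.add has_derivative_add)
next
  case (mult f g)
  then obtain D E where "\<And>x. (f has_derivative D x) (at x)" "\<And>v. (\<lambda>x. D x v) \<in> poly_funs"
    "\<And>x. (g has_derivative E x) (at x)" "\<And>v. (\<lambda>x. E x v) \<in> poly_funs" by blast
  then show ?case using mult.hyps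
    by (intro exI[of _ "\<lambda>x v. f x * E x v + D x v * g x"])
      (auto intro!: poly_funs.add poly_funs.mult has_derivative_mult)
qed

lemma poly_funs_bound:
  assumes "f \<in> poly_funs"
  shows "\<exists>C k. 0 \<le> C \<and> (\<forall>x. cmod (f x) \<le> C * (1 + norm x) ^ k)"
  using assms
proof induction
  case (const c)
  show ?case by (intro exI[of _ "cmod c"] exI[of _ 0]) simp
next
  case (coord j)
  show ?case using component_le_norm_cart[of _ j]
    by (intro exI[of _ 1] exI[of _ 1]) (auto intro: add_increasing)
next
  case (add f g)
  then obtain C k D l where f: "0 \<le> C" "\<And>x. cmod (f x) \<le> C * (1 + norm x) ^ k"
    and g: "0 \<le> D" "\<And>x. cmod (g x) \<le> D * (1 + norm x) ^ l" by blast
  have "cmod (f x + g x) \<le> (C + D) * (1 + norm x) ^ (k + l)" for x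
  proof -
    have "cmod (f x + g x) \<le> C * (1 + norm x) ^ k + D * (1 + norm x) ^ l"
      using norm_triangle_ineq[of "f x" "g x"] f(2)[of x] g(2)[of x] by linarith
    also have "\<dots> \<le> C * (1 + norm x) ^ (k + l) + D * (1 + norm x) ^ (k + l)"
      by (intro add_mono mult_left_mono power_increasing f g) auto
    finally show ?thesis by (simp add: algebra_simps)
  qed
  then show ?case using f(1) g(1) by (intro exI[of _ "C + D"] exI[of _ "k + l"]) auto
next
  case (mult f g)
  then obtain C k D l where f: "0 \<le> C" "\<And>x. cmod (f x) \<le> C * (1 + norm x) ^ k"
    and g: "0 \<le> D" "\<And>x. cmod (g x) \<le> D * (1 + norm x) ^ l" by blast
  have "cmod (f x * g x) \<le> (C * D) * (1 + norm x) ^ (k + l)" for x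
    using mult_mono[OF f(2)[of x] g(2)[of x]] f(1) by (simp add: norm_mult power_add mult_ac)
  then show ?case using f(1) g(1) by (intro exI[of _ "C * D"] exI[of _ "k + l"]) auto
qed

text \<open>The two parameters make the class stable under linear substitutions: composition with C
  turns the shape \<open>A\<close> into A C and the frequency \<open>w\<close> into C^T w.\<close>

definition packet :: "real ^ 'n ^ 'n \<Rightarrow> real ^ 'n \<Rightarrow> real ^ 'n \<Rightarrow> complex" where
  "packet A w x = cis (w \<bullet> x) * complex_of_real (gauss 1 (A *v x))"

text \<open>The logarithmic derivative of \<open>packet A w\<close> at \<open>x\<close> in the direction \<open>v\<close>.\<close>

definition packet_rate :: "real ^ 'n ^ 'n \<Rightarrow> real ^ 'n \<Rightarrow> real ^ 'n \<Rightarrow> real ^ 'n \<Rightarrow> complex" where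
  "packet_rate A w x v = \<i> * complex_of_real (w \<bullet> v) - complex_of_real ((A *v x) \<bullet> (A *v v))"

lemma packet_has_derivative:
  "(packet A w has_derivative (\<lambda>v. packet_rate A w x v * packet A w x)) (at x)"
proof -
  have A: "((*v) A has_derivative (*v) A) (at x)"
    by (simp add: bounded_linear_imp_has_derivative)
  have eq: "packet A w = (\<lambda>x. exp (\<i> * complex_of_real (w \<bullet> x) + complex_of_real ((- (1/2)) * ((A *v x) \<bullet> (A *v x)))))"
    unfolding packet_def fun_eq_iff cis_conv_exp gauss_def exp_add exp_of_real power2_norm_eq_inner by simp
  have 1: "((\<lambda>x. w \<bullet> x) has_derivative (\<lambda>v. w \<bullet> v)) (at x)"
    by (rule bounded_linear_imp_has_derivative[OF bounded_linear_inner_right])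
  have 2: "((\<lambda>x. (A *v x) \<bullet> (A *v x)) has_derivative (\<lambda>v. (A *v x) \<bullet> (A *v v) + (A *v v) \<bullet> (A *v x))) (at x)"
    by (rule has_derivative_inner[OF A A])
  have r: "\<i> * complex_of_real (w \<bullet> v) + complex_of_real ((- (1/2)) * ((A *v x) \<bullet> (A *v v) + (A *v v) \<bullet> (A *v x))) = packet_rate A w x v" for v
    unfolding packet_rate_def inner_commute[of "A *v v" "A *v x"] by simp
  from has_derivative_add[OF has_derivative_mult_right[OF has_derivative_of_real[OF 1], of \<i>]
      has_derivative_of_real[OF has_derivative_mult_right[OF 2, of "- (1/2)"]], unfolded r]
  have "((\<lambda>x. \<i> * complex_of_real (w \<bullet> x) + complex_of_real ((- (1/2)) * ((A *v x) \<bullet> (A *v x)))) has_derivative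
      (\<lambda>v. packet_rate A w x v)) (at x)" .
  from has_derivative_compose[OF this DERIV_exp[unfolded has_field_derivative_def]]
  show ?thesis unfolding eq by (simp only: mult.commute)
qed

lemma packet_rate_poly: "(\<lambda>x. packet_rate A w x v) \<in> poly_funs"
proof -
  have "(A *v x) \<bullet> (A *v v) = (\<Sum>j\<in>UNIV. (x $ j) * (\<Sum>i\<in>UNIV. A $ i $ j * (A *v v) $ i))" for x
    by (simp add: inner_vec_def matrix_vector_mult_def sum_distrib_left sum_distrib_right mult_ac)
      (subst sum.swap, simp)
  then have eq: "packet_rate A w x v = \<i> * complex_of_real (w \<bullet> v) +
      (\<Sum>j\<in>UNIV. complex_of_real (x $ j) * (- complex_of_real (\<Sum>i\<in>UNIV. A $ i $ j * (A *v v) $ i)))" for x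
    by (simp add: packet_rate_def sum_negf)
  show ?thesis unfolding eq by (intro poly_funs.intros poly_funs_sum)
qed

text \<open>Polynomial multiples are included because differentiation multiplies a packet by the
  affine function \<open>packet_rate\<close>; so iterated derivatives stay in the family.\<close>

definition packet_family :: "real ^ 'n ^ 'n \<Rightarrow> real ^ 'n \<Rightarrow> (real ^ 'n \<Rightarrow> complex) set" where
  "packet_family A w = {\<lambda>x. P x * packet A w x |P. P \<in> poly_funs}"

lemma packet_family_derivative:
  assumes "f \<in> packet_family A w"
  shows "f differentiable (at x)" and "pderiv_fun i f \<in> packet_family A w"
proof -
  obtain P where P: "P \<in> poly_funs" "f = (\<lambda>x. P x * packet A w x)" using assms by (auto simp: packet_family_def)
  obtain D where D: "\<And>x. (P has_derivative D x) (at x)" "\<And>v. (\<lambda>x. D x v) \<in> poly_funs"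
    using poly_funs_derivative[OF P(1)] by blast
  have der: "(f has_derivative (\<lambda>v. (P x * packet_rate A w x v + D x v) * packet A w x)) (at x)" for x
    unfolding P(2)
    by (rule has_derivative_eq_rhs[OF has_derivative_mult[OF D(1) packet_has_derivative]])
      (simp add: algebra_simps)
  then show "f differentiable (at x)" unfolding differentiable_def by blast
  have "pderiv_fun i f = (\<lambda>x. (P x * packet_rate A w x (axis i 1) + D x (axis i 1)) * packet A w x)"
    using pderiv_fun_eq[OF der] by blast
  then show "pderiv_fun i f \<in> packet_family A w"
    unfolding packet_family_def using P(1) D(2) by (auto intro!: poly_funs.intros packet_rate_poly)
qed

lemma cmod_packet: "cmod (packet A w x) = gauss 1 (A *v x)"
  by (simp add: packet_def norm_mult)

lemma gauss_matrix_le: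
  assumes "\<And>x. norm x \<le> K * norm (A *v x)" "0 < K" and that: "0 \<le> a"
  shows "gauss a (A *v x) \<le> gauss (a / K\<^sup>2) x"
proof -
  have "(norm x)\<^sup>2 \<le> (K * norm (A *v x))\<^sup>2" by (intro power_mono assms) simp
  then have "(norm x)\<^sup>2 / K\<^sup>2 \<le> (norm (A *v x))\<^sup>2" using assms(2) by (simp add: power_mult_distrib field_simps)
  from mult_left_mono[OF this that] show ?thesis by (simp add: gauss_def)
qed

lemma invertible_expansion:
  fixes A A' :: "real ^ 'n ^ 'n"
  assumes "A ** A' = mat 1"
  shows "\<exists>K>0. \<forall>x. norm x \<le> K * norm (A *v x)"
proof -
  obtain K where K: "K > 0" "\<And>x. norm (A' *v x) \<le> norm x * K"
    using bounded_linear.pos_bounded[OF matrix_vector_mul_bounded_linear[of A']] by blast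
  then show ?thesis using matrix_inverse_vector(2)[OF assms] by (metis mult.commute)
qed

text \<open>Only members of the family have to be bounded, since it is stable under derivatives.
  Invertibility of \<open>A\<close> makes the Gaussian decay in every direction and absorb all
  polynomials.\<close>

lemma packet_family_subset_schwartz:
  fixes A A' :: "real ^ 'n ^ 'n"
  assumes inv: "A ** A' = mat 1"
  shows "packet_family A w \<subseteq> schwartz"
proof
  fix f assume f: "f \<in> packet_family A w"
  have iter: "iter_pderiv is f \<in> packet_family A w" for "is"
    by (induction "is") (auto simp: iter_pderiv_def f packet_family_derivative)
  obtain K where K: "K > 0" "\<And>x. norm x \<le> K * norm (A *v x)" using invertible_expansion[OF inv] by blast
  have "bounded (range (\<lambda>x. norm x ^ k *\<^sub>R g x))" if g: "g \<in> packet_family A w" for g k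
  proof -
    obtain P where P: "P \<in> poly_funs" "g = (\<lambda>x. P x * packet A w x)" using g by (auto simp: packet_family_def)
    obtain C l where C: "0 \<le> C" "\<And>x. cmod (P x) \<le> C * (1 + norm x) ^ l" using poly_funs_bound[OF P(1)] by blast
    have a: "0 < 1 / K\<^sup>2" using K by simp
    have "norm (norm x ^ k *\<^sub>R g x) \<le> C * exp ((real (k + l))\<^sup>2 / (1 / K\<^sup>2))" for x
    proof -
      have "norm (norm x ^ k *\<^sub>R g x) = norm x ^ k * (cmod (P x) * gauss 1 (A *v x))"
        by (simp add: P(2) norm_mult cmod_packet)
      also have "\<dots> \<le> (1 + norm x) ^ k * ((C * (1 + norm x) ^ l) * gauss (1 / K\<^sup>2) x)"
        using gauss_matrix_le[OF K(2) K(1), of 1 x] C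
        by (intro mult_mono power_mono) auto
      also have "\<dots> = C * ((1 + norm x) ^ (k + l) * gauss (1 / K\<^sup>2) x)" by (simp add: power_add)
      also have "\<dots> \<le> C * (exp ((real (k + l))\<^sup>2 / (1 / K\<^sup>2)) * gauss (1 / K\<^sup>2 / 2) x)"
        by (intro mult_left_mono poly_gauss_bound a C)
      also have "\<dots> \<le> C * (exp ((real (k + l))\<^sup>2 / (1 / K\<^sup>2)) * 1)"
        by (intro mult_left_mono gauss_le_one) (use C a in auto)
      finally show ?thesis by simp
    qed
    then show ?thesis by (auto simp: bounded_iff)
  qed
  then show "f \<in> schwartz"
    using iter packet_family_derivative(1)[OF iter] by (auto simp: schwartz_def)
qed

lemma packet_schwartz:
  fixes A A' :: "real ^ 'n ^ 'n"
  assumes "A ** A' = mat 1"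
  shows "packet A w \<in> schwartz"
proof -
  have "packet A w \<in> packet_family A w"
    unfolding packet_family_def by (auto intro!: exI[of _ "\<lambda>x. 1"] poly_funs.const)
  then show ?thesis using packet_family_subset_schwartz[OF assms] by blast
qed

lemma poly_packet_schwartz:
  fixes A A' :: "real ^ 'n ^ 'n"
  assumes "A ** A' = mat 1" "P \<in> poly_funs"
  shows "(\<lambda>x. P x * packet A w x) \<in> schwartz"
  using packet_family_subset_schwartz[OF assms(1)] assms(2) unfolding packet_family_def by blast

section \<open>Distributional calculus on wave packets\<close>

text \<open>Testing with round packets of all frequencies yields the Fourier transform of
  \<open>f\<close> times a Gaussian, which is integrable although \<open>f\<close> itself may not
  be.\<close>

lemma schwartz_separates:
  fixes f :: "real ^ 'n \<Rightarrow> complex"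
  assumes f: "square_integrable f" and z: "\<And>\<phi>. \<phi> \<in> schwartz \<Longrightarrow> (\<integral>x. f x * \<phi> x \<partial>lborel) = 0"
  shows "AE x in lborel. f x = 0"
proof -
  have inv: "mat 1 ** mat 1 = (mat 1 :: real ^ 'n ^ 'n)" by simp
  define F where "F x = f x * packet (mat 1) 0 x" for x
  have F: "integrable lborel F"
    unfolding F_def by (intro square_integrable_mult f schwartz_square_integrable packet_schwartz[OF inv])
  have "fourier F \<xi> = 0" for \<xi>
  proof -
    have "cis (- (x \<bullet> \<xi>)) * F x = f x * packet (mat 1) (- \<xi>) x" for x
      by (simp add: F_def packet_def inner_commute)
    then show ?thesis unfolding fourier_def by (simp add: z packet_schwartz[OF inv])
  qed
  from AE_zero_if_fourier_zero[OF F this] show ?thesis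
  proof eventually_elim
    case (elim x)
    then have "cmod (f x) * gauss 1 x = 0" by (simp add: F_def packet_def flip: norm_mult)
    then show ?case by (simp add: less_imp_neq[OF gauss_pos, symmetric])
  qed
qed

lemma distr_of_L2_abs:
  assumes f: "square_integrable f" and \<phi>: "\<phi> \<in> schwartz"
  shows "distr_of_L2 (abs_L2 f) \<phi> = (\<integral>x. f x * \<phi> x \<partial>lborel)"
  unfolding distr_of_L2_def distr_of_fun_def
proof (rule integral_cong_AE)
  have [measurable]: "f \<in> borel_measurable borel" "rep_L2 (abs_L2 f) \<in> borel_measurable borel" "\<phi> \<in> borel_measurable borel"
    using f square_integrable_rep schwartz_measurable[OF \<phi>] by (auto simp: square_integrable_def)
  show "(\<lambda>x. rep_L2 (abs_L2 f) x * \<phi> x) \<in> borel_measurable lborel" "(\<lambda>x. f x * \<phi> x) \<in> borel_measurable lborel"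
    by measurable
  show "AE x in lborel. rep_L2 (abs_L2 f) x * \<phi> x = f x * \<phi> x"
    using rep_abs_L2_AE[OF f] by eventually_elim simp
qed

lemma dist_eq_L2_imp_eq:
  assumes "dist_eq (distr_of_L2 U) (distr_of_L2 V)"
  shows "U = V"
proof -
  have "AE x in lborel. rep_L2 U x - rep_L2 V x = 0"
  proof (rule schwartz_separates)
    show "square_integrable (\<lambda>x. rep_L2 U x - rep_L2 V x)"
      by (intro square_integrable_diff square_integrable_rep)
    fix \<phi> :: "(real, 'a) vec \<Rightarrow> complex" assume \<phi>: "\<phi> \<in> schwartz"
    have "integrable lborel (\<lambda>x. rep_L2 W x * \<phi> x)" for W
      by (intro square_integrable_mult square_integrable_rep schwartz_square_integrable \<phi>)
    then show "(\<integral>x. (rep_L2 U x - rep_L2 V x) * \<phi> x \<partial>lborel) = 0"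
      using assms \<phi> by (simp add: dist_eq_def distr_of_L2_def distr_of_fun_def left_diff_distrib)
  qed
  then have "abs_L2 (rep_L2 U) = abs_L2 (rep_L2 V)"
    by (intro abs_L2_eqI square_integrable_rep) simp
  then show ?thesis by (simp add: abs_rep_L2)
qed

lemma integral_rep_abs_L2:
  assumes "square_integrable f" and [measurable]: "g \<in> borel_measurable borel"
  shows "(\<integral>x. rep_L2 (abs_L2 f) x * g x \<partial>lborel) = (\<integral>x. f x * g x \<partial>lborel)"
proof (rule integral_cong_AE)
  have [measurable]: "f \<in> borel_measurable borel" "rep_L2 (abs_L2 f) \<in> borel_measurable borel"
    using assms square_integrable_rep by (auto simp: square_integrable_def)
  show "(\<lambda>x. rep_L2 (abs_L2 f) x * g x) \<in> borel_measurable lborel" "(\<lambda>x. f x * g x) \<in> borel_measurable lborel"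
    by measurable
  show "AE x in lborel. rep_L2 (abs_L2 f) x * g x = f x * g x"
    using rep_abs_L2_AE[OF assms(1)] by eventually_elim simp
qed

text \<open>Resolves the definite description behind \<open>fourier_L2\<close>: existence comes from
  \<open>plancherel_bound\<close> and transposition of the transform, uniqueness from the separation
  by Schwartz functions.\<close>

lemma fourier_L2_abs:
  fixes f :: "real ^ 'n \<Rightarrow> complex"
  assumes f: "integrable lborel f" and sq: "square_integrable f"
  shows "fourier_L2 (abs_L2 f) = abs_L2 (fourier f)"
  unfolding fourier_L2_def
proof (rule the_equality)
  have sqf: "square_integrable (fourier f)" by (rule plancherel_bound(1)[OF f sq])
  show *: "dist_eq (distr_of_L2 (abs_L2 (fourier f))) (distr_fourier (distr_of_L2 (abs_L2 f)))"
    unfolding dist_eq_def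
  proof
    fix \<phi> :: "real ^ 'n \<Rightarrow> complex" assume \<phi>: "\<phi> \<in> schwartz"
    have "distr_fourier (distr_of_L2 (abs_L2 f)) \<phi> = (\<integral>x. f x * fourier \<phi> x \<partial>lborel)"
      unfolding distr_fourier_def distr_of_L2_def distr_of_fun_def
      by (intro integral_rep_abs_L2 sq fourier_measurable schwartz_measurable \<phi>)
    then show "distr_of_L2 (abs_L2 (fourier f)) \<phi> = distr_fourier (distr_of_L2 (abs_L2 f)) \<phi>"
      by (simp add: distr_of_L2_abs[OF sqf \<phi>] integral_fourier_mult f schwartz_integrable[OF \<phi>])
  qed
  show "U = abs_L2 (fourier f)" if "dist_eq (distr_of_L2 U) (distr_fourier (distr_of_L2 (abs_L2 f)))" for U
    using that * by (intro dist_eq_L2_imp_eq) (simp add: dist_eq_def)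
qed

text \<open>Integrability of symbol times transform, rather than smoothness of the symbol, lets the
  inverse transform move off the test function.\<close>

lemma fourier_multiplier_abs:
  fixes f :: "real ^ 'n \<Rightarrow> complex"
  assumes f: "integrable lborel f" and sq: "square_integrable f" and m: "m \<in> borel_measurable borel"
    and int: "integrable lborel (\<lambda>\<xi>. complex_of_real (m \<xi>) * fourier f \<xi>)" and \<phi>: "\<phi> \<in> schwartz"
  shows "fourier_multiplier m (abs_L2 f) \<phi> =
    (\<integral>x. inv_fourier (\<lambda>\<xi>. complex_of_real (m \<xi>) * fourier f \<xi>) x * \<phi> x \<partial>lborel)"
proof -
  note m [measurable]
  have [measurable]: "\<phi> \<in> borel_measurable borel" by (rule schwartz_measurable[OF \<phi>])
  have sqf: "square_integrable (fourier f)" by (rule plancherel_bound(1)[OF f sq])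
  have "fourier_multiplier m (abs_L2 f) \<phi> =
      (\<integral>\<xi>. rep_L2 (abs_L2 (fourier f)) \<xi> * (complex_of_real (m \<xi>) * inv_fourier \<phi> \<xi>) \<partial>lborel)"
    unfolding fourier_multiplier_def distr_inv_fourier_def distr_of_fun_def fourier_L2_abs[OF f sq]
    by (simp add: mult_ac)
  also have "\<dots> = (\<integral>\<xi>. fourier f \<xi> * (complex_of_real (m \<xi>) * inv_fourier \<phi> \<xi>) \<partial>lborel)"
    by (rule integral_rep_abs_L2[OF sqf]) measurable
  also have "\<dots> = (\<integral>\<xi>. (complex_of_real (m \<xi>) * fourier f \<xi>) * inv_fourier \<phi> \<xi> \<partial>lborel)"
    by (simp add: mult_ac)
  also have "\<dots> = (\<integral>x. inv_fourier (\<lambda>\<xi>. complex_of_real (m \<xi>) * fourier f \<xi>) x * \<phi> x \<partial>lborel)"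
    by (rule integral_inv_fourier_mult[symmetric, OF int schwartz_integrable[OF \<phi>]])
  finally show ?thesis .
qed

text \<open>Up to the factor (2 pi)^n the inverse transform is the conjugate of the transform of the
  conjugate, so \<open>plancherel_bound\<close> applies.\<close>

lemma
  fixes g :: "real ^ 'n \<Rightarrow> complex"
  assumes g: "integrable lborel g" and sq: "square_integrable g"
  shows square_integrable_inv_fourier: "square_integrable (inv_fourier g)"
    and inv_fourier_bound: "(\<integral>x. (cmod (inv_fourier g x))\<^sup>2 \<partial>lborel) \<le> (\<integral>x. (cmod (g x))\<^sup>2 \<partial>lborel) / (2 * pi) ^ CARD('n)"
proof -
  let ?g = "\<lambda>x. cnj (g x)"
  have sq': "square_integrable ?g" by (rule square_integrable_cnj[OF sq])
  have g': "integrable lborel ?g" using g by simp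
  have [measurable]: "g \<in> borel_measurable borel" using g by auto
  have "inv_fourier g x = cnj (fourier ?g x) / (2 * pi) ^ CARD('n)" for x
    unfolding inv_fourier_def fourier_def
    by (subst Bochner_Integration.integral_cnj[symmetric]) (simp add: cis_cnj inner_commute)
  then have eq: "(cmod (inv_fourier g x))\<^sup>2 = (cmod (fourier ?g x))\<^sup>2 / ((2 * pi) ^ CARD('n))\<^sup>2" for x
    by (simp add: norm_divide norm_power power_divide norm_mult)
  note P = plancherel_bound[OF g' sq']
  have "integrable lborel (\<lambda>x. (cmod (inv_fourier g x))\<^sup>2)"
    unfolding eq using P(1) by (simp add: square_integrable_def)
  then show "square_integrable (inv_fourier g)" by (simp add: square_integrable_def)
  have "(\<integral>x. (cmod (inv_fourier g x))\<^sup>2 \<partial>lborel) = (\<integral>x. (cmod (fourier ?g x))\<^sup>2 \<partial>lborel) / ((2 * pi) ^ CARD('n))\<^sup>2"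
    unfolding eq by simp
  also have "\<dots> \<le> ((2 * pi) ^ CARD('n) * (\<integral>x. (cmod (g x))\<^sup>2 \<partial>lborel)) / ((2 * pi) ^ CARD('n))\<^sup>2"
    using P(2) by (intro divide_right_mono) auto
  also have "\<dots> = (\<integral>x. (cmod (g x))\<^sup>2 \<partial>lborel) / (2 * pi) ^ CARD('n)"
    by (simp add: power2_eq_square)
  finally show "(\<integral>x. (cmod (inv_fourier g x))\<^sup>2 \<partial>lborel) \<le> (\<integral>x. (cmod (g x))\<^sup>2 \<partial>lborel) / (2 * pi) ^ CARD('n)" .
qed

lemma has_derivative_frechet:
  "f differentiable (at x) \<Longrightarrow> (f has_derivative frechet_derivative f (at x)) (at x)"
  by (simp add: frechet_derivative_works)

lemma pderiv_fun_mult: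
  fixes f g :: "real ^ 'n \<Rightarrow> complex"
  assumes "f differentiable (at x)" "g differentiable (at x)"
  shows "pderiv_fun i (\<lambda>x. f x * g x) x = f x * pderiv_fun i g x + pderiv_fun i f x * g x"
  using pderiv_fun_eq[OF has_derivative_mult[OF assms[THEN has_derivative_frechet]], of i]
  by (simp add: pderiv_fun_def)

text \<open>Integration by parts without boundary terms: for F = f g the integral of F(x + e_i) -
  F(x) vanishes by translation invariance, and by the fundamental theorem along the segment and
  Fubini it equals the integral of the derivative of F.\<close>

lemma integral_schwartz_mult_pderiv:
  fixes f g :: "real ^ 'n \<Rightarrow> complex"
  assumes f: "f \<in> schwartz" and g: "g \<in> schwartz"
  shows "(\<integral>x. f x * pderiv_fun i g x \<partial>lborel) = - (\<integral>x. pderiv_fun i f x * g x \<partial>lborel)"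
proof -
  let ?e = "axis i 1 :: real ^ 'n"
  define F where "F x = f x * g x" for x
  define F' where "F' x = f x * pderiv_fun i g x + pderiv_fun i f x * g x" for x
  note sq = schwartz_square_integrable[OF f] schwartz_square_integrable[OF g]
    schwartz_square_integrable[OF schwartz_pderiv[OF f]] schwartz_square_integrable[OF schwartz_pderiv[OF g]]
  note cont = schwartz_continuous[OF f] schwartz_continuous[OF g]
    schwartz_continuous[OF schwartz_pderiv[OF f]] schwartz_continuous[OF schwartz_pderiv[OF g]]
  have F: "integrable lborel F" unfolding F_def by (intro square_integrable_mult sq)
  have i1: "integrable lborel (\<lambda>x. f x * pderiv_fun i g x)" "integrable lborel (\<lambda>x. pderiv_fun i f x * g x)"
    by (intro square_integrable_mult sq)+
  then have F': "integrable lborel F'" unfolding F'_def by simp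
  have cF': "continuous_on UNIV F'" unfolding F'_def by (intro continuous_intros cont)
  have [measurable]: "F' \<in> borel_measurable borel" "F \<in> borel_measurable borel" using F F' by auto
  have der: "((\<lambda>\<tau>. F (x + \<tau> *\<^sub>R ?e)) has_vector_derivative F' (x + \<tau> *\<^sub>R ?e)) (at \<tau> within {0..1})" for x \<tau>
  proof -
    let ?y = "x + \<tau> *\<^sub>R ?e"
    have Fd: "(F has_derivative frechet_derivative F (at ?y)) (at ?y)"
      unfolding F_def by (intro has_derivative_frechet differentiable_mult schwartz_differentiable0 f g)
    have e: "frechet_derivative F (at ?y) ?e = F' ?y"
      using pderiv_fun_mult[OF schwartz_differentiable0[OF f] schwartz_differentiable0[OF g], of i ?y]
      by (simp add: pderiv_fun_def[of i F] F_def[abs_def] F'_def pderiv_fun_def[of i "\<lambda>x. f x * g x"])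
    have "((\<lambda>\<tau>. x + \<tau> *\<^sub>R ?e) has_derivative (\<lambda>h. h *\<^sub>R ?e)) (at \<tau> within {0..1})"
      by (auto intro!: derivative_eq_intros)
    from has_derivative_compose[OF this Fd]
    show ?thesis
      using e linear_scale[OF has_derivative_linear[OF Fd]] by (simp add: has_vector_derivative_def)
  qed
  have ftc: "(\<integral>\<tau>. indicator {0..1} \<tau> *\<^sub>R F' (x + \<tau> *\<^sub>R ?e) \<partial>lborel) = F (x + ?e) - F x" for x
  proof -
    have "(\<integral>\<tau>. indicator {0..1} \<tau> *\<^sub>R F' (x + \<tau> *\<^sub>R ?e) \<partial>lborel) = F (x + 1 *\<^sub>R ?e) - F (x + 0 *\<^sub>R ?e)"
      by (rule integral_FTC_Icc[where F = "\<lambda>\<tau>. F (x + \<tau> *\<^sub>R ?e)"])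
        (auto intro!: der continuous_intros continuous_on_compose2[OF cF'])
    then show ?thesis by simp
  qed
  have tr: "integrable lborel (\<lambda>x. F' (x + c))" "(\<integral>x. F' (x + c) \<partial>lborel) = (\<integral>x. F' x \<partial>lborel)" for c
    using integral_lborel_translate[of F' c] F' by (simp_all add: add.commute)
  have nt: "(\<integral>x. norm (F' (x + c)) \<partial>lborel) = (\<integral>x. norm (F' x) \<partial>lborel)" for c
    using integral_lborel_translate(2)[of "\<lambda>x. norm (F' x)" c] by (simp add: add.commute)
  have pair: "integrable (lborel \<Otimes>\<^sub>M lborel) (\<lambda>(\<tau>::real, x). indicator {0..1} \<tau> *\<^sub>R F' (x + \<tau> *\<^sub>R ?e))"
  proof (rule lborel_pair.Fubini_integrable)
    show "integrable lborel (\<lambda>\<tau>. \<integral>x. norm (case (\<tau>, x) of (\<tau>::real, x) \<Rightarrow> indicator {0..1} \<tau> *\<^sub>R F' (x + \<tau> *\<^sub>R ?e)) \<partial>lborel)"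
      by (simp add: nt)
  qed (use tr in auto)
  have "0 = (\<integral>x. F (x + ?e) \<partial>lborel) - (\<integral>x. F x \<partial>lborel)"
    using integral_lborel_translate(2)[of F ?e] by (simp add: add.commute)
  also have "\<dots> = (\<integral>x. F (x + ?e) - F x \<partial>lborel)"
    using F integral_lborel_translate(1)[of F ?e] by (simp add: add.commute)
  also have "\<dots> = (\<integral>x. \<integral>\<tau>. indicator {0..1} \<tau> *\<^sub>R F' (x + \<tau> *\<^sub>R ?e) \<partial>lborel \<partial>lborel)" by (simp only: ftc)
  also have "\<dots> = (\<integral>\<tau>. \<integral>x. indicator {0..1} \<tau> *\<^sub>R F' (x + \<tau> *\<^sub>R ?e) \<partial>lborel \<partial>lborel)"
    by (rule lborel_pair.Fubini_integral[OF pair])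
  also have "\<dots> = (\<integral>x. F' x \<partial>lborel)" by (simp add: tr)
  also have "\<dots> = (\<integral>x. f x * pderiv_fun i g x \<partial>lborel) + (\<integral>x. pderiv_fun i f x * g x \<partial>lborel)"
    unfolding F'_def using i1 by simp
  finally show ?thesis by (simp add: eq_neg_iff_add_eq_0)
qed

lemma differentiable_coord: "(\<lambda>x :: real ^ 'n. complex_of_real (x $ j)) differentiable (at x)"
  and pderiv_fun_coord: "pderiv_fun i (\<lambda>x :: real ^ 'n. complex_of_real (x $ j)) x = (if i = j then 1 else 0)"
proof -
  have "bounded_linear (\<lambda>x :: real ^ 'n. complex_of_real (x $ j))"
    by (rule bounded_linear_compose[OF bounded_linear_of_real bounded_linear_vec_nth])
  then have d: "((\<lambda>x :: real ^ 'n. complex_of_real (x $ j)) has_derivative (\<lambda>x. complex_of_real (x $ j))) (at x)"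
    by (rule bounded_linear_imp_has_derivative)
  then show "(\<lambda>x :: real ^ 'n. complex_of_real (x $ j)) differentiable (at x)" unfolding differentiable_def by blast
  show "pderiv_fun i (\<lambda>x :: real ^ 'n. complex_of_real (x $ j)) x = (if i = j then 1 else 0)"
    using pderiv_fun_eq[OF d, of i] by (simp add: axis_def)
qed

lemma pderiv_fun_packet: "pderiv_fun i (packet A w) x = packet_rate A w x (axis i 1) * packet A w x"
  by (rule pderiv_fun_eq[OF packet_has_derivative])

lemma packet_rate_linear: "linear (packet_rate A w x)"
  unfolding packet_rate_def
proof (rule linearI)
  fix r :: real and b
  show "\<i> * complex_of_real (w \<bullet> r *\<^sub>R b) - complex_of_real ((A *v x) \<bullet> (A *v r *\<^sub>R b)) =
      r *\<^sub>R (\<i> * complex_of_real (w \<bullet> b) - complex_of_real ((A *v x) \<bullet> (A *v b)))"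
    unfolding matrix_vector_mult_scaleR inner_scaleR_right
    by (simp add: scaleR_conv_of_real algebra_simps)
qed (simp add: inner_add_right matrix_vector_right_distrib algebra_simps)

lemma packet_rate_sum: "packet_rate A w x v = (\<Sum>i\<in>UNIV. complex_of_real (v $ i) * packet_rate A w x (axis i 1))"
proof -
  have v: "v = (\<Sum>i\<in>UNIV. v $ i *\<^sub>R axis i 1)"
    by (simp add: vec_eq_iff axis_def if_distrib[of "\<lambda>t. _ * t"] cong: if_cong)
  have "packet_rate A w x (\<Sum>i\<in>UNIV. v $ i *\<^sub>R axis i 1) = (\<Sum>i\<in>UNIV. v $ i *\<^sub>R packet_rate A w x (axis i 1))"
    by (simp add: linear_sum[OF packet_rate_linear] linear_scale[OF packet_rate_linear])
  then show ?thesis using v by (simp add: scaleR_conv_of_real)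
qed

lemma integral_double_sum:
  fixes c :: "'i \<Rightarrow> 'j \<Rightarrow> complex" and h :: "'i \<Rightarrow> 'j \<Rightarrow> 'a \<Rightarrow> complex"
  assumes "\<And>i j. integrable M (h i j)"
  shows "(\<integral>x. (\<Sum>i\<in>I. \<Sum>j\<in>J. c i j * h i j x) \<partial>M) = (\<Sum>i\<in>I. \<Sum>j\<in>J. c i j * (\<integral>x. h i j x \<partial>M))"
  using assms by simp

text \<open>The distributional derivative acts on x_j \<phi>, and moving it back onto the packet
  makes it act on x_j u. The two Kronecker terms cancel, which leaves the rate of the packet along B
  x.\<close>

lemma packet_drift:
  fixes A A' B :: "real ^ 'n ^ 'n"
  assumes inv: "A ** A' = mat 1" and \<phi>: "\<phi> \<in> schwartz"
  shows "(\<Sum>i\<in>UNIV. \<Sum>j\<in>UNIV. complex_of_real (B $ i $ j) *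
        distr_mult (\<lambda>x. complex_of_real (x $ j)) (distr_pderiv i (distr_of_L2 (abs_L2 (packet A w)))) \<phi>) =
    (\<integral>x. packet_rate A w x (B *v x) * packet A w x * \<phi> x \<partial>lborel)"
proof -
  let ?u = "packet A w"
  have u: "?u \<in> schwartz" by (rule packet_schwartz[OF inv])
  note squ = schwartz_square_integrable[OF u] and sq\<phi> = schwartz_square_integrable[OF \<phi>]
  have xu: "(\<lambda>x. complex_of_real (x $ j) * ?u x) \<in> schwartz" for j
    by (intro poly_packet_schwartz[OF inv] poly_funs.coord)
  have xdu: "(\<lambda>x. (complex_of_real (x $ j) * packet_rate A w x (axis i 1)) * ?u x) \<in> schwartz" for i j
    by (intro poly_packet_schwartz[OF inv] poly_funs.intros packet_rate_poly)
  have int: "integrable lborel (\<lambda>x. (complex_of_real (x $ j) * packet_rate A w x (axis i 1)) * ?u x * \<phi> x)" for i j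
    by (intro square_integrable_mult schwartz_square_integrable xdu \<phi>)
  have int0: "integrable lborel (\<lambda>x. ?u x * \<phi> x)" by (intro square_integrable_mult squ sq\<phi>)
  have int1: "integrable lborel (\<lambda>x. (complex_of_real (x $ j) * ?u x) * pderiv_fun i \<phi> x)" for i j
    by (intro square_integrable_mult schwartz_square_integrable xu schwartz_pderiv \<phi>)
  have *: "distr_mult (\<lambda>x. complex_of_real (x $ j)) (distr_pderiv i (distr_of_L2 (abs_L2 ?u))) \<phi> =
      (\<integral>x. (complex_of_real (x $ j) * packet_rate A w x (axis i 1)) * ?u x * \<phi> x \<partial>lborel)" for i j
  proof -
    let ?\<delta> = "if i = j then 1 else 0 :: complex"
    have pd: "pderiv_fun i (\<lambda>x. complex_of_real (x $ j) * \<phi> x) x = complex_of_real (x $ j) * pderiv_fun i \<phi> x + ?\<delta> * \<phi> x" for x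
      by (subst pderiv_fun_mult) (simp_all add: differentiable_coord schwartz_differentiable0[OF \<phi>] pderiv_fun_coord)
    have m: "(\<lambda>x. complex_of_real (x $ j) * pderiv_fun i \<phi> x + ?\<delta> * \<phi> x) \<in> borel_measurable borel"
      using schwartz_measurable[OF \<phi>] schwartz_measurable[OF schwartz_pderiv[OF \<phi>], of i]
      by (intro borel_measurable_add borel_measurable_times borel_measurable_of_real) auto
    have "distr_mult (\<lambda>x. complex_of_real (x $ j)) (distr_pderiv i (distr_of_L2 (abs_L2 ?u))) \<phi> =
        - (\<integral>x. ?u x * (complex_of_real (x $ j) * pderiv_fun i \<phi> x + ?\<delta> * \<phi> x) \<partial>lborel)"
      unfolding distr_mult_def distr_pderiv_def distr_of_L2_def distr_of_fun_def
      by (simp only: pd integral_rep_abs_L2[OF squ m])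
    also have "(\<integral>x. ?u x * (complex_of_real (x $ j) * pderiv_fun i \<phi> x + ?\<delta> * \<phi> x) \<partial>lborel) =
        (\<integral>x. (complex_of_real (x $ j) * ?u x) * pderiv_fun i \<phi> x \<partial>lborel) + ?\<delta> * (\<integral>x. ?u x * \<phi> x \<partial>lborel)"
    proof -
      have "?u x * (complex_of_real (x $ j) * pderiv_fun i \<phi> x + ?\<delta> * \<phi> x) =
        (complex_of_real (x $ j) * ?u x) * pderiv_fun i \<phi> x + ?\<delta> * (?u x * \<phi> x)" for x
        by (simp add: algebra_simps)
      then show ?thesis using int1[of j i] int0 by (simp only: Bochner_Integration.integral_add integrable_mult_right integral_mult_right_zero)
    qed
    also have "(\<integral>x. (complex_of_real (x $ j) * ?u x) * pderiv_fun i \<phi> x \<partial>lborel) =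
        - (\<integral>x. pderiv_fun i (\<lambda>x. complex_of_real (x $ j) * ?u x) x * \<phi> x \<partial>lborel)"
      by (rule integral_schwartz_mult_pderiv[OF xu \<phi>])
    also have "(\<integral>x. pderiv_fun i (\<lambda>x. complex_of_real (x $ j) * ?u x) x * \<phi> x \<partial>lborel) =
        (\<integral>x. (complex_of_real (x $ j) * packet_rate A w x (axis i 1)) * ?u x * \<phi> x \<partial>lborel) + ?\<delta> * (\<integral>x. ?u x * \<phi> x \<partial>lborel)"
    proof -
      have "pderiv_fun i (\<lambda>x. complex_of_real (x $ j) * ?u x) x * \<phi> x =
          (complex_of_real (x $ j) * packet_rate A w x (axis i 1)) * ?u x * \<phi> x + ?\<delta> * (?u x * \<phi> x)" for x
        by (subst pderiv_fun_mult)
          (simp_all add: differentiable_coord schwartz_differentiable0[OF u] pderiv_fun_coord pderiv_fun_packet algebra_simps)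
      then show ?thesis using int[of j i] int0 by (simp only: Bochner_Integration.integral_add integrable_mult_right integral_mult_right_zero)
    qed
    finally show ?thesis by simp
  qed
  have "packet_rate A w x (B *v x) * ?u x * \<phi> x =
      (\<Sum>i\<in>UNIV. \<Sum>j\<in>UNIV. complex_of_real (B $ i $ j) * ((complex_of_real (x $ j) * packet_rate A w x (axis i 1)) * ?u x * \<phi> x))" for x
    by (subst packet_rate_sum) (simp add: matrix_vector_mult_def sum_distrib_left sum_distrib_right mult_ac)
  then have "(\<integral>x. packet_rate A w x (B *v x) * ?u x * \<phi> x \<partial>lborel) =
      (\<Sum>i\<in>UNIV. \<Sum>j\<in>UNIV. complex_of_real (B $ i $ j) * (\<integral>x. (complex_of_real (x $ j) * packet_rate A w x (axis i 1)) * ?u x * \<phi> x \<partial>lborel))"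
    by (simp only: integral_double_sum[OF int])
  then show ?thesis by (simp only: *)
qed

text \<open>Substituting y = A x leaves the transform of the standard Gaussian at A^(-T) (\<xi> -
  w): it is concentrated around \<open>w\<close> at the scale of \<open>transpose A\<close>.\<close>

lemma fourier_packet:
  fixes A A' :: "real ^ 'n ^ 'n"
  assumes inv: "A ** A' = mat 1"
  shows "fourier (packet A w) \<xi> =
    complex_of_real (lin_scale A * sqrt (2 * pi) ^ CARD('n) * gauss 1 (transpose A' *v (\<xi> - w)))"
proof -
  let ?\<zeta> = "transpose A' *v (\<xi> - w)"
  have "cis (- (x \<bullet> \<xi>)) * packet A w x = cis (- ((A *v x) \<bullet> ?\<zeta>)) * complex_of_real (gauss 1 (A *v x))" for x
  proof -
    have "(A *v x) \<bullet> ?\<zeta> = (A' *v (A *v x)) \<bullet> (\<xi> - w)"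
      by (simp add: dot_lmul_matrix[symmetric] inner_commute)
    then have "(A *v x) \<bullet> ?\<zeta> = x \<bullet> \<xi> - w \<bullet> x"
      by (simp add: matrix_inverse_vector[OF inv] inner_diff_right inner_commute)
    then show ?thesis by (simp add: packet_def cis_mult flip: mult.assoc)
  qed
  then have "fourier (packet A w) \<xi> = (\<integral>x. cis (- ((A *v x) \<bullet> ?\<zeta>)) * complex_of_real (gauss 1 (A *v x)) \<partial>lborel)"
    by (simp add: fourier_def)
  also have "\<dots> = lin_scale A *\<^sub>R (\<integral>y. cis (- (y \<bullet> ?\<zeta>)) * complex_of_real (gauss 1 y) \<partial>lborel)"
    by (rule integral_linear_image[OF inv]) measurable
  also have "(\<integral>y. cis (- (y \<bullet> ?\<zeta>)) * complex_of_real (gauss 1 y) \<partial>lborel) = complex_of_real (sqrt (2 * pi) ^ CARD('n) * gauss 1 ?\<zeta>)"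
    using fourier_gauss[of 1 ?\<zeta>] by (simp add: fourier_def)
  finally show ?thesis by (simp add: scaleR_conv_of_real)
qed

section \<open>The Ornstein-Uhlenbeck operator on wave packets\<close>

lemma gauss_square: "(gauss 1 x)\<^sup>2 = gauss 2 x"
  by (simp add: power2_eq_square gauss_mult)

definition quad_symbol :: "real ^ 'n ^ 'n \<Rightarrow> real \<Rightarrow> real ^ 'n \<Rightarrow> real" where
  "quad_symbol Q s \<xi> = ((Q *v \<xi>) \<bullet> \<xi>) powr s"

lemma quad_symbol_measurable [measurable]: "quad_symbol Q s \<in> borel_measurable borel"
  unfolding quad_symbol_def by measurable

lemma quad_symbol_nonneg [simp]: "0 \<le> quad_symbol Q s \<xi>"
  by (simp add: quad_symbol_def)

lemma quad_form_le:
  fixes Q :: "real ^ 'n ^ 'n"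
  shows "\<exists>C\<ge>1. \<forall>\<xi>. (Q *v \<xi>) \<bullet> \<xi> \<le> C * (norm \<xi>)\<^sup>2"
proof -
  obtain K where K: "\<And>x. norm (Q *v x) \<le> norm x * K"
    using bounded_linear.bounded[OF matrix_vector_mul_bounded_linear[of Q]] by blast
  have "(Q *v \<xi>) \<bullet> \<xi> \<le> max K 1 * (norm \<xi>)\<^sup>2" for \<xi>
  proof -
    have "(Q *v \<xi>) \<bullet> \<xi> \<le> norm (Q *v \<xi>) * norm \<xi>" by (rule norm_cauchy_schwarz)
    also have "\<dots> \<le> (norm \<xi> * K) * norm \<xi>" by (intro mult_right_mono K) simp
    also have "\<dots> = K * (norm \<xi>)\<^sup>2" by (simp add: power2_eq_square)
    also have "\<dots> \<le> max K 1 * (norm \<xi>)\<^sup>2" by (intro mult_right_mono) auto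
    finally show ?thesis .
  qed
  then show ?thesis by (intro exI[of _ "max K 1"]) auto
qed

lemma powr_poly_bound:
  fixes C s :: real
  assumes "1 \<le> C" "0 < s"
  shows "\<exists>D k. 0 \<le> D \<and> (\<forall>r\<ge>0. (C * r\<^sup>2) powr s \<le> D * (1 + r) ^ k)"
proof -
  obtain k where k: "s \<le> real k" using real_arch_simple by blast
  have "(C * r\<^sup>2) powr s \<le> C ^ k * (1 + r) ^ (2 * k)" if r: "0 \<le> r" for r
  proof -
    \<comment> \<open>A base of at least 1 is what allows the exponent to be raised from
      \<open>s\<close> to an integer.\<close>
    have X: "1 \<le> C * (1 + r)\<^sup>2" using assms r by (simp add: mult_ge1_I)
    have "(C * r\<^sup>2) powr s \<le> (C * (1 + r)\<^sup>2) powr s"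
      using assms r by (intro powr_mono2 mult_left_mono power_mono) auto
    also have "\<dots> \<le> (C * (1 + r)\<^sup>2) powr real k" using X k by (intro powr_mono) auto
    also have "\<dots> = (C * (1 + r)\<^sup>2) ^ k" using X by (intro powr_realpow) linarith
    finally show ?thesis by (simp add: power_mult_distrib power_mult)
  qed
  then show ?thesis using assms by (intro exI[of _ "C ^ k"] exI[of _ "2 * k"]) auto
qed

lemma quad_symbol_bound:
  fixes Q :: "real ^ 'n ^ 'n"
  assumes Q: "pos_semidef Q" and s: "0 < s"
  shows "\<exists>D k. 0 \<le> D \<and> (\<forall>\<xi>. quad_symbol Q s \<xi> \<le> D * (1 + norm \<xi>) ^ k)"
proof -
  obtain C where C: "C \<ge> 1" "\<And>\<xi>. (Q *v \<xi>) \<bullet> \<xi> \<le> C * (norm \<xi>)\<^sup>2" using quad_form_le by blast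
  obtain D k where D: "0 \<le> D" "\<And>r. r \<ge> 0 \<Longrightarrow> (C * r\<^sup>2) powr s \<le> D * (1 + r) ^ k"
    using powr_poly_bound[OF C(1) s] by blast
  have "quad_symbol Q s \<xi> \<le> D * (1 + norm \<xi>) ^ k" for \<xi>
  proof -
    have "quad_symbol Q s \<xi> \<le> (C * (norm \<xi>)\<^sup>2) powr s"
      unfolding quad_symbol_def using Q s C(2) by (intro powr_mono2) (auto simp: pos_semidef_def)
    also have "\<dots> \<le> D * (1 + norm \<xi>) ^ k" by (rule D(2)) simp
    finally show ?thesis .
  qed
  then show ?thesis using D(1) by blast
qed

lemma
  fixes A A' :: "real ^ 'n ^ 'n" and h :: "real ^ 'n \<Rightarrow> 'b::{banach, second_countable_topology}"
  assumes inv: "A ** A' = mat 1" and [measurable]: "h \<in> borel_measurable borel"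
  shows integrable_affine_image: "integrable lborel (\<lambda>y. h (w + A *v y)) \<longleftrightarrow> integrable lborel h"
    and integral_affine_image: "(\<integral>y. h (w + A *v y) \<partial>lborel) = lin_scale A *\<^sub>R (\<integral>x. h x \<partial>lborel)"
  using integrable_linear_image[OF inv, of "\<lambda>x. h (w + x)"] integral_linear_image[OF inv, of "\<lambda>x. h (w + x)"]
    integral_lborel_translate[of h w] by simp_all

lemma transpose_inverse:
  fixes A A' :: "real ^ 'n ^ 'n"
  assumes "A ** A' = mat 1"
  shows "transpose A ** transpose A' = mat 1"
  using assms[unfolded matrix_left_right_inverse[of A A']]
  by (metis matrix_transpose_mul transpose_mat)

text \<open>The frequency drops out of the modulus. The factor \<open>lin_scale A\<close> is the
  reference size for the errors below.\<close>

lemma norm_packet: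
  fixes A A' :: "real ^ 'n ^ 'n"
  assumes inv: "A ** A' = mat 1"
  shows "(norm (abs_L2 (packet A w)))\<^sup>2 = lin_scale A * (\<integral>y. gauss 2 y \<partial>(lborel :: (real ^ 'n) measure))"
proof -
  have "(norm (abs_L2 (packet A w)))\<^sup>2 = (\<integral>x. gauss 2 (A *v x) \<partial>lborel)"
    unfolding norm_abs_L2[OF schwartz_square_integrable[OF packet_schwartz[OF inv]]] cmod_packet gauss_square ..
  also have "\<dots> = lin_scale A * (\<integral>y. gauss 2 y \<partial>(lborel :: (real ^ 'n) measure))"
    by (subst integral_linear_image[OF inv]) auto
  finally show ?thesis .
qed

text \<open>The Fourier multiplier applied to a packet, i.e. the fractional part of the operator without
  its factor \<open>1/2\<close>.\<close>

definition multiplier_packet :: "real ^ 'n ^ 'n \<Rightarrow> real \<Rightarrow> real ^ 'n ^ 'n \<Rightarrow> real ^ 'n \<Rightarrow> real ^ 'n \<Rightarrow> complex" where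
  "multiplier_packet Q s A w = inv_fourier (\<lambda>\<xi>. complex_of_real (quad_symbol Q s \<xi>) * fourier (packet A w) \<xi>)"

text \<open>With \<xi> = w + A^T y the transform of the packet becomes a fixed Gaussian in y, which
  absorbs the polynomially bounded symbol. The (2 pi)^n from the transform cancels against that of
  Plancherel; there remain the square of \<open>lin_scale A\<close>, from the transform, and the
  inverse of \<open>lin_scale (transpose A)\<close>, from the substitution.\<close>

lemma
  fixes A A' Q :: "real ^ 'n ^ 'n"
  assumes inv: "A ** A' = mat 1" and Q: "pos_semidef Q" and s: "0 < s"
  shows integrable_multiplier_packet:
      "integrable lborel (\<lambda>\<xi>. complex_of_real (quad_symbol Q s \<xi>) * fourier (packet A w) \<xi>)"
    and square_integrable_multiplier_packet: "square_integrable (multiplier_packet Q s A w)"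
    and integrable_quad_symbol_gauss: "integrable lborel (\<lambda>y. (quad_symbol Q s (w + transpose A *v y))\<^sup>2 * gauss 2 y)"
    and norm_multiplier_packet: "(norm (abs_L2 (multiplier_packet Q s A w)))\<^sup>2 \<le>
      (lin_scale A)\<^sup>2 / lin_scale (transpose A) * (\<integral>y. (quad_symbol Q s (w + transpose A *v y))\<^sup>2 * gauss 2 y \<partial>lborel)"
proof -
  let ?A = "transpose A"
  let ?m = "quad_symbol Q s"
  define g where "g \<xi> = complex_of_real (?m \<xi>) * fourier (packet A w) \<xi>" for \<xi>
  have inv': "?A ** transpose A' = mat 1" by (rule transpose_inverse[OF inv])
  define L where "L = lin_scale A * sqrt (2 * pi) ^ CARD('n)"
  have L0: "0 \<le> L" using lin_scale_pos[OF inv] by (simp add: L_def)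
  have [measurable]: "packet A w \<in> borel_measurable borel" by (rule schwartz_measurable[OF packet_schwartz[OF inv]])
  have gm [measurable]: "g \<in> borel_measurable borel" unfolding g_def by measurable
  have gy: "g (w + ?A *v y) = complex_of_real (?m (w + ?A *v y) * (L * gauss 1 y))" for y
    unfolding g_def fourier_packet[OF inv] add_diff_cancel_left' matrix_inverse_vector(2)[OF inv'] L_def
    by (simp only: of_real_mult)
  obtain D k where D: "0 \<le> D" "\<And>\<xi>. ?m \<xi> \<le> D * (1 + norm \<xi>) ^ k" using quad_symbol_bound[OF Q s] by blast
  obtain K where K: "K > 0" "\<And>y. norm (?A *v y) \<le> norm y * K"
    using bounded_linear.pos_bounded[OF matrix_vector_mul_bounded_linear[of ?A]] by blast
  define E where "E = D * (1 + norm w + K) ^ k"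
  have E: "0 \<le> E" using D K by (simp add: E_def)
  have my: "?m (w + ?A *v y) \<le> E * (1 + norm y) ^ k" for y
  proof -
    have "1 + norm (w + ?A *v y) \<le> 1 + (norm w + norm y * K)"
      using norm_triangle_ineq[of w "?A *v y"] K(2)[of y] by linarith
    also have "\<dots> \<le> (1 + norm w + K) * (1 + norm y)" using K(1) by (simp add: algebra_simps)
    finally have "D * (1 + norm (w + ?A *v y)) ^ k \<le> D * ((1 + norm w + K) * (1 + norm y)) ^ k"
      using D(1) by (intro mult_left_mono power_mono) auto
    then show ?thesis using D(2)[of "w + ?A *v y"] by (simp add: E_def power_mult_distrib)
  qed
  have "integrable lborel (\<lambda>y. g (w + ?A *v y))"
  proof (rule integrable_poly_gauss[of 1])
    show "norm (g (w + ?A *v y)) \<le> (E * L) * ((1 + norm y) ^ k * gauss 1 y)" for y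
      using mult_right_mono[OF my[of y], of "L * gauss 1 y"] L0 unfolding gy norm_of_real
      by (simp add: abs_mult mult_ac)
  qed (simp, measurable)
  then have gi': "integrable lborel g" using integrable_affine_image[OF inv' gm, of w] by blast
  then show "integrable lborel (\<lambda>\<xi>. complex_of_real (?m \<xi>) * fourier (packet A w) \<xi>)"
    unfolding g_def[abs_def] .
  show mi: "integrable lborel (\<lambda>y. (?m (w + ?A *v y))\<^sup>2 * gauss 2 y)"
  proof (rule integrable_poly_gauss[of 2])
    show "norm ((?m (w + ?A *v y))\<^sup>2 * gauss 2 y) \<le> E\<^sup>2 * ((1 + norm y) ^ (2 * k) * gauss 2 y)" for y
    proof -
      have "(?m (w + ?A *v y))\<^sup>2 \<le> (E * (1 + norm y) ^ k)\<^sup>2" by (intro power_mono my) simp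
      then have "(?m (w + ?A *v y))\<^sup>2 * gauss 2 y \<le> (E * (1 + norm y) ^ k)\<^sup>2 * gauss 2 y" by (intro mult_right_mono) auto
      then show ?thesis by (simp add: power_mult_distrib power_mult[symmetric] mult_ac)
    qed
  qed (simp, measurable)
  have g2: "(cmod (g (w + ?A *v y)))\<^sup>2 = L\<^sup>2 * ((?m (w + ?A *v y))\<^sup>2 * gauss 2 y)" for y
    unfolding gy norm_of_real power2_abs power_mult_distrib gauss_square by (simp only: mult_ac)
  have "integrable lborel (\<lambda>y. (cmod (g (w + ?A *v y)))\<^sup>2)" unfolding g2 by (intro integrable_mult_right mi)
  then have "integrable lborel (\<lambda>\<xi>. (cmod (g \<xi>))\<^sup>2)"
    using integrable_affine_image[OF inv', of "\<lambda>\<xi>. (cmod (g \<xi>))\<^sup>2" w] by simp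
  then have sq: "square_integrable g" using gm by (simp add: square_integrable_def)
  have mp: "multiplier_packet Q s A w = inv_fourier g" by (simp add: multiplier_packet_def g_def[abs_def])
  show sqv: "square_integrable (multiplier_packet Q s A w)"
    unfolding mp by (rule square_integrable_inv_fourier[OF gi' sq])
  have p: "lin_scale ?A > 0" by (rule lin_scale_pos[OF inv'])
  have "(norm (abs_L2 (multiplier_packet Q s A w)))\<^sup>2 \<le> (\<integral>\<xi>. (cmod (g \<xi>))\<^sup>2 \<partial>lborel) / (2 * pi) ^ CARD('n)"
    unfolding norm_abs_L2[OF sqv] unfolding mp by (rule inv_fourier_bound[OF gi' sq])
  also have "(\<integral>\<xi>. (cmod (g \<xi>))\<^sup>2 \<partial>lborel) = (\<integral>y. (cmod (g (w + ?A *v y)))\<^sup>2 \<partial>lborel) / lin_scale ?A"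
    using integral_affine_image[OF inv', of "\<lambda>\<xi>. (cmod (g \<xi>))\<^sup>2" w] p by simp
  also have "(\<integral>y. (cmod (g (w + ?A *v y)))\<^sup>2 \<partial>lborel) = L\<^sup>2 * (\<integral>y. (?m (w + ?A *v y))\<^sup>2 * gauss 2 y \<partial>lborel)"
    unfolding g2 by simp
  also have "L\<^sup>2 = (lin_scale A)\<^sup>2 * (2 * pi) ^ CARD('n)"
    by (simp add: L_def power_mult_distrib flip: power_mult) (simp add: mult.commute[of _ 2] power_mult)
  finally show "(norm (abs_L2 (multiplier_packet Q s A w)))\<^sup>2 \<le>
      (lin_scale A)\<^sup>2 / lin_scale ?A * (\<integral>y. (?m (w + ?A *v y))\<^sup>2 * gauss 2 y \<partial>lborel)"
    by simp
qed

lemma poly_packet_square_integrable: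
  fixes A A' :: "real ^ 'n ^ 'n"
  assumes "A ** A' = mat 1" "P \<in> poly_funs"
  shows "square_integrable (\<lambda>x. P x * packet A w x)"
  by (intro schwartz_square_integrable poly_packet_schwartz[OF assms])

lemma packet_rate_matrix_poly: "(\<lambda>x. packet_rate A w x (B *v x)) \<in> poly_funs"
proof -
  have "(\<lambda>x. complex_of_real ((B *v x) $ i)) \<in> poly_funs" for i
    by (simp add: matrix_vector_mult_def) (intro poly_funs_sum poly_funs.intros)
  then show ?thesis
    unfolding packet_rate_sum[of A w _ "B *v _"]
    by (intro poly_funs_sum poly_funs.mult packet_rate_poly)
qed

text \<open>Puts packets into the maximal domain with an explicit image, as
  \<open>C0_semigroup_duhamel\<close> requires. The fractional part of the image lies in L^2 but
  need not be a Schwartz function.\<close>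

lemma packet_in_OU_operator:
  fixes A A' B Q :: "real ^ 'n ^ 'n"
  assumes inv: "A ** A' = mat 1" and Q: "pos_semidef Q" and s: "0 < s"
  shows "(abs_L2 (packet A w),
      abs_L2 (\<lambda>x. (1/2) * multiplier_packet Q s A w x + packet_rate A w x (B *v x) * packet A w x)) \<in> OU_operator s B Q"
proof -
  let ?u = "packet A w" and ?v = "multiplier_packet Q s A w"
  let ?r = "\<lambda>x. packet_rate A w x (B *v x) * packet A w x"
  have u: "?u \<in> schwartz" by (rule packet_schwartz[OF inv])
  have sqr: "square_integrable ?r" by (intro poly_packet_square_integrable[OF inv] packet_rate_matrix_poly)
  have sqv: "square_integrable ?v" by (rule square_integrable_multiplier_packet[OF inv Q s])
  have sq: "square_integrable (\<lambda>x. (1/2) * ?v x + ?r x)"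
    by (intro square_integrable_add square_integrable_scale sqv sqr)
  have "OU_distr s B Q (abs_L2 ?u) \<phi> = distr_of_L2 (abs_L2 (\<lambda>x. (1/2) * ?v x + ?r x)) \<phi>" if \<phi>: "\<phi> \<in> schwartz" for \<phi>
  proof -
    note sq\<phi> = schwartz_square_integrable[OF \<phi>]
    have "fourier_multiplier (\<lambda>\<xi>. ((Q *v \<xi>) \<bullet> \<xi>) powr s) (abs_L2 ?u) \<phi> = (\<integral>x. ?v x * \<phi> x \<partial>lborel)"
      unfolding multiplier_packet_def quad_symbol_def[symmetric]
      by (rule fourier_multiplier_abs[OF schwartz_integrable[OF u] schwartz_square_integrable[OF u]
            quad_symbol_measurable integrable_multiplier_packet[OF inv Q s] \<phi>])
    then have "OU_distr s B Q (abs_L2 ?u) \<phi> = (\<integral>x. ?v x * \<phi> x \<partial>lborel) / 2 + (\<integral>x. ?r x * \<phi> x \<partial>lborel)"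
      unfolding OU_distr_def packet_drift[OF inv \<phi>] by simp
    also have "\<dots> = (\<integral>x. (1/2) * (?v x * \<phi> x) + ?r x * \<phi> x \<partial>lborel)"
      using square_integrable_mult[OF sqv sq\<phi>] square_integrable_mult[OF sqr sq\<phi>] by simp
    also have "\<dots> = distr_of_L2 (abs_L2 (\<lambda>x. (1/2) * ?v x + ?r x)) \<phi>"
      unfolding distr_of_L2_abs[OF sq \<phi>] by (simp add: algebra_simps)
    finally show ?thesis .
  qed
  then show ?thesis by (simp add: OU_operator_def dist_eq_def)
qed

text \<open>Dominated convergence: by the mean value theorem and the locally uniform majorant
  \<open>G\<close>, the difference quotient minus the derivative is at most 2 |G|.\<close>

lemma has_vector_derivative_L2:
  fixes u u' :: "real \<Rightarrow> real ^ 'n \<Rightarrow> complex"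
  assumes sq: "\<And>r. square_integrable (u r)" "\<And>r. square_integrable (u' r)"
    and der: "\<And>r x. ((\<lambda>r. u r x) has_vector_derivative u' r x) (at r)"
    and dom: "\<And>R. \<exists>G. square_integrable G \<and> (\<forall>r x. \<bar>r\<bar> \<le> R \<longrightarrow> cmod (u' r x) \<le> cmod (G x))"
  shows "((\<lambda>r. abs_L2 (u r)) has_vector_derivative abs_L2 (u' r)) (at r)"
proof -
  \<comment> \<open>The radius |r| + 1 covers all increments of size at most 1.\<close>
  obtain G where G: "square_integrable G" "\<And>\<rho> x. \<bar>\<rho>\<bar> \<le> \<bar>r\<bar> + 1 \<Longrightarrow> cmod (u' \<rho> x) \<le> cmod (G x)"
    using dom by meson
  have G2: "integrable lborel (\<lambda>x. 4 * (cmod (G x))\<^sup>2)" using G(1) by (simp add: square_integrable_def)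
  define d where "d h x = u (r + h) x - u r x - complex_of_real h * u' r x" for h x
  have sqd: "square_integrable (d h)" for h
    unfolding d_def by (intro square_integrable_diff square_integrable_scale sq)
  have absd: "abs_L2 (u (r + h)) - abs_L2 (u r) - h *\<^sub>R abs_L2 (u' r) = abs_L2 (d h)" for h
    unfolding d_def
    by (simp add: abs_L2_diff abs_L2_scaleR square_integrable_diff square_integrable_scale sq)
  have db: "cmod (d h x) \<le> 2 * \<bar>h\<bar> * cmod (G x)" if h: "\<bar>h\<bar> \<le> 1" for h x
  proof -
    have "norm (u (r + h) x - u r x) \<le> cmod (G x) * norm (r + h - r)"
    proof (rule differentiable_bound[of "{r - 1..r + 1}" "\<lambda>r. u r x" "\<lambda>\<rho> t. t *\<^sub>R u' \<rho> x"])
      fix \<rho> assume \<rho>: "\<rho> \<in> {r - 1..r + 1}"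
      show "((\<lambda>r. u r x) has_derivative (\<lambda>t. t *\<^sub>R u' \<rho> x)) (at \<rho> within {r - 1..r + 1})"
        using der[of x \<rho>] unfolding has_vector_derivative_def by (rule has_derivative_at_withinI)
      have "norm (t *\<^sub>R u' \<rho> x) \<le> cmod (G x) * norm t" for t
      proof -
        have "\<bar>\<rho>\<bar> \<le> \<bar>r\<bar> + 1" using \<rho> unfolding atLeastAtMost_iff by linarith
        then show ?thesis
          using mult_left_mono[OF G(2)[of \<rho> x], of "\<bar>t\<bar>"] by (simp add: mult.commute)
      qed
      then show "onorm (\<lambda>t. t *\<^sub>R u' \<rho> x) \<le> cmod (G x)" by (intro onorm_bound) auto
    qed (use h in auto)
    moreover have "cmod (complex_of_real h * u' r x) \<le> \<bar>h\<bar> * cmod (G x)"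
      by (simp add: norm_mult G(2) mult_left_mono)
    ultimately show ?thesis
      using norm_triangle_ineq4[of "u (r + h) x - u r x" "complex_of_real h * u' r x"]
      by (simp add: d_def algebra_simps)
  qed
  have "((\<lambda>h. norm (abs_L2 (d h)) / norm h) \<longlongrightarrow> 0) (at 0)"
    unfolding tendsto_at_iff_sequentially
  proof (intro allI impI)
    fix X :: "nat \<Rightarrow> real" assume X0: "\<forall>i. X i \<in> UNIV - {0}" and X: "X \<longlonglongrightarrow> 0"
    obtain N where N: "\<And>i. i \<ge> N \<Longrightarrow> \<bar>X i\<bar> < 1"
      using LIMSEQ_D[OF X, of 1] by auto
    \<comment> \<open>The shift brings every member of the sequence into [-1, 1], where
      \<open>db\<close> applies.\<close>
    define Y where "Y i = X (i + N)" for i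
    have Y: "Y \<longlonglongrightarrow> 0" unfolding Y_def by (rule LIMSEQ_ignore_initial_segment[OF X])
    have Y0: "Y i \<noteq> 0" and Y1: "\<bar>Y i\<bar> \<le> 1" for i using X0 N[of "i + N"] by (auto simp: Y_def)
    have [measurable]: "d h \<in> borel_measurable borel" for h using sqd by (simp add: square_integrable_def)
    have "(\<lambda>i. \<integral>x. (cmod (d (Y i) x) / \<bar>Y i\<bar>)\<^sup>2 \<partial>lborel) \<longlonglongrightarrow> (\<integral>x. 0 \<partial>(lborel :: (real ^ 'n) measure))"
    proof (rule integral_dominated_convergence[OF _ _ G2])
      show "AE x in lborel. norm ((cmod (d (Y i) x) / \<bar>Y i\<bar>)\<^sup>2) \<le> 4 * (cmod (G x))\<^sup>2" for i
      proof (rule AE_I2)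
        fix x
        have "cmod (d (Y i) x) / \<bar>Y i\<bar> \<le> 2 * cmod (G x)"
          using db[OF Y1[of i], of x] Y0[of i] by (simp add: divide_le_eq mult_ac)
        then have "(cmod (d (Y i) x) / \<bar>Y i\<bar>)\<^sup>2 \<le> (2 * cmod (G x))\<^sup>2" by (intro power_mono) auto
        then show "norm ((cmod (d (Y i) x) / \<bar>Y i\<bar>)\<^sup>2) \<le> 4 * (cmod (G x))\<^sup>2" by (simp add: power_mult_distrib)
      qed
      show "AE x in lborel. (\<lambda>i. (cmod (d (Y i) x) / \<bar>Y i\<bar>)\<^sup>2) \<longlonglongrightarrow> 0"
      proof (rule AE_I2)
        fix x
        have "((\<lambda>h. norm (u (r + h) x - u r x - h *\<^sub>R u' r x) / norm h) \<longlongrightarrow> 0) (at 0)"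
          using der[of x r] unfolding has_vector_derivative_def has_derivative_at by blast
        moreover have "filterlim Y (at 0) sequentially" using Y Y0 by (simp add: filterlim_at)
        ultimately have "(\<lambda>i. norm (u (r + Y i) x - u r x - Y i *\<^sub>R u' r x) / norm (Y i)) \<longlonglongrightarrow> 0"
          by (rule filterlim_compose)
        then have "(\<lambda>i. cmod (d (Y i) x) / \<bar>Y i\<bar>) \<longlonglongrightarrow> 0" by (simp add: d_def scaleR_conv_of_real)
        from tendsto_power[OF this, of 2] show "(\<lambda>i. (cmod (d (Y i) x) / \<bar>Y i\<bar>)\<^sup>2) \<longlonglongrightarrow> 0" by simp
      qed
    qed measurable
    moreover have "(\<integral>x. (cmod (d (Y i) x) / \<bar>Y i\<bar>)\<^sup>2 \<partial>lborel) = (norm (abs_L2 (d (Y i))) / norm (Y i))\<^sup>2" for i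
      by (simp add: power_divide norm_abs_L2[OF sqd])
    ultimately have "(\<lambda>i. (norm (abs_L2 (d (Y i))) / norm (Y i))\<^sup>2) \<longlonglongrightarrow> 0" by simp
    from tendsto_real_sqrt[OF this] have "(\<lambda>i. norm (abs_L2 (d (Y i))) / norm (Y i)) \<longlonglongrightarrow> 0" by simp
    then show "((\<lambda>h. norm (abs_L2 (d h)) / norm h) \<circ> X) \<longlonglongrightarrow> 0"
      unfolding Y_def comp_def by (rule LIMSEQ_offset)
  qed
  then show ?thesis
    unfolding has_vector_derivative_def has_derivative_at absd
    by (simp add: bounded_linear_scaleR_left)
qed

section \<open>Transported wave packets\<close>

text \<open>exp(-r B^T), the motion of frequencies. Its transpose exp(-r B) moves points: the phase
  <eta, exp(-r B) x> is that of the frequency exp(-r B^T) eta.\<close>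

definition flow :: "real ^ 'n ^ 'n \<Rightarrow> real \<Rightarrow> real ^ 'n ^ 'n" where
  "flow B r = mexp (transpose B) (- r)"

lemma flow_0: "flow B 0 = mat 1"
  by (simp add: flow_def mexp_0)

lemma flow_inverse: "flow B r ** flow B (- r) = mat 1"
  using mexp_inverse[of "transpose B" "- r"] by (simp add: flow_def)

lemma norm_matrix_vector_le:
  fixes A :: "real ^ 'n ^ 'm"
  shows "norm (A *v x) \<le> (\<Sum>i\<in>UNIV. \<Sum>j\<in>UNIV. \<bar>A $ i $ j\<bar>) * norm x"
proof -
  have "norm (A *v x) \<le> (\<Sum>i\<in>UNIV. \<bar>(A *v x) $ i\<bar>)" by (rule norm_le_l1_cart)
  also have "\<dots> \<le> (\<Sum>i\<in>UNIV. \<Sum>j\<in>UNIV. \<bar>A $ i $ j\<bar> * norm x)"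
  proof (rule sum_mono)
    fix i
    have "\<bar>(A *v x) $ i\<bar> \<le> (\<Sum>j\<in>UNIV. \<bar>A $ i $ j * x $ j\<bar>)"
      unfolding matrix_vector_mult_def by simp
    also have "\<dots> \<le> (\<Sum>j\<in>UNIV. \<bar>A $ i $ j\<bar> * norm x)"
      unfolding abs_mult by (intro sum_mono mult_left_mono component_le_norm_cart) simp
    finally show "\<bar>(A *v x) $ i\<bar> \<le> (\<Sum>j\<in>UNIV. \<bar>A $ i $ j\<bar> * norm x)" .
  qed
  finally show ?thesis by (simp add: sum_distrib_right)
qed

text \<open>The interval is symmetric, so inverses are covered too: the inverse of
  \<open>flow B r\<close> is \<open>flow B (- r)\<close>.\<close>

lemma flow_bounded:
  fixes B :: "real ^ 'n ^ 'n"
  shows "\<exists>K\<ge>1. \<forall>r x. \<bar>r\<bar> \<le> R \<longrightarrow> norm (flow B r *v x) \<le> K * norm x \<and> norm (transpose (flow B r) *v x) \<le> K * norm x"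
proof -
  have "\<exists>b. \<forall>r. \<bar>r\<bar> \<le> R \<longrightarrow> \<bar>flow B r $ i $ j\<bar> \<le> b" for i j
  proof -
    have "continuous_on {-R..R} (\<lambda>t. mexp (transpose B) t $ i $ j)"
      by (intro continuous_at_imp_continuous_on ballI DERIV_isCont[OF mexp_has_derivative])
    then have "bounded ((\<lambda>t. mexp (transpose B) t $ i $ j) ` {-R..R})"
      by (intro compact_imp_bounded compact_continuous_image) auto
    then obtain b where b: "\<forall>y\<in>(\<lambda>t. mexp (transpose B) t $ i $ j) ` {-R..R}. norm y \<le> b"
      unfolding bounded_iff by blast
    have "\<bar>flow B r $ i $ j\<bar> \<le> b" if "\<bar>r\<bar> \<le> R" for r
    proof -
      have "- r \<in> {-R..R}" using that by auto
      from bspec[OF b imageI[OF this]] show ?thesis by (simp add: flow_def)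
    qed
    then show ?thesis by blast
  qed
  then obtain b where b: "\<And>i j r. \<bar>r\<bar> \<le> R \<Longrightarrow> \<bar>flow B r $ i $ j\<bar> \<le> b i j" by metis
  define K where "K = max 1 (\<Sum>i\<in>UNIV. \<Sum>j\<in>UNIV. b i j)"
  have "norm (flow B r *v x) \<le> K * norm x \<and> norm (transpose (flow B r) *v x) \<le> K * norm x" if r: "\<bar>r\<bar> \<le> R" for r x
  proof -
    have 1: "(\<Sum>i\<in>UNIV. \<Sum>j\<in>UNIV. \<bar>flow B r $ i $ j\<bar>) \<le> K"
      unfolding K_def by (rule max.coboundedI2) (intro sum_mono b r)
    have 2: "(\<Sum>i\<in>UNIV. \<Sum>j\<in>UNIV. \<bar>transpose (flow B r) $ i $ j\<bar>) = (\<Sum>i\<in>UNIV. \<Sum>j\<in>UNIV. \<bar>flow B r $ i $ j\<bar>)"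
      unfolding transpose_def by (subst sum.swap) simp
    have "norm (flow B r *v x) \<le> K * norm x"
      by (rule order_trans[OF norm_matrix_vector_le]) (intro mult_right_mono 1 norm_ge_zero)
    moreover have "norm (transpose (flow B r) *v x) \<le> K * norm x"
      by (rule order_trans[OF norm_matrix_vector_le]) (unfold 2, intro mult_right_mono 1 norm_ge_zero)
    ultimately show ?thesis by blast
  qed
  moreover have "1 \<le> K" by (simp add: K_def)
  ultimately show ?thesis by blast
qed

lemma flow_transpose_derivative:
  fixes B :: "real ^ 'n ^ 'n"
  shows "((\<lambda>r. transpose (flow B r) *v x) has_vector_derivative - (transpose (flow B r) *v (B *v x))) (at r)"
proof -
  have "((\<lambda>r. (transpose (flow B r) *v x) $ i) has_real_derivative - (transpose (flow B r) *v (B *v x)) $ i) (at r)" for i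
  proof -
    have 1: "((\<lambda>r. flow B r $ j $ i) has_real_derivative - (transpose B ** flow B r) $ j $ i) (at r)" for j
      unfolding flow_def
      using DERIV_chain2[OF mexp_has_derivative[of "transpose B" j i "- r"] DERIV_minus[OF DERIV_ident]] by simp
    have "((\<lambda>r. \<Sum>j\<in>UNIV. flow B r $ j $ i * x $ j) has_real_derivative
        (\<Sum>j\<in>UNIV. - (transpose B ** flow B r) $ j $ i * x $ j)) (at r)"
      by (intro DERIV_sum DERIV_cmult_right 1)
    moreover have "(transpose (flow B r) *v (B *v x)) = transpose (transpose B ** flow B r) *v x"
      by (simp only: matrix_transpose_mul transpose_transpose matrix_vector_mul_assoc)
    ultimately show ?thesis
      by (simp only:) (simp add: matrix_vector_mult_def transpose_def sum_negf)
  qed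
  then show ?thesis
    unfolding has_vector_derivative_def has_derivative_componentwise_within[of "\<lambda>r. transpose (flow B r) *v x"]
    by (auto simp: Basis_vec_def inner_axis has_real_derivative_iff_has_vector_derivative
        has_vector_derivative_def simp del: transpose_matrix_vector)
qed

lemma scaleR_matrix_mult:
  fixes A C :: "real ^ 'n ^ 'n"
  shows "(a *\<^sub>R A) ** (b *\<^sub>R C) = (a * b) *\<^sub>R (A ** C)"
  by (simp add: vec_eq_iff matrix_matrix_mult_def sum_distrib_left mult_ac)

lemma scaleR_matrix_vector:
  fixes A :: "real ^ 'n ^ 'n"
  shows "(a *\<^sub>R A) *v x = a *\<^sub>R (A *v x)"
  by (simp add: scaleR_matrix_vector_assoc)

lemma flow_packet_inverse:
  assumes "e \<noteq> 0"
  shows "(e *\<^sub>R transpose (flow B r)) ** ((1 / e) *\<^sub>R transpose (flow B (- r))) = mat 1"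
  unfolding scaleR_matrix_mult transpose_inverse[OF flow_inverse] using assms by simp

text \<open>The round packet of frequency \<eta> and width 1/e, composed with exp(-r B).\<close>

definition wave :: "real ^ 'n ^ 'n \<Rightarrow> real ^ 'n \<Rightarrow> real \<Rightarrow> real \<Rightarrow> real ^ 'n \<Rightarrow> complex" where
  "wave B \<eta> e r = packet (e *\<^sub>R transpose (flow B r)) (flow B r *v \<eta>)"

text \<open>The first-order part <Bx, grad> of the operator, applied to the wave.\<close>

definition wave_drift :: "real ^ 'n ^ 'n \<Rightarrow> real ^ 'n \<Rightarrow> real \<Rightarrow> real \<Rightarrow> real ^ 'n \<Rightarrow> complex" where
  "wave_drift B \<eta> e r x = packet_rate (e *\<^sub>R transpose (flow B r)) (flow B r *v \<eta>) x (B *v x) * wave B \<eta> e r x"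

lemma square_integrable_wave: "e \<noteq> 0 \<Longrightarrow> square_integrable (wave B \<eta> e r)"
  unfolding wave_def by (intro schwartz_square_integrable packet_schwartz[OF flow_packet_inverse])

lemma square_integrable_wave_drift: "e \<noteq> 0 \<Longrightarrow> square_integrable (wave_drift B \<eta> e r)"
  unfolding wave_drift_def wave_def
  by (intro poly_packet_square_integrable[OF flow_packet_inverse] packet_rate_matrix_poly)

text \<open>The wave solves the transport equation exactly: all time dependence sits in the point at
  which one fixed packet is evaluated, so the chain rule applies.\<close>

lemma wave_derivative:
  fixes B :: "real ^ 'n ^ 'n"
  shows "((\<lambda>r. wave B \<eta> e r x) has_vector_derivative - wave_drift B \<eta> e r x) (at r)"
proof -
  let ?A = "e *\<^sub>R (mat 1 :: real ^ 'n ^ 'n)"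
  have dot: "(flow B r *v \<eta>) \<bullet> v = \<eta> \<bullet> (transpose (flow B r) *v v)" for r v
    by (metis dot_lmul_matrix inner_commute transpose_matrix_vector)
  have A: "?A *v (transpose (flow B r) *v v) = (e *\<^sub>R transpose (flow B r)) *v v" for r v
    by (simp only: scaleR_matrix_vector matrix_vector_mul_lid)
  have w: "wave B \<eta> e r x = packet ?A \<eta> (transpose (flow B r) *v x)" for r
    by (simp only: wave_def packet_def dot A)
  have rate: "packet_rate ?A \<eta> (transpose (flow B r) *v x) (transpose (flow B r) *v v) =
      packet_rate (e *\<^sub>R transpose (flow B r)) (flow B r *v \<eta>) x v" for v
    by (simp only: packet_rate_def dot A)
  let ?y = "transpose (flow B r) *v x" and ?z = "transpose (flow B r) *v (B *v x)"
  have "((\<lambda>r. packet ?A \<eta> (transpose (flow B r) *v x)) has_derivative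
      (\<lambda>h. packet_rate ?A \<eta> ?y (h *\<^sub>R (- ?z)) * packet ?A \<eta> ?y)) (at r)"
    by (rule has_derivative_compose[OF flow_transpose_derivative[unfolded has_vector_derivative_def] packet_has_derivative])
  moreover have "packet_rate ?A \<eta> ?y (h *\<^sub>R (- ?z)) * packet ?A \<eta> ?y = h *\<^sub>R (- wave_drift B \<eta> e r x)" for h
    unfolding wave_drift_def w[symmetric] rate[symmetric]
      linear_scale[OF packet_rate_linear] linear_neg[OF packet_rate_linear] by simp
  ultimately show ?thesis unfolding has_vector_derivative_def w by simp
qed

lemma square_integrable_poly_gauss:
  assumes "0 < a"
  shows "square_integrable (\<lambda>x :: real ^ 'n. complex_of_real (C * ((1 + norm x) ^ k * gauss a x)))"
proof -
  have "integrable lborel (\<lambda>x :: real ^ 'n. (C * ((1 + norm x) ^ k * gauss a x))\<^sup>2)"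
  proof (rule integrable_poly_gauss[of "2 * a"])
    show "norm ((C * ((1 + norm x) ^ k * gauss a x))\<^sup>2) \<le> C\<^sup>2 * ((1 + norm x) ^ (2 * k) * gauss (2 * a) x)" for x :: "real ^ 'n"
      using gauss_mult[of a x a]
      by (simp add: power_mult_distrib power_mult[symmetric] mult.commute[of k] power2_eq_square[of "gauss a x"])
  qed (use assms in \<open>simp, measurable\<close>)
  then show ?thesis unfolding square_integrable_def norm_of_real power2_abs by simp
qed

text \<open>The majorant asked for by \<open>has_vector_derivative_L2\<close>: the rate grows at
  most quadratically in x, and the Gaussians have a common decay because the flow and its inverse
  are bounded on [-R, R].\<close>

lemma wave_drift_dominated:
  fixes B :: "real ^ 'n ^ 'n"
  assumes e: "0 < e"
  shows "\<exists>G. square_integrable G \<and> (\<forall>r x. \<bar>r\<bar> \<le> R \<longrightarrow> cmod (wave_drift B \<eta> e r x) \<le> cmod (G x))"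
proof -
  obtain K where K: "K \<ge> 1" "\<And>r x. \<bar>r\<bar> \<le> R \<Longrightarrow> norm (flow B r *v x) \<le> K * norm x"
    "\<And>r x. \<bar>r\<bar> \<le> R \<Longrightarrow> norm (transpose (flow B r) *v x) \<le> K * norm x"
    using flow_bounded[of R B] by blast
  obtain b where b: "b > 0" "\<And>x. norm (B *v x) \<le> norm x * b"
    using bounded_linear.pos_bounded[OF matrix_vector_mul_bounded_linear[of B]] by blast
  \<comment> \<open>\<open>K / e\<close> bounds the norm of the inverse of the shape matrix.\<close>
  define a where "a = 1 / (K / e)\<^sup>2"
  have a: "0 < a" using K e by (simp add: a_def)
  \<comment> \<open>The two summands bound the phase part and the Gaussian part of the rate along B
    x.\<close>
  define C where "C = K * norm \<eta> * b + (e * K) * (e * (K * b))"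
  have C: "0 \<le> C" using K b e by (simp add: C_def)
  define G where "G x = complex_of_real (C * ((1 + norm x) ^ 2 * gauss a x))" for x :: "real ^ 'n"
  have "cmod (wave_drift B \<eta> e r x) \<le> cmod (G x)" if r: "\<bar>r\<bar> \<le> R" for r x
  proof -
    let ?A = "e *\<^sub>R transpose (flow B r)"
    have Av: "norm (?A *v v) \<le> e * (K * norm v)" for v
      unfolding scaleR_matrix_vector using K(3)[OF r, of v] e by simp
    have xA: "norm y \<le> K / e * norm (?A *v y)" for y
    proof -
      have "norm y = norm (transpose (flow B (- r)) *v (transpose (flow B r) *v y))"
        using matrix_inverse_vector(2)[OF transpose_inverse[OF flow_inverse[of B r]], of y] by (simp only:)
      also have "\<dots> \<le> K * norm (transpose (flow B r) *v y)" using r by (intro K(3)) simp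
      finally show ?thesis unfolding scaleR_matrix_vector using e by simp
    qed
    have "cmod (packet_rate ?A (flow B r *v \<eta>) x (B *v x)) \<le>
        \<bar>(flow B r *v \<eta>) \<bullet> (B *v x)\<bar> + \<bar>(?A *v x) \<bullet> (?A *v (B *v x))\<bar>"
      unfolding packet_rate_def by (rule order_trans[OF norm_triangle_ineq4]) (simp add: norm_mult)
    also have "\<dots> \<le> norm (flow B r *v \<eta>) * norm (B *v x) + norm (?A *v x) * norm (?A *v (B *v x))"
      by (intro add_mono Cauchy_Schwarz_ineq2)
    also have "\<dots> \<le> (K * norm \<eta>) * (norm x * b) + (e * (K * norm x)) * (e * (K * (norm x * b)))"
    proof (intro add_mono mult_mono K(2)[OF r] b(2) Av)
      have "e * (K * norm (B *v x)) \<le> e * (K * (norm x * b))"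
        using e K(1) b(2)[of x] by (intro mult_left_mono) auto
      then show "norm (?A *v (B *v x)) \<le> e * (K * (norm x * b))" using Av[of "B *v x"] by linarith
    qed (use K(1) e in auto)
    also have "\<dots> = K * norm \<eta> * b * norm x + (e * K) * (e * (K * b)) * (norm x)\<^sup>2"
      by (simp add: power2_eq_square)
    also have "\<dots> \<le> K * norm \<eta> * b * (1 + norm x)\<^sup>2 + (e * K) * (e * (K * b)) * (1 + norm x)\<^sup>2"
      using K(1) b(1) e by (intro add_mono mult_left_mono) (auto simp: power2_eq_square algebra_simps)
    finally have rate: "cmod (packet_rate ?A (flow B r *v \<eta>) x (B *v x)) \<le> C * (1 + norm x)\<^sup>2"
      by (simp add: C_def algebra_simps)
    have "cmod (wave B \<eta> e r x) \<le> gauss a x"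
      unfolding wave_def cmod_packet a_def using K(1) e by (intro gauss_matrix_le xA) auto
    then have "cmod (wave_drift B \<eta> e r x) \<le> (C * (1 + norm x)\<^sup>2) * gauss a x"
      unfolding wave_drift_def norm_mult using rate C by (intro mult_mono) auto
    then have "cmod (wave_drift B \<eta> e r x) \<le> C * ((1 + norm x)\<^sup>2 * gauss a x)" by (simp only: mult.assoc)
    then show ?thesis unfolding G_def norm_of_real by (rule order_trans[OF _ abs_ge_self])
  qed
  moreover have "square_integrable G" unfolding G_def by (rule square_integrable_poly_gauss[OF a])
  ultimately show ?thesis by blast
qed

lemma wave_L2_derivative:
  fixes B :: "real ^ 'n ^ 'n"
  assumes e: "0 < e"
  shows "((\<lambda>r. abs_L2 (wave B \<eta> e r)) has_vector_derivative abs_L2 (\<lambda>x. - wave_drift B \<eta> e r x)) (at r)"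
proof (rule has_vector_derivative_L2)
  show "square_integrable (wave B \<eta> e r)" for r using e by (intro square_integrable_wave) simp
  show "square_integrable (\<lambda>x. - wave_drift B \<eta> e r x)" for r
    using square_integrable_scale[OF square_integrable_wave_drift[of e B \<eta> r], of "-1"] e by simp
  show "((\<lambda>r. wave B \<eta> e r x) has_vector_derivative - wave_drift B \<eta> e r x) (at r)" for r x by (rule wave_derivative)
  show "\<exists>G. square_integrable G \<and> (\<forall>r x. \<bar>r\<bar> \<le> R \<longrightarrow> cmod (- wave_drift B \<eta> e r x) \<le> cmod (G x))" for R
    using wave_drift_dominated[OF e, of R B \<eta>] by simp
qed

section \<open>The theorem\<close>

lemma transpose_scaleR: "transpose (e *\<^sub>R A) = e *\<^sub>R transpose (A :: real ^ 'n ^ 'm)"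
  by (simp add: vec_eq_iff transpose_def)

lemma lin_scale_scaleR:
  fixes X X' :: "real ^ 'n ^ 'n"
  assumes inv: "X ** X' = mat 1" and e: "e \<noteq> 0"
  shows "lin_scale (e *\<^sub>R X) = lin_scale (e *\<^sub>R (mat 1 :: real ^ 'n ^ 'n)) * lin_scale X"
proof -
  have "(e *\<^sub>R (mat 1 :: real ^ 'n ^ 'n)) ** ((1 / e) *\<^sub>R mat 1) = mat 1"
    using e by (simp add: scaleR_matrix_mult)
  from lin_scale_mult[OF this inv] show ?thesis
    using scaleR_matrix_mult[of e "mat 1" 1 X] by simp
qed

lemma flow_kalman:
  assumes "\<eta> \<in> kalman_space B Q"
  shows "flow B r *v \<eta> \<in> kalman_space B Q"
  unfolding flow_def
  by (intro mexp_mem_closed_subspace subspace_kalman_space kalman_space_invariant assms)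

text \<open>The cross terms vanish by symmetry. This is the one place where membership of the
  frequency in S makes the damping small.\<close>

lemma quad_form_shift:
  fixes Q :: "real ^ 'n ^ 'n"
  assumes Q: "pos_semidef Q" and w: "Q *v w = 0"
  shows "(Q *v (w + z)) \<bullet> (w + z) = (Q *v z) \<bullet> z"
proof -
  have "(Q *v z) \<bullet> w = z \<bullet> (Q *v w)" using Q by (intro symmetric_matrix_inner) (simp add: pos_semidef_def)
  then show ?thesis by (simp add: matrix_vector_right_distrib w inner_add_right)
qed

text \<open>\<open>C\<close> is independent of e and r. The squared norm of the wave carries the
  same factor \<open>lin_scale (e *\<^sub>R mat 1)\<close>, by \<open>norm_packet\<close> and
  \<open>lin_scale_scaleR\<close>, so relative to the wave the multiplier has size e^(2s).\<close>

lemma wave_multiplier_bound: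
  fixes B Q :: "real ^ 'n ^ 'n"
  assumes Q: "pos_semidef Q" and s: "0 < s" and \<eta>: "\<eta> \<in> kalman_space B Q"
  shows "\<exists>C\<ge>0. \<forall>e r. 0 < e \<longrightarrow> \<bar>r\<bar> \<le> R \<longrightarrow>
    (norm (abs_L2 (multiplier_packet Q s (e *\<^sub>R transpose (flow B r)) (flow B r *v \<eta>))))\<^sup>2 \<le>
      C * (e\<^sup>2 powr s)\<^sup>2 * lin_scale (e *\<^sub>R (mat 1 :: real ^ 'n ^ 'n))"
proof -
  obtain K where K: "K \<ge> 1" "\<And>r x. \<bar>r\<bar> \<le> R \<Longrightarrow> norm (flow B r *v x) \<le> K * norm x"
    "\<And>r x. \<bar>r\<bar> \<le> R \<Longrightarrow> norm (transpose (flow B r) *v x) \<le> K * norm x"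
    using flow_bounded[of R B] by blast
  obtain C where C: "C \<ge> 1" "\<And>\<xi>. (Q *v \<xi>) \<bullet> \<xi> \<le> C * (norm \<xi>)\<^sup>2" using quad_form_le by blast
  define c where "c = measure lborel (ball (0 :: real ^ 'n) K) / measure lborel (ball (0 :: real ^ 'n) 1)"
  have c0: "0 \<le> c" by (simp add: c_def)
  have DK: "1 \<le> C * K\<^sup>2" using C(1) K(1) by (simp add: mult_ge1_I)
  define p where "p y = ((C * K\<^sup>2) * (norm y)\<^sup>2) powr s" for y :: "real ^ 'n"
  obtain D k where D: "0 \<le> D" "\<And>r. r \<ge> 0 \<Longrightarrow> ((C * K\<^sup>2) * r\<^sup>2) powr s \<le> D * (1 + r) ^ k"
    using powr_poly_bound[OF DK s] by blast
  have [measurable]: "p \<in> borel_measurable borel" unfolding p_def by measurable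
  have pint: "integrable lborel (\<lambda>y. (p y)\<^sup>2 * gauss 2 y)"
  proof (rule integrable_poly_gauss[of 2])
    show "norm ((p y)\<^sup>2 * gauss 2 y) \<le> D\<^sup>2 * ((1 + norm y) ^ (2 * k) * gauss 2 y)" for y
    proof -
      have "(p y)\<^sup>2 \<le> (D * (1 + norm y) ^ k)\<^sup>2" unfolding p_def by (intro power_mono D(2)) auto
      then have "(p y)\<^sup>2 * gauss 2 y \<le> (D * (1 + norm y) ^ k)\<^sup>2 * gauss 2 y" by (intro mult_right_mono) auto
      then show ?thesis by (simp add: power_mult_distrib power_mult[symmetric] mult_ac)
    qed
  qed (simp, measurable)
  define W where "W = (\<integral>y. (p y)\<^sup>2 * gauss 2 y \<partial>lborel)"
  have W: "0 \<le> W" unfolding W_def by (intro Bochner_Integration.integral_nonneg) simp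
  have "(norm (abs_L2 (multiplier_packet Q s (e *\<^sub>R transpose (flow B r)) (flow B r *v \<eta>))))\<^sup>2 \<le>
      (c\<^sup>2 * c * W) * (e\<^sup>2 powr s)\<^sup>2 * lin_scale (e *\<^sub>R (mat 1 :: real ^ 'n ^ 'n))"
    if e: "0 < e" and r: "\<bar>r\<bar> \<le> R" for e r
  proof -
    let ?N = "flow B r" and ?w = "flow B r *v \<eta>"
    let ?A = "e *\<^sub>R transpose ?N"
    define \<sigma> where "\<sigma> = lin_scale (e *\<^sub>R (mat 1 :: real ^ 'n ^ 'n))"
    have r': "\<bar>- r\<bar> \<le> R" using r by simp
    have inv: "?A ** ((1 / e) *\<^sub>R transpose (flow B (- r))) = mat 1" using e by (intro flow_packet_inverse) simp
    have invT: "transpose ?N ** transpose (flow B (- r)) = mat 1" by (rule transpose_inverse[OF flow_inverse])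
    have tA: "transpose ?A = e *\<^sub>R ?N" by (simp add: transpose_scaleR)
    have \<sigma>: "0 < \<sigma>" unfolding \<sigma>_def
      using e by (intro lin_scale_pos[of _ "(1 / e) *\<^sub>R mat 1"]) (simp add: scaleR_matrix_mult)
    define \<kappa> where "\<kappa> = lin_scale (transpose ?N)"
    have \<kappa>: "0 < \<kappa>" "\<kappa> \<le> c" unfolding \<kappa>_def c_def
      by (rule lin_scale_pos[OF invT]) (rule lin_scale_le[OF invT K(3)[OF r']], use K(1) in simp)
    have inv2: "flow B (- r) ** ?N = mat 1" using flow_inverse[of B "- r"] by simp
    \<comment> \<open>\<open>\<mu>\<close> stands for the reciprocal of \<open>lin_scale ?N\<close>,
      so that the denominator in \<open>ratio\<close> is controlled by an upper bound as
      well.\<close>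
    define \<mu> where "\<mu> = lin_scale (flow B (- r))"
    have \<mu>: "0 < \<mu>" "\<mu> \<le> c" unfolding \<mu>_def c_def
      by (rule lin_scale_pos[OF inv2]) (rule lin_scale_le[OF inv2 K(2)[OF r]], use K(1) in simp)
    have N\<mu>: "lin_scale ?N * \<mu> = 1" unfolding \<mu>_def by (rule lin_scale_inverse[OF flow_inverse])
    then have "lin_scale ?N = 1 / \<mu>" using \<mu>(1) by (simp add: field_simps)
    \<comment> \<open>This is (\<sigma> \<kappa>)^2 / (\<sigma> / \<mu>): one power of \<sigma>
      remains, and the other factors are at most c^3.\<close>
    then have ratio: "(lin_scale ?A)\<^sup>2 / lin_scale (transpose ?A) = \<kappa>\<^sup>2 * \<mu> * \<sigma>"
      using lin_scale_scaleR[OF invT, of e] lin_scale_scaleR[OF flow_inverse, of e B r] e \<sigma> \<mu>(1)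
      unfolding tA \<kappa>_def \<sigma>_def by (simp add: power2_eq_square)
    have Qw: "Q *v ?w = 0" by (rule kalman_space_kernel[OF Q flow_kalman[OF \<eta>]])
    \<comment> \<open>The deviation from \<open>?w\<close> has length at most e K |y|, and the power
      \<open>s\<close> splits off the factor e^2.\<close>
    have symb: "(quad_symbol Q s (?w + transpose ?A *v y))\<^sup>2 \<le> (e\<^sup>2 powr s)\<^sup>2 * (p y)\<^sup>2" for y
    proof -
      have "(Q *v (?w + transpose ?A *v y)) \<bullet> (?w + transpose ?A *v y) = (Q *v (transpose ?A *v y)) \<bullet> (transpose ?A *v y)"
        by (rule quad_form_shift[OF Q Qw])
      also have "\<dots> \<le> C * (norm (transpose ?A *v y))\<^sup>2" by (rule C(2))
      also have "\<dots> \<le> C * (e * (K * norm y))\<^sup>2"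
        unfolding tA scaleR_matrix_vector norm_scaleR using e C(1) K(2)[OF r, of y]
        by (intro mult_left_mono power_mono) auto
      also have "\<dots> = e\<^sup>2 * ((C * K\<^sup>2) * (norm y)\<^sup>2)" by (simp add: power_mult_distrib)
      finally have "quad_symbol Q s (?w + transpose ?A *v y) \<le> (e\<^sup>2 * ((C * K\<^sup>2) * (norm y)\<^sup>2)) powr s"
        unfolding quad_symbol_def using Q s by (intro powr_mono2) (auto simp: pos_semidef_def)
      also have "\<dots> = e\<^sup>2 powr s * p y"
        unfolding p_def by (rule powr_mult)
      finally show ?thesis unfolding power_mult_distrib[symmetric] by (intro power_mono) auto
    qed
    have "(\<integral>y. (quad_symbol Q s (?w + transpose ?A *v y))\<^sup>2 * gauss 2 y \<partial>lborel) \<le>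
        (\<integral>y. (e\<^sup>2 powr s)\<^sup>2 * ((p y)\<^sup>2 * gauss 2 y) \<partial>lborel)"
    proof (rule integral_mono)
      show "(quad_symbol Q s (?w + transpose ?A *v y))\<^sup>2 * gauss 2 y \<le> (e\<^sup>2 powr s)\<^sup>2 * ((p y)\<^sup>2 * gauss 2 y)" for y
        using mult_right_mono[OF symb[of y], of "gauss 2 y"] by (simp add: mult.assoc)
    qed (intro integrable_quad_symbol_gauss[OF inv Q s] integrable_mult_right pint)+
    also have "\<dots> = (e\<^sup>2 powr s)\<^sup>2 * W" by (simp add: W_def)
    finally have I: "(\<integral>y. (quad_symbol Q s (?w + transpose ?A *v y))\<^sup>2 * gauss 2 y \<partial>lborel) \<le> (e\<^sup>2 powr s)\<^sup>2 * W" .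
    have "(norm (abs_L2 (multiplier_packet Q s ?A ?w)))\<^sup>2 \<le> (lin_scale ?A)\<^sup>2 / lin_scale (transpose ?A) *
        (\<integral>y. (quad_symbol Q s (?w + transpose ?A *v y))\<^sup>2 * gauss 2 y \<partial>lborel)"
      by (rule norm_multiplier_packet[OF inv Q s])
    also have "\<dots> \<le> (c\<^sup>2 * c * \<sigma>) * ((e\<^sup>2 powr s)\<^sup>2 * W)"
      unfolding ratio using \<kappa> \<mu> \<sigma> c0 I by (intro mult_mono power_mono) auto
    finally show ?thesis by (simp add: \<sigma>_def mult_ac)
  qed
  moreover have "0 \<le> c\<^sup>2 * c * W" using c0 W by simp
  ultimately show ?thesis by blast
qed

text \<open>The drift cancels the time derivative of the wave, so the residual fed into Duhamel's
  estimate is half the multiplier.\<close>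

lemma wave_transport_error:
  fixes B Q :: "real ^ 'n ^ 'n"
  assumes Q: "pos_semidef Q" and s: "0 < s" and \<eta>: "\<eta> \<in> kalman_space B Q"
    and OU: "OU_semigroup s B Q T" and a: "0 \<le> a"
  shows "\<exists>C\<ge>0. \<forall>e>0. norm (T a (abs_L2 (wave B \<eta> e 0)) - abs_L2 (wave B \<eta> e a)) \<le>
    C * (e\<^sup>2 powr s) * sqrt (lin_scale (e *\<^sub>R (mat 1 :: real ^ 'n ^ 'n)))"
proof -
  have C0: "C0_semigroup T" and gen: "generator T = {(u, - f) | u f. (u, f) \<in> OU_operator s B Q}"
    using OU by (auto simp: OU_semigroup_def)
  obtain M' where M': "\<And>t u. t \<in> {0..a} \<Longrightarrow> norm (T t u) \<le> M' * norm u"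
    using C0_semigroup_locally_bounded[OF C0, of a] by blast
  define M where "M = max M' 0"
  have M: "0 \<le> M" "norm (T t u) \<le> M * norm u" if "t \<in> {0..a}" for t u
    using M'[OF that, of u] mult_right_mono[of M' M "norm u"] by (auto simp: M_def)
  have M0: "0 \<le> M" by (simp add: M_def)
  obtain C where C: "C \<ge> 0" "\<And>e r. 0 < e \<Longrightarrow> \<bar>r\<bar> \<le> a \<Longrightarrow>
    (norm (abs_L2 (multiplier_packet Q s (e *\<^sub>R transpose (flow B r)) (flow B r *v \<eta>))))\<^sup>2 \<le>
      C * (e\<^sup>2 powr s)\<^sup>2 * lin_scale (e *\<^sub>R (mat 1 :: real ^ 'n ^ 'n))"
    using wave_multiplier_bound[OF Q s \<eta>, of a] by blast
  have "norm (T a (abs_L2 (wave B \<eta> e 0)) - abs_L2 (wave B \<eta> e a)) \<le>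
      (M * (1/2 * sqrt C) * a) * (e\<^sup>2 powr s) * sqrt (lin_scale (e *\<^sub>R (mat 1 :: real ^ 'n ^ 'n)))" if e: "0 < e" for e
  proof -
    define \<sigma> where "\<sigma> = lin_scale (e *\<^sub>R (mat 1 :: real ^ 'n ^ 'n))"
    let ?v = "\<lambda>r. multiplier_packet Q s (e *\<^sub>R transpose (flow B r)) (flow B r *v \<eta>)"
    let ?d = "wave_drift B \<eta> e"
    let ?g = "\<lambda>r. - abs_L2 (\<lambda>x. (1/2) * ?v r x + ?d r x)"
    have inv: "(e *\<^sub>R transpose (flow B r)) ** ((1 / e) *\<^sub>R transpose (flow B (- r))) = mat 1" for r
      using e by (intro flow_packet_inverse) simp
    have sqv: "square_integrable (?v r)" for r by (rule square_integrable_multiplier_packet[OF inv Q s])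
    have sqd: "square_integrable (?d r)" for r using e by (intro square_integrable_wave_drift) simp
    have sqd': "square_integrable (\<lambda>x. - ?d r x)" for r using square_integrable_scale[OF sqd, of "-1"] by simp
    have sqh: "square_integrable (\<lambda>x. (1/2) * ?v r x)" for r by (rule square_integrable_scale[OF sqv])
    have sqg: "square_integrable (\<lambda>x. (1/2) * ?v r x + ?d r x)" for r
      by (intro square_integrable_add sqh sqd)
    have "norm (T a (abs_L2 (wave B \<eta> e 0)) - abs_L2 (wave B \<eta> e a)) \<le>
        M * (1/2 * (sqrt C * (e\<^sup>2 powr s) * sqrt \<sigma>)) * a"
    proof (rule C0_semigroup_duhamel[OF C0 a M0, where g = ?g and u = "\<lambda>r. abs_L2 (wave B \<eta> e r)"
          and u' = "\<lambda>r. abs_L2 (\<lambda>x. - ?d r x)"])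
      show "norm (T t u) \<le> M * norm u" if "t \<in> {0..a}" for t u by (rule M(2)[OF that])
      show "(abs_L2 (wave B \<eta> e r), ?g r) \<in> generator T" for r
        using packet_in_OU_operator[OF inv[of r] Q s, of "flow B r *v \<eta>" B]
        unfolding gen wave_drift_def wave_def by blast
      show "((\<lambda>r. abs_L2 (wave B \<eta> e r)) has_vector_derivative abs_L2 (\<lambda>x. - ?d r x)) (at r)" for r
        by (rule wave_L2_derivative[OF e])
      fix r assume r: "r \<in> {0..a}"
      have "abs_L2 (\<lambda>x. - ?d r x) - ?g r = abs_L2 (\<lambda>x. (1/2) * ?v r x)"
        unfolding diff_minus_eq_add abs_L2_add[OF sqd' sqg] by (simp add: algebra_simps)
      also have "\<dots> = (1/2) *\<^sub>R abs_L2 (?v r)" by (simp add: abs_L2_scaleR[OF sqv])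
      finally have "norm (abs_L2 (\<lambda>x. - ?d r x) - ?g r) = 1/2 * norm (abs_L2 (?v r))" by simp
      also have "norm (abs_L2 (?v r)) \<le> sqrt (C * (e\<^sup>2 powr s)\<^sup>2 * \<sigma>)"
        unfolding \<sigma>_def using C(2)[OF e, of r] r by (intro real_le_rsqrt) auto
      also have "sqrt (C * (e\<^sup>2 powr s)\<^sup>2 * \<sigma>) = sqrt C * (e\<^sup>2 powr s) * sqrt \<sigma>"
        by (simp add: real_sqrt_mult)
      finally show "norm (abs_L2 (\<lambda>x. - ?d r x) - ?g r) \<le> 1/2 * (sqrt C * (e\<^sup>2 powr s) * sqrt \<sigma>)" by simp
    qed
    then show ?thesis by (simp add: \<sigma>_def mult_ac)
  qed
  moreover have "0 \<le> M * (1/2 * sqrt C) * a" using M0 C(1) a by simp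
  ultimately show ?thesis by blast
qed

lemma packet_mult_cnj: "packet A w x * packet A (- w) x = complex_of_real (gauss 2 (A *v x))"
proof -
  have "packet A w x * packet A (- w) x =
      (cis (w \<bullet> x) * cis ((- w) \<bullet> x)) * complex_of_real (gauss 1 (A *v x) * gauss 1 (A *v x))"
    by (simp only: packet_def of_real_mult mult_ac)
  then show ?thesis by (simp add: cis_mult gauss_mult)
qed

text \<open>The derivative falls on the test packet, where it is multiplication by the rate.\<close>

lemma directional_deriv_packet:
  fixes A A' :: "real ^ 'n ^ 'n"
  assumes inv: "A ** A' = mat 1"
  shows "directional_deriv \<xi> u (packet A w) =
    - (\<integral>x. rep_L2 u x * (packet_rate A w x \<xi> * packet A w x) \<partial>lborel)"
proof -
  have pd: "pderiv_fun j (packet A w) = (\<lambda>x. packet_rate A w x (axis j 1) * packet A w x)" for j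
    by (rule ext) (rule pderiv_fun_packet)
  have int: "integrable lborel (\<lambda>x. rep_L2 u x * (packet_rate A w x (axis j 1) * packet A w x))" for j
    by (intro square_integrable_mult square_integrable_rep poly_packet_square_integrable[OF inv] packet_rate_poly)
  have "rep_L2 u x * (packet_rate A w x \<xi> * packet A w x) =
      (\<Sum>j\<in>UNIV. complex_of_real (\<xi> $ j) * (rep_L2 u x * (packet_rate A w x (axis j 1) * packet A w x)))" for x
    by (subst packet_rate_sum) (simp add: sum_distrib_left sum_distrib_right mult_ac)
  then have "(\<integral>x. rep_L2 u x * (packet_rate A w x \<xi> * packet A w x) \<partial>lborel) =
      (\<Sum>j\<in>UNIV. complex_of_real (\<xi> $ j) * (\<integral>x. rep_L2 u x * (packet_rate A w x (axis j 1) * packet A w x) \<partial>lborel))"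
    using int by simp
  then show ?thesis
    by (simp add: directional_deriv_def distr_pderiv_def distr_of_L2_def distr_of_fun_def pd sum_negf)
qed

text \<open>The right side is free of \<eta>, while the left side is homogeneous in it. The factor
  on the left stems from the squared norm of the transported wave, its square root on the right from
  the norm of the test packet, as the initial wave does not see the flow.\<close>

lemma flow_inner_bound:
  fixes B Q :: "real ^ 'n ^ 'n"
  assumes Q: "pos_semidef Q" and s: "0 < s" and \<eta>: "\<eta> \<in> kalman_space B Q"
    and OU: "OU_semigroup s B Q T" and a: "0 \<le> a"
    and D: "\<And>u. dist_eq (directional_deriv \<xi> (T a u)) (distr_of_L2 (D u))"
    and K: "\<And>u. norm (D u) \<le> K * norm u"
  shows "\<bar>(flow B a *v \<eta>) \<bullet> \<xi>\<bar> * lin_scale (transpose (flow B a)) \<le> K * sqrt (lin_scale (transpose (flow B a)))"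
proof -
  let ?w = "flow B a *v \<eta>"
  define \<kappa> where "\<kappa> = lin_scale (transpose (flow B a))"
  have \<kappa>: "0 < \<kappa>" unfolding \<kappa>_def by (rule lin_scale_pos[OF transpose_inverse[OF flow_inverse]])
  define g where "g = (\<integral>y. gauss 2 y \<partial>(lborel :: (real ^ 'n) measure))"
  have g: "0 < g" by (simp add: g_def integral_gauss)
  obtain C where C: "C \<ge> 0" "\<And>e. e > 0 \<Longrightarrow> norm (T a (abs_L2 (wave B \<eta> e 0)) - abs_L2 (wave B \<eta> e a)) \<le>
      C * (e\<^sup>2 powr s) * sqrt (lin_scale (e *\<^sub>R (mat 1 :: real ^ 'n ^ 'n)))"
    using wave_transport_error[OF Q s \<eta> OU a] by blast
  define N where "N = norm (transpose (flow B a) *v \<xi>)"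
  \<comment> \<open>A bound, after rescaling the variable and for e \<le> 1, for the squared norm of
    rate times packet; only the volume factor then depends on e.\<close>
  define W where "W = (\<integral>y. ((?w \<bullet> \<xi>)\<^sup>2 + N\<^sup>2 * (norm y)\<^sup>2) * gauss 2 y \<partial>(lborel :: (real ^ 'n) measure))"
  have Wint: "integrable lborel (\<lambda>y :: real ^ 'n. ((?w \<bullet> \<xi>)\<^sup>2 + N\<^sup>2 * (norm y)\<^sup>2) * gauss 2 y)"
  proof (rule integrable_poly_gauss[of 2 _ "(?w \<bullet> \<xi>)\<^sup>2 + N\<^sup>2" 2])
    fix y :: "real ^ 'n"
    have "(?w \<bullet> \<xi>)\<^sup>2 * 1 + N\<^sup>2 * (norm y)\<^sup>2 \<le> (?w \<bullet> \<xi>)\<^sup>2 * (1 + norm y)\<^sup>2 + N\<^sup>2 * (1 + norm y)\<^sup>2"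
      by (intro add_mono mult_left_mono power_mono) (auto simp: one_le_power)
    then have "((?w \<bullet> \<xi>)\<^sup>2 + N\<^sup>2 * (norm y)\<^sup>2) * gauss 2 y \<le> (((?w \<bullet> \<xi>)\<^sup>2 + N\<^sup>2) * (1 + norm y)\<^sup>2) * gauss 2 y"
      by (intro mult_right_mono) (auto simp: distrib_right)
    then show "norm (((?w \<bullet> \<xi>)\<^sup>2 + N\<^sup>2 * (norm y)\<^sup>2) * gauss 2 y) \<le> ((?w \<bullet> \<xi>)\<^sup>2 + N\<^sup>2) * ((1 + norm y)\<^sup>2 * gauss 2 y)"
      by (simp add: mult.assoc)
  qed (simp, measurable)
  have Wm: "(\<lambda>y :: real ^ 'n. ((?w \<bullet> \<xi>)\<^sup>2 + N\<^sup>2 * (norm y)\<^sup>2) * gauss 2 y) \<in> borel_measurable borel"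
    by measurable
  have W0: "0 \<le> W" unfolding W_def by (intro Bochner_Integration.integral_nonneg) simp
  have main: "\<bar>?w \<bullet> \<xi>\<bar> * \<kappa> * g \<le> K * g * sqrt \<kappa> + (C * sqrt (\<kappa> * W)) * (e\<^sup>2 powr s)" if e: "0 < e" "e \<le> 1" for e
  proof -
    let ?A = "e *\<^sub>R transpose (flow B a)"
    define \<sigma> where "\<sigma> = lin_scale (e *\<^sub>R (mat 1 :: real ^ 'n ^ 'n))"
    have \<sigma>: "0 < \<sigma>" unfolding \<sigma>_def
      using e by (intro lin_scale_pos[of _ "(1 / e) *\<^sub>R mat 1"]) (simp add: scaleR_matrix_mult)
    have inv: "?A ** ((1 / e) *\<^sub>R transpose (flow B (- a))) = mat 1" using e by (intro flow_packet_inverse) simp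
    have inv0: "(e *\<^sub>R transpose (flow B 0)) ** ((1 / e) *\<^sub>R transpose (flow B (- 0))) = mat 1"
      using e by (intro flow_packet_inverse) simp
    have lA: "lin_scale ?A = \<sigma> * \<kappa>"
      unfolding \<sigma>_def \<kappa>_def using e by (intro lin_scale_scaleR[OF transpose_inverse[OF flow_inverse]]) simp
    define U0 where "U0 = abs_L2 (wave B \<eta> e 0)"
    define Ua where "Ua = abs_L2 (wave B \<eta> e a)"
    have U0: "norm U0 = sqrt (\<sigma> * g)"
      using norm_packet[OF inv0, of "flow B 0 *v \<eta>"]
      by (intro real_sqrt_unique[symmetric]) (simp_all add: U0_def wave_def g_def \<sigma>_def flow_0)
    \<comment> \<open>Pairings are taken without conjugation; the frequency \<open>- ?w\<close>
      supplies it, making this the conjugate of the wave at time \<open>a\<close>.\<close>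
    let ?\<phi> = "packet ?A (- ?w)"
    have \<phi>: "?\<phi> \<in> schwartz" by (rule packet_schwartz[OF inv])
    note sq\<phi> = schwartz_square_integrable[OF \<phi>]
    have n\<phi>: "norm (abs_L2 ?\<phi>) = sqrt (\<sigma> * \<kappa> * g)"
      using norm_packet[OF inv, of "- ?w"] lA by (intro real_sqrt_unique[symmetric]) (simp_all add: g_def)
    define d where "d x = packet_rate ?A (- ?w) x \<xi> * ?\<phi> x" for x
    have sqd: "square_integrable d"
      unfolding d_def by (intro poly_packet_square_integrable[OF inv] packet_rate_poly)
    define Y where "Y = T a U0"
    have sqw: "square_integrable (wave B \<eta> e a)" using e by (intro square_integrable_wave) simp
    have "- (\<integral>x. rep_L2 Y x * d x \<partial>lborel) = (\<integral>x. rep_L2 (D U0) x * ?\<phi> x \<partial>lborel)"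
      using D[of U0] \<phi> directional_deriv_packet[OF inv, of \<xi> Y "- ?w"]
      by (simp add: dist_eq_def d_def Y_def distr_of_L2_def distr_of_fun_def)
    then have "cmod (\<integral>x. rep_L2 Y x * d x \<partial>lborel) = cmod (\<integral>x. rep_L2 (D U0) x * ?\<phi> x \<partial>lborel)"
      by (metis norm_minus_cancel)
    also have "\<dots> \<le> norm (D U0) * norm (abs_L2 ?\<phi>)"
      using integral_mult_le_norm_L2[OF square_integrable_rep sq\<phi>, of "D U0"] by (simp add: abs_rep_L2)
    also have "\<dots> \<le> (K * norm U0) * norm (abs_L2 ?\<phi>)" by (intro mult_right_mono K norm_ge_zero)
    also have "\<dots> = K * g * sqrt \<kappa> * \<sigma>"
    proof -
      have "sqrt (\<sigma> * g) * sqrt (\<sigma> * \<kappa> * g) = sqrt ((\<sigma> * g)\<^sup>2 * \<kappa>)"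
        unfolding real_sqrt_mult[symmetric] by (simp only: power2_eq_square mult_ac)
      also have "\<dots> = \<sigma> * g * sqrt \<kappa>" using \<sigma> g by (simp add: real_sqrt_mult abs_mult)
      finally show ?thesis unfolding U0 n\<phi> by (simp add: mult_ac)
    qed
    finally have 1: "cmod (\<integral>x. rep_L2 Y x * d x \<partial>lborel) \<le> K * g * sqrt \<kappa> * \<sigma>" .
    have nd: "norm (abs_L2 d) \<le> sqrt (\<sigma> * \<kappa> * W)"
    proof (rule real_le_rsqrt)
      have "(cmod (d x))\<^sup>2 \<le> ((?w \<bullet> \<xi>)\<^sup>2 + N\<^sup>2 * (norm (?A *v x))\<^sup>2) * gauss 2 (?A *v x)" for x
      proof -
        have "(cmod (packet_rate ?A (- ?w) x \<xi>))\<^sup>2 = (?w \<bullet> \<xi>)\<^sup>2 + ((?A *v x) \<bullet> (?A *v \<xi>))\<^sup>2"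
          by (simp only: cmod_power2 packet_rate_def) simp
        also have "((?A *v x) \<bullet> (?A *v \<xi>))\<^sup>2 \<le> (norm (?A *v x) * norm (?A *v \<xi>))\<^sup>2"
          by (intro abs_le_square_iff[THEN iffD1]) (simp add: Cauchy_Schwarz_ineq2)
        also have "\<dots> \<le> (norm (?A *v x) * N)\<^sup>2"
        proof (intro power_mono mult_left_mono)
          \<comment> \<open>Here e \<le> 1 enters, to make the bound uniform in e.\<close>
          show "norm (?A *v \<xi>) \<le> N"
            unfolding scaleR_matrix_vector norm_scaleR N_def using e by (simp only: abs_of_pos) (intro mult_left_le_one_le, auto)
        qed auto
        finally have "(cmod (packet_rate ?A (- ?w) x \<xi>))\<^sup>2 \<le> (?w \<bullet> \<xi>)\<^sup>2 + N\<^sup>2 * (norm (?A *v x))\<^sup>2"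
          by (simp add: power_mult_distrib mult.commute)
        then show ?thesis
          unfolding d_def norm_mult power_mult_distrib cmod_packet gauss_square by (intro mult_right_mono) auto
      qed
      then have "(\<integral>x. (cmod (d x))\<^sup>2 \<partial>lborel) \<le> (\<integral>x. ((?w \<bullet> \<xi>)\<^sup>2 + N\<^sup>2 * (norm (?A *v x))\<^sup>2) * gauss 2 (?A *v x) \<partial>lborel)"
        using sqd Wint integrable_linear_image[OF inv Wm]
        by (intro integral_mono) (auto simp: square_integrable_def)
      also have "\<dots> = \<sigma> * \<kappa> * W"
        unfolding W_def using integral_linear_image[OF inv Wm] lA by simp
      finally show "(norm (abs_L2 d))\<^sup>2 \<le> \<sigma> * \<kappa> * W" unfolding norm_abs_L2[OF sqd] .
    qed
    have "cmod ((\<integral>x. rep_L2 Y x * d x \<partial>lborel) - (\<integral>x. wave B \<eta> e a x * d x \<partial>lborel)) =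
        cmod (\<integral>x. (rep_L2 Y x - wave B \<eta> e a x) * d x \<partial>lborel)"
      using square_integrable_mult[OF square_integrable_rep[of Y] sqd] square_integrable_mult[OF sqw sqd]
      by (simp add: left_diff_distrib)
    also have "\<dots> \<le> norm (Y - Ua) * norm (abs_L2 d)"
      using integral_mult_le_norm_L2[OF square_integrable_diff[OF square_integrable_rep[of Y] sqw] sqd]
      unfolding abs_L2_diff[OF square_integrable_rep[of Y] sqw, symmetric] abs_rep_L2 Ua_def .
    also have "\<dots> \<le> (C * (e\<^sup>2 powr s) * sqrt \<sigma>) * sqrt (\<sigma> * \<kappa> * W)"
      unfolding Y_def Ua_def U0_def \<sigma>_def
      using C(1) \<sigma> by (intro mult_mono C(2)[OF e(1)] nd[unfolded \<sigma>_def]) (auto simp: \<sigma>_def)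
    also have "\<dots> = (C * sqrt (\<kappa> * W)) * (e\<^sup>2 powr s) * \<sigma>"
      using \<sigma> by (simp add: real_sqrt_mult)
    finally have 2: "cmod ((\<integral>x. rep_L2 Y x * d x \<partial>lborel) - (\<integral>x. wave B \<eta> e a x * d x \<partial>lborel)) \<le>
        (C * sqrt (\<kappa> * W)) * (e\<^sup>2 powr s) * \<sigma>" .
    \<comment> \<open>The Gaussian part of the rate is real, so the imaginary part isolates the
      frequency.\<close>
    have "Im (\<integral>x. wave B \<eta> e a x * d x \<partial>lborel) = (\<integral>x. Im (wave B \<eta> e a x * d x) \<partial>lborel)"
      by (rule integral_Im[symmetric]) (rule square_integrable_mult[OF sqw sqd])
    also have "\<dots> = (\<integral>x. (- (?w \<bullet> \<xi>)) * gauss 2 (?A *v x) \<partial>lborel)"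
    proof (rule Bochner_Integration.integral_cong[OF refl])
      fix x
      have "wave B \<eta> e a x * d x = packet_rate ?A (- ?w) x \<xi> * complex_of_real (gauss 2 (?A *v x))"
        unfolding d_def wave_def packet_mult_cnj[of ?A ?w x, symmetric] by (simp only: mult_ac)
      then show "Im (wave B \<eta> e a x * d x) = (- (?w \<bullet> \<xi>)) * gauss 2 (?A *v x)"
        by (simp only: packet_rate_def) simp
    qed
    also have "\<dots> = (- (?w \<bullet> \<xi>)) * (\<sigma> * \<kappa> * g)"
      using integral_linear_image[OF inv gauss_measurable[of 2]] lA by (simp only: integral_mult_right_zero g_def) simp
    finally have "\<bar>?w \<bullet> \<xi>\<bar> * (\<sigma> * \<kappa> * g) = \<bar>Im (\<integral>x. wave B \<eta> e a x * d x \<partial>lborel)\<bar>"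
      using \<sigma> \<kappa> g by (simp add: abs_mult)
    also have "\<dots> \<le> cmod (\<integral>x. wave B \<eta> e a x * d x \<partial>lborel)" by (rule abs_Im_le_cmod)
    also have "\<dots> \<le> K * g * sqrt \<kappa> * \<sigma> + (C * sqrt (\<kappa> * W)) * (e\<^sup>2 powr s) * \<sigma>"
      using 1 2 norm_triangle_sub[of "\<integral>x. wave B \<eta> e a x * d x \<partial>lborel" "\<integral>x. rep_L2 Y x * d x \<partial>lborel"]
      by (simp add: norm_minus_commute)
    finally have "\<sigma> * (\<bar>?w \<bullet> \<xi>\<bar> * \<kappa> * g) \<le> \<sigma> * (K * g * sqrt \<kappa> + (C * sqrt (\<kappa> * W)) * (e\<^sup>2 powr s))"
      by (simp add: algebra_simps)
    then show ?thesis using \<sigma> by (simp only: mult_le_cancel_left_pos)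
  qed
  \<comment> \<open>\<eta> is still fixed, hence so are \<open>C\<close> and \<open>W\<close>; only
    the power of e varies in the error term.\<close>
  have "(\<lambda>k. (1 / real (Suc k))\<^sup>2 powr s) \<longlonglongrightarrow> 0"
  proof (rule tendsto_zero_powrI)
    have "(\<lambda>k. (1 / real (Suc k))\<^sup>2) \<longlonglongrightarrow> 0\<^sup>2" by (intro tendsto_intros LIMSEQ_Suc[OF lim_1_over_n])
    then show "(\<lambda>k. (1 / real (Suc k))\<^sup>2) \<longlonglongrightarrow> 0" by simp
  qed (use s in auto)
  then have "(\<lambda>k. K * g * sqrt \<kappa> + (C * sqrt (\<kappa> * W)) * ((1 / real (Suc k))\<^sup>2 powr s)) \<longlonglongrightarrow>
      K * g * sqrt \<kappa> + (C * sqrt (\<kappa> * W)) * 0"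
    by (intro tendsto_intros)
  then have "\<bar>?w \<bullet> \<xi>\<bar> * \<kappa> * g \<le> K * g * sqrt \<kappa> + (C * sqrt (\<kappa> * W)) * 0"
    by (rule LIMSEQ_le_const) (intro exI allI impI main, auto)
  then have "g * (\<bar>?w \<bullet> \<xi>\<bar> * \<kappa>) \<le> g * (K * sqrt \<kappa>)" by (simp add: mult_ac)
  then show ?thesis using g unfolding \<kappa>_def by (simp only: mult_le_cancel_left_pos)
qed

theorem theorem2p1:
  fixes B Q :: "real ^ 'n ^ 'n" and \<xi>0 :: "real ^ 'n" and s :: real
    and T :: "real \<Rightarrow> 'n::finite L2 \<Rightarrow> 'n L2"
  assumes "s > 0"
    and "pos_semidef Q"
    and "OU_semigroup s B Q T"
    and "\<exists>t>0. L2_bounded (\<lambda>u. directional_deriv \<xi>0 (T t u))"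
  shows "\<xi>0 \<in> (kalman_space B Q)\<^sup>\<bottom>"
proof -
  obtain t D where t: "t > 0" and D: "bounded_clinear_L2 D"
    "\<And>u. dist_eq (directional_deriv \<xi>0 (T t u)) (distr_of_L2 (D u))"
    using assms(4) by (auto simp: L2_bounded_def)
  obtain K where K: "\<And>u. norm (D u) \<le> norm u * K"
    using bounded_linear.bounded D(1) unfolding bounded_clinear_L2_def by blast
  define \<kappa> where "\<kappa> = lin_scale (transpose (flow B t))"
  have \<kappa>: "0 < \<kappa>" unfolding \<kappa>_def by (rule lin_scale_pos[OF transpose_inverse[OF flow_inverse]])
  have "\<zeta> \<bullet> \<xi>0 = 0" if \<zeta>: "\<zeta> \<in> kalman_space B Q" for \<zeta>
  proof (rule ccontr)
    assume nz: "\<zeta> \<bullet> \<xi>0 \<noteq> 0"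
    \<comment> \<open>Chosen so that, for this multiple of the preimage of \<zeta> under the flow,
      the left side of \<open>flow_inner_bound\<close> is |K sqrt \<kappa>| + 1 and exceeds the
      right side.\<close>
    define c where "c = (\<bar>K * sqrt \<kappa>\<bar> + 1) / (\<bar>\<zeta> \<bullet> \<xi>0\<bar> * \<kappa>)"
    have "c *\<^sub>R (flow B (- t) *v \<zeta>) \<in> kalman_space B Q"
      by (intro subspace_scale[OF subspace_kalman_space] flow_kalman \<zeta>)
    then have "\<bar>(flow B t *v (c *\<^sub>R (flow B (- t) *v \<zeta>))) \<bullet> \<xi>0\<bar> * \<kappa> \<le> K * sqrt \<kappa>"
      unfolding \<kappa>_def using t K
      by (intro flow_inner_bound[OF assms(2,1) _ assms(3) _ D(2)]) (auto simp: mult.commute)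
    moreover have "flow B t *v (c *\<^sub>R (flow B (- t) *v \<zeta>)) = c *\<^sub>R \<zeta>"
      by (simp add: matrix_vector_mult_scaleR matrix_inverse_vector(1)[OF flow_inverse])
    ultimately have "\<bar>c\<bar> * (\<bar>\<zeta> \<bullet> \<xi>0\<bar> * \<kappa>) \<le> K * sqrt \<kappa>" by (simp add: abs_mult)
    moreover have "\<bar>c\<bar> * (\<bar>\<zeta> \<bullet> \<xi>0\<bar> * \<kappa>) = \<bar>K * sqrt \<kappa>\<bar> + 1"
      using nz \<kappa> by (simp add: c_def abs_mult)
    ultimately show False by linarith
  qed
  then show ?thesis by (simp add: orthogonal_comp_def orthogonal_def)
qed

end
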